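(* Let $V$ be a complex vector space with $\dim V=k$ equipped with a nondegenerate symmetric bilinear form $b$. Identify $V^{\otimes n}$ with the space of multilinear forms on $V^n$. A basis for $(V^{\otimes n})^{\mathrm{SO}(V)}$ is given by the set of 1-regular arc diagrams on $n$ vertices which include at most one hyperedge satisfying the painting rule, and whose arcs can be decomposed into at most $k$ weak nestings. In other words, there are either $0$ or $k$ painted vertices, and each vertex is either painted or else is incident to exactly one arc. Assuming $k\le n$, we have the following possibilities: - if $n,k$ are both even, graphs may have $0$ or $1$ hyperedge; - if $n,k$ are both odd, graphs must have $1$ hyperedge; - if $n$ is even and $k$ is odd, graphs must have $0$ hyperedges; - if $n$ is odd and $k$ is even, there exist no (nonzero) $\mathrm{SO}(V)$-invariants.
   Context: For $1\le i\le j\le n$, $f_{ij}(v_1,\dots,v_n)=b(v_i,v_j)$. An arc diagram on $n$ vertices is a multigraph on vertices $1,\dots,n$ (drawn left to right), with each edge (arc) written $(i,j)$, $i\le j$. A hyperedge is a choice of $k$ vertices $i_1<\dots<i_k$, called painted vertices, regarded as an edge incident to these $k$ vertices. The graph is 1-regular if every vertex has degree 1, counting arcs and the hyperedge. It represents the product of the $f_{ij}$ over its arcs $(i,j)$, multiplied by $\det(v_{i_1},\dots,v_{i_k})$ (with respect to a fixed basis of $V$) if the hyperedge is present. A weak nesting is a set of arcs that are pairwise weakly nested, where $(i,j),(i',j')$ are weakly nested if $i\le i'\le j'\le j$ or $i'\le i\le j\le j'$. Let $M$ be the multiset of arcs. Let $C_1(M)$ be the sub-multiset of those $(i,j)\in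 M$ for which there is no $(i',j')\in M$ with $i'<i$ and $j'<j$, and $C_{\ell+1}=C_1(M\setminus\bigcup_{s\le\ell}C_s)$, until $M$ is exhausted. Painting rule: for each $\ell$ for which $C_\ell$ exists, the $\ell$th painted vertex lies weakly left of the arcs in $C_\ell$, i.e. $i_\ell\le i$ for every $(i,j)\in C_\ell$ (vacuous for other $\ell$). *)

theory Defs
  imports Complex_Main "HOL-Library.Multiset" "HOL-Library.Function_Algebras"
    "Jordan_Normal_Form.Determinant"
begin

section \<open>Bases\<close>

text \<open>The names \<open>Modules.module\<close> and \<open>Vector_Spaces.linear\<close> are written in full because HOL-Algebra
  has a locale \<open>module\<close> as well.\<close>

definition family_basis ::
  "('a::field \<Rightarrow> 'b::ab_group_add \<Rightarrow> 'b) \<Rightarrow> 'i set \<Rightarrow> ('i \<Rightarrow> 'b) \<Rightarrow> 'b set \<Rightarrow> bool"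
where
  "family_basis scale I f W \<longleftrightarrow>
     inj_on f I \<and> \<not> Modules.module.dependent scale (f ` I) \<and> Modules.module.span scale (f ` I) = W"

text \<open>Determinant of the \<open>k\<close> vectors \<open>u 0, \<dots>, u (k - 1)\<close> with respect to the basis
  \<open>e 0, \<dots>, e (k - 1)\<close>; the coordinates of \<open>u c\<close> form column \<open>c\<close>.\<close>

definition det_vectors ::
  "(complex \<Rightarrow> 'v::ab_group_add \<Rightarrow> 'v) \<Rightarrow> nat \<Rightarrow> (nat \<Rightarrow> 'v) \<Rightarrow> (nat \<Rightarrow> 'v) \<Rightarrow> complex"
where
  "det_vectors scale k e u =
     Determinant.det (mat k k (\<lambda>(r, c). Modules.module.representation scale (e ` {..<k}) (u c) (e r)))"


section \<open>The special orthogonal group and its invariant multilinear forms\<close>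

definition symmetric_bilinear_form ::
  "(complex \<Rightarrow> 'v::ab_group_add \<Rightarrow> 'v) \<Rightarrow> ('v \<Rightarrow> 'v \<Rightarrow> complex) \<Rightarrow> bool"
where
  "symmetric_bilinear_form scale b \<longleftrightarrow>
     (\<forall>x. Vector_Spaces.linear scale (*) (b x)) \<and>
     (\<forall>y. Vector_Spaces.linear scale (*) (\<lambda>x. b x y)) \<and>
     (\<forall>x y. b x y = b y x)"

definition nondegenerate_form :: "('v::zero \<Rightarrow> 'v \<Rightarrow> complex) \<Rightarrow> bool" where
  "nondegenerate_form b \<longleftrightarrow> (\<forall>x. (\<forall>y. b x y = 0) \<longrightarrow> x = 0)"

text \<open>\<open>det_vectors scale k e (\<lambda>c. g (e c))\<close> is the determinant of the endomorphism \<open>g\<close>.\<close>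

definition special_orthogonal ::
  "(complex \<Rightarrow> 'v::ab_group_add \<Rightarrow> 'v) \<Rightarrow> ('v \<Rightarrow> 'v \<Rightarrow> complex) \<Rightarrow> nat \<Rightarrow> (nat \<Rightarrow> 'v) \<Rightarrow> ('v \<Rightarrow> 'v) set"
where
  "special_orthogonal scale b k e =
     {g. Vector_Spaces.linear scale scale g \<and> (\<forall>x y. b (g x) (g y) = b x y) \<and>
         det_vectors scale k e (\<lambda>c. g (e c)) = 1}"

text \<open>A function on \<open>V\<^sup>n\<close> is encoded as a function of a sequence \<open>v :: nat \<Rightarrow> 'v\<close> that depends only on
  the entries \<open>v 1, \<dots>, v n\<close>. For \<open>n = 0\<close> these are the constants.\<close>

definition multilinear_forms ::
  "(complex \<Rightarrow> 'v::ab_group_add \<Rightarrow> 'v) \<Rightarrow> nat \<Rightarrow> ((nat \<Rightarrow> 'v) \<Rightarrow> complex) set"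
where
  "multilinear_forms scale n =
     {T. (\<forall>v w. (\<forall>i\<in>{1..n}. v i = w i) \<longrightarrow> T v = T w) \<and>
         (\<forall>v. \<forall>i\<in>{1..n}. Vector_Spaces.linear scale (*) (\<lambda>x. T (v(i := x))))}"

definition form_scale :: "complex \<Rightarrow> ('x \<Rightarrow> complex) \<Rightarrow> 'x \<Rightarrow> complex" where
  "form_scale c T = (\<lambda>v. c * T v)"

lemma vector_space_form_scale: "vector_space form_scale"
  by unfold_locales (auto simp: form_scale_def fun_eq_iff algebra_simps)

text \<open>A group element \<open>g\<close> sends a form \<open>T\<close> to \<open>T (g\<^sup>-\<^sup>1 v\<^sub>1, \<dots>, g\<^sup>-\<^sup>1 v\<^sub>n)\<close>; since \<open>g\<close> ranges over a group,
  the fixed forms are the \<open>T\<close> below.\<close>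

definition SO_invariants ::
  "(complex \<Rightarrow> 'v::ab_group_add \<Rightarrow> 'v) \<Rightarrow> ('v \<Rightarrow> 'v \<Rightarrow> complex) \<Rightarrow> nat \<Rightarrow> (nat \<Rightarrow> 'v) \<Rightarrow> nat
     \<Rightarrow> ((nat \<Rightarrow> 'v) \<Rightarrow> complex) set"
where
  "SO_invariants scale b k e n =
     {T \<in> multilinear_forms scale n.
        \<forall>g\<in>special_orthogonal scale b k e. \<forall>v. T (\<lambda>i. g (v i)) = T v}"


section \<open>Arc diagrams\<close>

type_synonym arc = "nat \<times> nat"

text \<open>The hyperedge is given by its set of painted vertices, and \<open>painted D = {}\<close> means that there is
  no hyperedge. In particular a diagram has at most one hyperedge.\<close>

datatype diagram = Diagram (arcs: "arc multiset") (painted: "nat set")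

definition has_hyperedge :: "diagram \<Rightarrow> bool" where
  "has_hyperedge D \<longleftrightarrow> painted D \<noteq> {}"

definition arc_diagram :: "nat \<Rightarrow> nat \<Rightarrow> diagram \<Rightarrow> bool" where
  "arc_diagram n k D \<longleftrightarrow>
     (\<forall>(i, j)\<in>#arcs D. 1 \<le> i \<and> i \<le> j \<and> j \<le> n) \<and>
     painted D \<subseteq> {1..n} \<and>
     (has_hyperedge D \<longrightarrow> card (painted D) = k)"

text \<open>An arc \<open>(i, i)\<close> contributes 2 to the degree of \<open>i\<close>.\<close>

definition vertex_degree :: "diagram \<Rightarrow> nat \<Rightarrow> nat" where
  "vertex_degree D v =
     (\<Sum>(i, j)\<in>#arcs D. of_bool (i = v) + of_bool (j = v)) + of_bool (v \<in> painted D)"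

definition one_regular :: "nat \<Rightarrow> diagram \<Rightarrow> bool" where
  "one_regular n D \<longleftrightarrow> (\<forall>v\<in>{1..n}. vertex_degree D v = 1)"

fun weakly_nested :: "arc \<Rightarrow> arc \<Rightarrow> bool" where
  "weakly_nested (i, j) (i', j') \<longleftrightarrow>
     (i \<le> i' \<and> i' \<le> j' \<and> j' \<le> j) \<or> (i' \<le> i \<and> i \<le> j \<and> j \<le> j')"

definition weak_nesting :: "arc multiset \<Rightarrow> bool" where
  "weak_nesting N \<longleftrightarrow> (\<forall>a\<in>#N. \<forall>a'\<in>#N. weakly_nested a a')"

definition decomposes_into_weak_nestings :: "nat \<Rightarrow> arc multiset \<Rightarrow> bool" where
  "decomposes_into_weak_nestings k M \<longleftrightarrow>
     (\<exists>Ns. length Ns \<le> k \<and> (\<forall>N\<in>set Ns. weak_nesting N) \<and> sum_list Ns = M)"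

definition first_layer :: "arc multiset \<Rightarrow> arc multiset" where
  "first_layer M = {#(i, j) \<in># M. \<not> (\<exists>(i', j')\<in>#M. i' < i \<and> j' < j)#}"

primrec remaining_arcs :: "arc multiset \<Rightarrow> nat \<Rightarrow> arc multiset" where
  "remaining_arcs M 0 = M"
| "remaining_arcs M (Suc l) = remaining_arcs M l - first_layer (remaining_arcs M l)"

text \<open>Layers and painted vertices are counted from 0: \<open>layer M l\<close> is \<open>C\<close> with index \<open>l + 1\<close>, and
  \<open>painted_vertex D l\<close> is the painted vertex with index \<open>l + 1\<close>.\<close>

definition layer :: "arc multiset \<Rightarrow> nat \<Rightarrow> arc multiset" where
  "layer M l = first_layer (remaining_arcs M l)"

definition painted_vertex :: "diagram \<Rightarrow> nat \<Rightarrow> nat" where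
  "painted_vertex D l = sorted_list_of_set (painted D) ! l"

text \<open>A layer \<open>C\<close> exists as long as the arcs are not exhausted, that is, when it is nonempty.\<close>

definition painting_rule :: "diagram \<Rightarrow> bool" where
  "painting_rule D \<longleftrightarrow>
     (\<forall>l. layer (arcs D) l \<noteq> {#} \<longrightarrow>
        l < card (painted D) \<and> (\<forall>(i, j)\<in>#layer (arcs D) l. painted_vertex D l \<le> i))"

definition basis_diagrams :: "nat \<Rightarrow> nat \<Rightarrow> diagram set" where
  "basis_diagrams n k =
     {D. arc_diagram n k D \<and> one_regular n D \<and> (has_hyperedge D \<longrightarrow> painting_rule D) \<and>
         decomposes_into_weak_nestings k (arcs D)}"

definition diagram_form ::
  "(complex \<Rightarrow> 'v::ab_group_add \<Rightarrow> 'v) \<Rightarrow> ('v \<Rightarrow> 'v \<Rightarrow> complex) \<Rightarrow> nat \<Rightarrow> (nat \<Rightarrow> 'v) \<Rightarrow> diagram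
     \<Rightarrow> (nat \<Rightarrow> 'v) \<Rightarrow> complex"
where
  "diagram_form scale b k e D v =
     (\<Prod>(i, j)\<in>#arcs D. b (v i) (v j)) *
     (if has_hyperedge D then det_vectors scale k e (\<lambda>l. v (painted_vertex D l)) else 1)"

end

theory Submission
  imports Defs
begin

text \<open>
Fix a frame of \<open>V\<close> that is orthonormal for \<open>b\<close>. A multilinear form is determined by its values on
tuples of frame vectors, so it is a function of words \<open>w\<close> with letters below \<open>k\<close>. A 1-regular
diagram is a set \<open>S\<close> of painted vertices with a fixed-point-free involution \<open>\<pi>\<close> of the other vertices, and
on a word its form is \<open>0\<close> unless the letters agree along all arcs, and otherwise the determinant of the
letters on \<open>S\<close> (which is \<open>1\<close> without hyperedge).

Spanning by all 1-regular diagrams. Subtract from an invariant its orthogonal projection to the span of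
the diagrams. The difference \<open>A\<close> is invariant and orthogonal to all diagrams, and so are its contractions
in two positions, which vanish by induction on the number of vertices. Let \<open>E a b\<close> sum over all ways to
change one letter \<open>a\<close> of a word to \<open>b\<close>; the derivative of the invariance under plane rotations says
\<open>E a b A = E b a A\<close>, and \<open>E b a\<close> is the adjoint of \<open>E a b\<close>. As \<open>A\<close> has no contractions, the sum of all
\<open>E a b (E a b A)\<close> is \<open>n A\<close>, so the squared norms of the \<open>E a b A\<close> sum to \<open>n\<close> times that of \<open>A\<close>. But the
diagonal terms alone contribute the weight \<open>\<Sum> m\<^sup>2 \<ge> \<Sum> m = n\<close> to a word whose letters have
multiplicities \<open>m\<close>. Hence \<open>A\<close> lives on words without repeated letters and is annihilated by the
off-diagonal \<open>E a b\<close>. For \<open>n > 0\<close> this forces \<open>A = 0\<close>, except for \<open>n = k\<close>, where \<open>A\<close> is alternating, hence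
a multiple of the determinant, and again \<open>0\<close> by orthogonality (\<open>invariant_orthogonal_to_diagrams_vanishes\<close>).

Straightening. Diagrams are compared first by the sum of their painted vertices and then by the sum of
\<open>i j\<close> over the arcs \<open>(i, j)\<close>. A diagram outside the proposed basis has either \<open>k + 1\<close> arcs whose left and
right ends both increase, or such a chain of \<open>l\<close> arcs that all start left of the \<open>l\<close>-th painted vertex.
In the first case take the left ends of the chain, in the second these left ends and the painted vertices
from the \<open>l\<close>-th on. Alternating the form over these \<open>k + 1\<close> vertices gives \<open>0\<close> because \<open>V\<close> has dimension
\<open>k\<close>. By the rearrangement inequality the diagram itself is the largest term of the alternating sum,
so it is a combination of smaller diagrams (\<open>word_form_straighten\<close>).

Independence. Give the arcs of the layer with index \<open>l\<close> and the painted vertex with index \<open>l\<close> of a basis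
diagram the letter \<open>l\<close>. The painting rule and the nesting of each layer say that in each letter class the
painted vertex comes first and each arc encloses the next. These two properties make the diagram the
smallest one compatible with the colouring. So the matrix of values of basis diagrams on
these words is triangular (\<open>colouring_triangular\<close>).
\<close>

section \<open>Alternating functions\<close>

text \<open>Permutations are products of transpositions. The domain \<open>X\<close> allows \<open>G\<close> to be alternating on a restricted set of functions only.\<close>

lemma transposition_antisymmetric_imp_sign:
  fixes G :: "('a \<Rightarrow> 'b) \<Rightarrow> complex"
  assumes "finite S"
    and "\<And>w x y. w \<in> X \<Longrightarrow> x \<in> S \<Longrightarrow> y \<in> S \<Longrightarrow> w \<circ> Transposition.transpose x y \<in> X"
    and "\<And>w x y. w \<in> X \<Longrightarrow> x \<in> S \<Longrightarrow> y \<in> S \<Longrightarrow> x \<noteq> y \<Longrightarrow>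
           G (w \<circ> Transposition.transpose x y) = - G w"
    and "p permutes S" and "w \<in> X"
  shows "G (w \<circ> p) = of_int (sign p) * G w"
  using assms(4,1,5)
proof (induction arbitrary: w rule: permutes_induct)
  case id
  then show ?case by simp
next
  case (swap x y p)
  have "G (w \<circ> (Transposition.transpose x y \<circ> p)) = of_int (sign p) * G (w \<circ> Transposition.transpose x y)"
    using swap.IH[of "w \<circ> Transposition.transpose x y"] swap assms(2) by (simp only: o_assoc)
  moreover have "sign (Transposition.transpose x y \<circ> p) = - sign p"
    using swap.hyps(3) sign_compose[OF permutation_swap_id permutation_permutes[THEN iffD2], of p x y]
      swap.hyps(4) assms(1) by (auto simp: sign_swap_id)
  ultimately show ?case
    by (simp only: assms(3)[OF \<open>w \<in> X\<close> swap.hyps(1-3)] of_int_minus mult_minus_left mult_minus_right)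
qed

text \<open>If \<open>w\<close> takes equal values at two points, composing with their transposition pairs off the terms with opposite signs. Applied to \<open>k + 1\<close> positions and \<open>k\<close> letters, this is the source of all relations between diagrams.\<close>

lemma signed_sum_eq_0_if_not_inj:
  fixes G :: "('a \<Rightarrow> 'b) \<Rightarrow> complex"
  assumes "finite P" and "\<not> inj_on w P"
  shows "(\<Sum>s | s permutes P. of_int (sign s) * G (w \<circ> s)) = 0"
proof -
  obtain x y where xy: "x \<in> P" "y \<in> P" "x \<noteq> y" "w x = w y"
    using assms(2) by (auto simp: inj_on_def)
  let ?t = "Transposition.transpose x y"
  have wt: "w \<circ> ?t = w"
    using xy(4) by (auto simp: fun_eq_iff Transposition.transpose_def)
  have "(\<Sum>s | s permutes P. of_int (sign s) * G (w \<circ> s))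
      = (\<Sum>s | s permutes P. of_int (sign (?t \<circ> s)) * G (w \<circ> (?t \<circ> s)))"
    using setum_permutations_compose_left[OF permutes_swap_id[OF xy(1,2)], of "\<lambda>s. of_int (sign s) * G (w \<circ> s)"] .
  also have "\<dots> = (\<Sum>s | s permutes P. - (of_int (sign s) * G (w \<circ> s)))"
  proof (rule sum.cong)
    fix s assume s: "s \<in> {s. s permutes P}"
    then have "sign (?t \<circ> s) = - sign s"
      using sign_compose[OF permutation_swap_id permutation_permutes[THEN iffD2], of s x y]
        assms(1) xy(3) by (auto simp: sign_swap_id)
    then show "of_int (sign (?t \<circ> s)) * G (w \<circ> (?t \<circ> s)) = - (of_int (sign s) * G (w \<circ> s))"
      using wt by (simp add: o_assoc)
  qed simp
  also have "\<dots> = - (\<Sum>s | s permutes P. of_int (sign s) * G (w \<circ> s))"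
    by (simp add: sum_negf)
  finally show ?thesis by (simp add: eq_neg_iff_add_eq_0)
qed

section \<open>Rearrangement inequalities\<close>

text \<open>Moving the largest argument to itself can only increase the sum, and increases it strictly unless it was fixed already; the rest is induction.\<close>

lemma rearrangement_le_and_strict:
  fixes g :: "nat \<Rightarrow> int"
  assumes "finite C" and "strict_mono_on C g" and "s permutes C"
  shows "(\<Sum>x\<in>C. int (s x) * g x) \<le> (\<Sum>x\<in>C. int x * g x) \<and>
    (s \<noteq> id \<longrightarrow> (\<Sum>x\<in>C. int (s x) * g x) < (\<Sum>x\<in>C. int x * g x))"
  using assms
proof (induction C arbitrary: s rule: finite_linorder_max_induct)
  case empty
  then show ?case by simp
next
  case (insert m C)
  let ?t = "Transposition.transpose m (s m)"
  let ?s = "?t \<circ> s"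
  have perm: "?s permutes C"
    using permutes_insert_lemma[OF insert.prems(2)] .
  have mono: "strict_mono_on C g"
    using insert.prems(1) by (auto simp: strict_mono_on_def)
  note IH = insert.IH[OF mono perm]
  have mC: "m \<notin> C" using insert.hyps by auto
  show ?case
  proof (cases "s m = m")
    case True
    then have "?s = s" by simp
    then show ?thesis using IH True mC insert.hyps(1) by simp
  next
    case False
    define x0 where "x0 = inv_into UNIV s m"
    have s0: "s x0 = m" unfolding x0_def using insert.prems(2) by (meson permutes_inverses(1))
    have x0: "x0 \<in> C" "s m \<in> C"
      using s0 False insert.prems(2) permutes_in_image[OF insert.prems(2)] by (metis insert_iff)+
    have sx: "s x = ?s x" if "x \<in> C" "x \<noteq> x0" for x
    proof -
      have "s x \<noteq> m" "s x \<noteq> s m"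
        using that s0 mC permutes_inj[OF insert.prems(2)] by (auto dest: injD)
      then show ?thesis by simp
    qed
    have sx0: "?s x0 = s m" using s0 by simp
    have A: "(\<Sum>x\<in>C. int (s x) * g x) = (\<Sum>x\<in>C. int (?s x) * g x) + int m * g x0 - int (s m) * g x0"
    proof -
      have "(\<Sum>x\<in>C. int (s x) * g x) = int (s x0) * g x0 + (\<Sum>x\<in>C - {x0}. int (s x) * g x)"
        using insert.hyps(1) x0 by (simp add: sum.remove)
      moreover have "(\<Sum>x\<in>C. int (?s x) * g x) = int (?s x0) * g x0 + (\<Sum>x\<in>C - {x0}. int (?s x) * g x)"
        using insert.hyps(1) x0 by (subst sum.remove) auto
      moreover have "(\<Sum>x\<in>C - {x0}. int (s x) * g x) = (\<Sum>x\<in>C - {x0}. int (?s x) * g x)"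
        by (rule sum.cong) (use sx in auto)
      ultimately show ?thesis using s0 sx0 by simp
    qed
    have "0 < (int m - int (s m)) * (g m - g x0)"
    proof (rule mult_pos_pos)
      show "0 < int m - int (s m)" using insert.hyps(2) x0 by auto
      show "0 < g m - g x0" using insert.prems(1) insert.hyps(2) x0 by (auto simp: strict_mono_on_def)
    qed
    then have "int m * g x0 - int (s m) * g x0 + int (s m) * g m < int m * g m"
      by (simp add: algebra_simps)
    moreover have "(\<Sum>x\<in>insert m C. int (s x) * g x) = int (s m) * g m + (\<Sum>x\<in>C. int (s x) * g x)"
      "(\<Sum>x\<in>insert m C. int x * g x) = int m * g m + (\<Sum>x\<in>C. int x * g x)"
      using insert.hyps(1) mC by auto
    ultimately have "(\<Sum>x\<in>insert m C. int (s x) * g x) < (\<Sum>x\<in>insert m C. int x * g x)"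
      using IH A by linarith
    then show ?thesis by simp
  qed
qed

lemma sum_less_by_exchange:
  fixes A B :: "nat set"
  assumes "finite A" "finite B" "card A = card B" "A \<noteq> B"
    and "\<And>x y. x \<in> A - B \<Longrightarrow> y \<in> B - A \<Longrightarrow> x < y"
  shows "\<Sum>A < \<Sum>B"
proof -
  have card: "card (A - B) = card (B - A)"
    using assms(1-3) by (simp add: card_le_sym_Diff le_antisym)
  have ne: "A - B \<noteq> {}"
    using assms(1-4) card by (metis Diff_eq_empty_iff card_0_eq finite_Diff card.empty equalityI)
  obtain f where f: "bij_betw f (A - B) (B - A)"
    using card assms(1,2) by (metis finite_Diff finite_same_card_bij)
  have "\<Sum>(B - A) = (\<Sum>x\<in>A - B. f x)"
    using sum.reindex_bij_betw[OF f, of "\<lambda>x. x"] by simp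
  moreover have "(\<Sum>x\<in>A - B. x) < (\<Sum>x\<in>A - B. f x)"
    by (rule sum_strict_mono) (use assms ne f in \<open>auto simp: bij_betw_def\<close>)
  moreover have "\<Sum>A = \<Sum>(A - B) + \<Sum>(A \<inter> B)" "\<Sum>B = \<Sum>(B - A) + \<Sum>(A \<inter> B)"
    using assms(1,2) by (metis add.commute sum.Int_Diff, metis add.commute sum.Int_Diff Int_commute)
  ultimately show ?thesis by simp
qed

section \<open>Fixed-point-free involutions and diagrams\<close>

lemma involution_permutes:
  assumes "\<And>x. x \<in> A \<Longrightarrow> p x \<in> A" "\<And>x. x \<in> A \<Longrightarrow> p (p x) = x" "\<And>x. x \<notin> A \<Longrightarrow> p x = x"
  shows "p permutes A"
  by (intro bij_imp_permutes bij_betw_byWitness[where f' = p]) (use assms in auto)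

text \<open>The involution is the identity outside \<open>U\<close>, so it is determined by the arcs.\<close>

definition pairing :: "nat set \<Rightarrow> (nat \<Rightarrow> nat) \<Rightarrow> bool" where
  "pairing U \<pi> \<longleftrightarrow> \<pi> permutes U \<and> (\<forall>x\<in>U. \<pi> x \<noteq> x \<and> \<pi> (\<pi> x) = x)"

lemma pairing_in: "pairing U \<pi> \<Longrightarrow> x \<in> U \<Longrightarrow> \<pi> x \<in> U"
  by (simp add: pairing_def permutes_in_image)

lemma pairing_invol: "pairing U \<pi> \<Longrightarrow> \<pi> (\<pi> x) = x"
  by (metis pairing_def permutes_not_in)

lemma pairingD:
  assumes "pairing U \<pi>" "x \<in> U"
  shows "\<pi> x \<in> U" "\<pi> x \<noteq> x" "\<pi> (\<pi> x) = x"
  using assms pairing_in pairing_invol by (blast, simp add: pairing_def, blast)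

lemma pairing_add:
  assumes "pairing U \<pi>" "i \<notin> U" "j \<notin> U" "i \<noteq> j"
  shows "pairing (insert i (insert j U)) (\<pi>(i := j, j := i))"
  unfolding pairing_def
proof
  let ?p = "\<pi>(i := j, j := i)"
  have \<pi>: "\<pi> x \<noteq> x" "\<pi> (\<pi> x) = x" "\<pi> x \<in> U" "\<pi> x \<noteq> i" "\<pi> x \<noteq> j" if "x \<in> U" for x
    using that assms pairing_in[OF assms(1) that] by (auto simp: pairing_def)
  have *: "\<forall>x\<in>insert i (insert j U). ?p x \<noteq> x \<and> ?p (?p x) = x"
    using assms \<pi> by auto
  then show "\<forall>x\<in>insert i (insert j U). ?p x \<noteq> x \<and> ?p (?p x) = x" .
  show "?p permutes insert i (insert j U)"
  proof (rule involution_permutes)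
    show "?p x \<in> insert i (insert j U)" if "x \<in> insert i (insert j U)" for x
      using that \<pi>(3)[of x] by auto
    show "?p (?p x) = x" if "x \<in> insert i (insert j U)" for x
      using *[THEN bspec, OF that] by (rule conjunct2)
    show "?p x = x" if "x \<notin> insert i (insert j U)" for x
      using that assms(1) permutes_not_in[of \<pi> U x] by (simp add: pairing_def)
  qed
qed

text \<open>\<open>U\<close> is the set of vertices that are not painted; each arc is recorded at its left end.\<close>

definition diagram_of :: "nat set \<Rightarrow> nat set \<Rightarrow> (nat \<Rightarrow> nat) \<Rightarrow> diagram" where
  "diagram_of U S \<pi> = Diagram (image_mset (\<lambda>v. (v, \<pi> v)) (mset_set {v \<in> U. v < \<pi> v})) S"

lemma painted_diagram_of [simp]: "painted (diagram_of U S \<pi>) = S"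
  by (simp add: diagram_of_def)

lemma arcs_diagram_of [simp]:
  "arcs (diagram_of U S \<pi>) = image_mset (\<lambda>v. (v, \<pi> v)) (mset_set {v \<in> U. v < \<pi> v})"
  by (simp add: diagram_of_def)

text \<open>Each vertex lies on exactly one arc and an arc \<open>(i, i)\<close> would give degree 2, so the arcs match the vertices in pairs. Removing one arc removes its two ends from \<open>U\<close>.\<close>

lemma one_regular_arcs_imp_pairing:
  fixes M :: "arc multiset"
  assumes "\<And>i j. (i, j) \<in># M \<Longrightarrow> i \<le> j" and "finite U"
    and "\<And>v. (\<Sum>(i, j)\<in>#M. of_bool (i = v) + of_bool (j = v)) = (of_bool (v \<in> U) :: nat)"
  shows "\<exists>\<pi>. pairing U \<pi> \<and> M = image_mset (\<lambda>v. (v, \<pi> v)) (mset_set {v \<in> U. v < \<pi> v})"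
  using assms
proof (induction M arbitrary: U)
  case empty
  then have "v \<notin> U" for v using empty.prems(3)[of v] by (cases "v \<in> U") auto
  then have U: "U = {}" by blast
  have "pairing {} (\<lambda>x. x)" using permutes_id[of "{}"] by (simp only: pairing_def id_def) blast
  moreover have "{#} = image_mset (\<lambda>v. (v, v)) (mset_set {v \<in> {}. v < v})" by simp
  ultimately show ?case unfolding U by blast
next
  case (add a M)
  obtain i j where a: "a = (i, j)" by (cases a)
  define d :: "nat \<Rightarrow> nat" where "d v = (\<Sum>(i, j)\<in>#M. of_bool (i = v) + of_bool (j = v))" for v
  have deg: "of_bool (i = v) + of_bool (j = v) + d v = of_bool (v \<in> U)" for v
    using add.prems(3)[of v] unfolding a d_def by simp
  have "i \<le> j" using add.prems(1)[of i j] by (simp add: a)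
  moreover have "i \<noteq> j" using deg[of i] by (cases "i \<in> U") auto
  ultimately have ij: "i < j" by simp
  have iU: "i \<in> U" "j \<in> U"
    using deg[of i] by (cases "i \<in> U", simp_all) (use deg[of j] in \<open>cases "j \<in> U", simp_all\<close>)
  define U' where "U' = U - {i, j}"
  have U: "U = insert i (insert j U')" using iU by (auto simp: U'_def)
  have notin: "i \<notin> U'" "j \<notin> U'" by (simp_all add: U'_def)
  have "d v = of_bool (v \<in> U')" for v
    using deg[of v] iU ij by (cases "v = i"; cases "v = j"; cases "v \<in> U") (simp_all add: U'_def)
  moreover have arcs_M: "x \<le> y" if "(x, y) \<in># M" for x y
    using add.prems(1)[of x y] that by simp
  moreover have fin: "finite U'" using add.prems(2) by (simp add: U'_def)
  ultimately obtain \<pi> where \<pi>: "pairing U' \<pi>"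
      "M = image_mset (\<lambda>v. (v, \<pi> v)) (mset_set {v \<in> U'. v < \<pi> v})"
    using add.IH[of U'] arcs_M unfolding d_def by blast
  let ?p = "\<pi>(i := j, j := i)"
  have "pairing U ?p" using pairing_add[OF \<pi>(1) notin] ij by (simp add: U)
  moreover have "add_mset a M = image_mset (\<lambda>v. (v, ?p v)) (mset_set {v \<in> U. v < ?p v})"
  proof -
    have 1: "{v \<in> U. v < ?p v} = insert i {v \<in> U'. v < \<pi> v}"
      using ij notin by (auto simp: U)
    have 2: "i \<notin> {v \<in> U'. v < \<pi> v}" using notin by simp
    have 3: "image_mset (\<lambda>v. (v, ?p v)) (mset_set {v \<in> U'. v < \<pi> v}) = M"
      unfolding \<pi>(2) by (rule image_mset_cong) (use fin notin in auto)
    show ?thesis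
      unfolding 1 using 2 3 fin ij a by (simp add: mset_set.insert)
  qed
  ultimately show ?case by blast
qed

definition one_regular_diagrams :: "nat \<Rightarrow> nat \<Rightarrow> diagram set" where
  "one_regular_diagrams n k = {D. arc_diagram n k D \<and> one_regular n D}"

lemma one_regular_diagrams_cases:
  assumes "D \<in> one_regular_diagrams n k"
  obtains S \<pi> where "D = diagram_of ({1..n} - S) S \<pi>" "pairing ({1..n} - S) \<pi>"
    "S \<subseteq> {1..n}" "S = {} \<or> card S = k"
proof -
  define S where "S = painted D"
  have D: "\<And>i j. (i, j) \<in># arcs D \<Longrightarrow> 1 \<le> i \<and> i \<le> j \<and> j \<le> n" "S \<subseteq> {1..n}" "S = {} \<or> card S = k"
    "\<And>v. v \<in> {1..n} \<Longrightarrow> vertex_degree D v = 1"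
    using assms by (auto simp: one_regular_diagrams_def arc_diagram_def one_regular_def has_hyperedge_def S_def)
  have deg: "(\<Sum>(i, j)\<in>#arcs D. of_bool (i = v) + of_bool (j = v)) = (of_bool (v \<in> {1..n} - S) :: nat)" for v
  proof (cases "v \<in> {1..n}")
    case True
    then show ?thesis using D(4)[OF True] by (auto simp: vertex_degree_def S_def of_bool_def split: if_splits)
  next
    case False
    have "(\<Sum>(i, j)\<in>#arcs D. of_bool (i = v) + of_bool (j = v)) = (\<Sum>a\<in>#arcs D. (0::nat))"
      by (rule arg_cong[of _ _ sum_mset], rule image_mset_cong) (use False D(1) in fastforce)
    also have "\<dots> = 0" by (rule sum_mset.neutral_const)
    finally have *: "(\<Sum>(i, j)\<in>#arcs D. of_bool (i = v) + of_bool (j = v)) = (0::nat)" .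
    show ?thesis using False by (simp only: *) auto
  qed
  have le: "x \<le> y" if "(x, y) \<in># arcs D" for x y using D(1)[OF that] by simp
  obtain \<pi> where "pairing ({1..n} - S) \<pi>"
      "arcs D = image_mset (\<lambda>v. (v, \<pi> v)) (mset_set {v \<in> {1..n} - S. v < \<pi> v})"
    using one_regular_arcs_imp_pairing[OF le _ deg] by auto
  then show ?thesis using D(2,3) that[of S \<pi>] by (metis S_def diagram.exhaust_sel diagram_of_def)
qed

lemma degree_diagram_of:
  assumes "finite U" "pairing U \<pi>"
  shows "(\<Sum>(i, j)\<in>#arcs (diagram_of U S \<pi>). of_bool (i = v) + of_bool (j = v)) = (of_bool (v \<in> U) :: nat)"
proof -
  have "(\<Sum>(i, j)\<in>#arcs (diagram_of U S \<pi>). of_bool (i = v) + of_bool (j = v))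
      = (\<Sum>x\<in>{x \<in> U. x < \<pi> x}. of_bool (x = v) + of_bool (\<pi> x = v) :: nat)"
    by (simp add: image_mset.compositionality o_def sum_unfold_sum_mset)
  also have "\<dots> = (\<Sum>x\<in>{x \<in> U. x < \<pi> x}. of_bool (x = v)) + (\<Sum>x\<in>{x \<in> U. x < \<pi> x}. of_bool (x = \<pi> v))"
    unfolding sum.distrib
    by (intro arg_cong2[of _ _ _ _ plus] refl sum.cong arg_cong[of _ _ of_bool]) (use pairing_invol[OF assms(2)] in auto)
  also have "\<dots> = of_bool (v \<in> {x \<in> U. x < \<pi> x}) + of_bool (\<pi> v \<in> {x \<in> U. x < \<pi> x})"
    using assms(1) by (simp add: of_bool_def)
  also have "\<dots> = of_bool (v \<in> U)"
  proof (cases "v \<in> U")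
    case True
    then have "\<pi> v \<in> U" "\<pi> v \<noteq> v" "\<pi> (\<pi> v) = v" using assms(2) by (auto simp: pairing_def pairing_in)
    then show ?thesis using True by (auto simp: of_bool_def)
  next
    case False
    then show ?thesis using assms(2) by (auto simp: pairing_def permutes_not_in)
  qed
  finally show ?thesis .
qed

lemma diagram_of_in_one_regular:
  assumes "pairing ({1..n} - S) \<pi>" "S \<subseteq> {1..n}" "S = {} \<or> card S = k"
  shows "diagram_of ({1..n} - S) S \<pi> \<in> one_regular_diagrams n k"
proof -
  have "arc_diagram n k (diagram_of ({1..n} - S) S \<pi>)"
    using assms pairing_in[OF assms(1)] by (auto simp: arc_diagram_def has_hyperedge_def)
  moreover have "one_regular n (diagram_of ({1..n} - S) S \<pi>)"
    using degree_diagram_of[OF _ assms(1), where S = S] assms(2)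
    by (auto simp: one_regular_def vertex_degree_def simp del: arcs_diagram_of)
  ultimately show ?thesis by (simp add: one_regular_diagrams_def)
qed

section \<open>Tensors as functions on words\<close>

text \<open>The coordinates of a tensor with index set \<open>I\<close>. Arbitrary index sets make contractions possible without renumbering, and words are extensional so that they form a finite set.\<close>

definition words :: "nat set \<Rightarrow> nat \<Rightarrow> (nat \<Rightarrow> nat) set" where
  "words I k = I \<rightarrow>\<^sub>E {..<k}"

lemma finite_words [simp]: "finite I \<Longrightarrow> finite (words I k)"
  by (simp add: words_def finite_PiE)

lemma words_less: "w \<in> words I k \<Longrightarrow> i \<in> I \<Longrightarrow> w i < k"
  by (auto simp: words_def PiE_def Pi_def)

lemma words_upd [intro]: "w \<in> words I k \<Longrightarrow> i \<in> I \<Longrightarrow> b < k \<Longrightarrow> w(i := b) \<in> words I k"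
  by (auto simp: words_def PiE_def Pi_def extensional_def)

lemma words_permute: "w \<in> words I k \<Longrightarrow> p permutes I \<Longrightarrow> w \<circ> p \<in> words I k"
  by (auto simp: words_def PiE_def Pi_def extensional_def permutes_in_image permutes_not_in)

lemma words_eqI: "w \<in> words I k \<Longrightarrow> w' \<in> words I k \<Longrightarrow> (\<And>i. i \<in> I \<Longrightarrow> w i = w' i) \<Longrightarrow> w = w'"
  unfolding words_def by (rule PiE_ext)

text \<open>The action of an elementary matrix on tensors.\<close>

definition replace_sum :: "nat set \<Rightarrow> nat \<Rightarrow> nat \<Rightarrow> ((nat \<Rightarrow> nat) \<Rightarrow> complex) \<Rightarrow> (nat \<Rightarrow> nat) \<Rightarrow> complex" where
  "replace_sum I a b A w = (\<Sum>i\<in>{i \<in> I. w i = a}. A (w(i := b)))"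

text \<open>Invariance under the Lie algebra of skew-symmetric matrices.\<close>

definition replace_invariant :: "nat set \<Rightarrow> nat \<Rightarrow> ((nat \<Rightarrow> nat) \<Rightarrow> complex) \<Rightarrow> bool" where
  "replace_invariant I k A \<longleftrightarrow>
     (\<forall>a<k. \<forall>b<k. \<forall>w\<in>words I k. replace_sum I a b A w = replace_sum I b a A w)"

definition traceless :: "nat set \<Rightarrow> nat \<Rightarrow> ((nat \<Rightarrow> nat) \<Rightarrow> complex) \<Rightarrow> bool" where
  "traceless I k A \<longleftrightarrow>
     (\<forall>i\<in>I. \<forall>j\<in>I. \<forall>w\<in>words I k. i \<noteq> j \<longrightarrow> (\<Sum>b<k. A (w(i := b, j := b))) = 0)"

lemma replace_sum_adjoint:
  assumes "finite I" "a < k" "b < k"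
  shows "(\<Sum>w\<in>words I k. replace_sum I a b A w * cnj (B w))
       = (\<Sum>w\<in>words I k. A w * cnj (replace_sum I b a B w))"
proof -
  have "(\<Sum>w\<in>words I k. replace_sum I a b A w * cnj (B w))
      = (\<Sum>(w, i)\<in>Sigma (words I k) (\<lambda>w. {i \<in> I. w i = a}). A (w(i := b)) * cnj (B w))"
    using assms by (simp add: replace_sum_def sum_distrib_right sum.Sigma)
  also have "\<dots> = (\<Sum>(w, i)\<in>Sigma (words I k) (\<lambda>w. {i \<in> I. w i = b}). A w * cnj (B (w(i := a))))"
    by (rule sum.reindex_bij_witness[where i = "\<lambda>(w, i). (w(i := a), i)" and j = "\<lambda>(w, i). (w(i := b), i)"])
       (use assms in auto)
  also have "\<dots> = (\<Sum>w\<in>words I k. A w * cnj (replace_sum I b a B w))"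
    using assms by (simp add: replace_sum_def sum_distrib_left sum.Sigma)
  finally show ?thesis .
qed

lemma replace_sum_diag: "replace_sum I a a A w = of_nat (card {i \<in> I. w i = a}) * A w"
proof -
  have "replace_sum I a a A w = (\<Sum>i\<in>{i \<in> I. w i = a}. A w)"
    unfolding replace_sum_def by (rule sum.cong) (auto simp: fun_upd_idem)
  then show ?thesis by simp
qed

text \<open>Two replacements at different positions add up to a contraction, which vanishes. At the same position, changing \<open>a\<close> to \<open>b\<close> twice needs \<open>a = b\<close> and changes nothing, which counts each position once.\<close>

lemma sum_replace_sum_square:
  assumes "finite I" "w \<in> words I k"
    and traceless: "traceless I k A"
  shows "(\<Sum>a<k. \<Sum>b<k. replace_sum I a b (replace_sum I a b A) w) = of_nat (card I) * A w"
proof -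
  let ?X = "\<lambda>i j b. A (w(i := b, j := b))"
  have "replace_sum I a b (replace_sum I a b A) w
      = (\<Sum>i\<in>I. \<Sum>j\<in>I. if w i = a \<and> (w(i := b)) j = w i then ?X i j b else 0)" for a b
  proof -
    have "replace_sum I a b (replace_sum I a b A) w
      = (\<Sum>i\<in>I. if w i = a then (\<Sum>j\<in>I. if (w(i := b)) j = a then ?X i j b else 0) else 0)"
      unfolding replace_sum_def using assms(1) by (simp only: sum.inter_filter)
    also have "\<dots> = (\<Sum>i\<in>I. \<Sum>j\<in>I. if w i = a \<and> (w(i := b)) j = w i then ?X i j b else 0)"
    proof (rule sum.cong[OF refl])
      fix i
      show "(if w i = a then (\<Sum>j\<in>I. if (w(i := b)) j = a then ?X i j b else 0) else 0)
        = (\<Sum>j\<in>I. if w i = a \<and> (w(i := b)) j = w i then ?X i j b else 0)"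
        by (cases "w i = a") simp_all
    qed
    finally show ?thesis .
  qed
  then have "(\<Sum>a<k. \<Sum>b<k. replace_sum I a b (replace_sum I a b A) w)
      = (\<Sum>a<k. \<Sum>b<k. \<Sum>i\<in>I. \<Sum>j\<in>I. if w i = a \<and> (w(i := b)) j = w i then ?X i j b else 0)"
    by simp
  also have "\<dots> = (\<Sum>a<k. \<Sum>i\<in>I. \<Sum>b<k. \<Sum>j\<in>I. if w i = a \<and> (w(i := b)) j = w i then ?X i j b else 0)"
    by (rule sum.cong[OF refl], rule sum.swap)
  also have "\<dots> = (\<Sum>i\<in>I. \<Sum>a<k. \<Sum>b<k. \<Sum>j\<in>I. if w i = a \<and> (w(i := b)) j = w i then ?X i j b else 0)"
    by (rule sum.swap)
  also have "\<dots> = (\<Sum>i\<in>I. A w)"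
  proof (rule sum.cong[OF refl])
    fix i assume i: "i \<in> I"
    have wi: "w i < k" using words_less[OF assms(2) i] .
    have "(\<Sum>a<k. \<Sum>b<k. \<Sum>j\<in>I. if w i = a \<and> (w(i := b)) j = w i then ?X i j b else 0)
       = (\<Sum>a<k. if w i = a then (\<Sum>b<k. \<Sum>j\<in>I. if (w(i := b)) j = w i then ?X i j b else 0) else 0)"
      by (rule sum.cong[OF refl]) simp
    also have "\<dots> = (\<Sum>b<k. \<Sum>j\<in>I. if (w(i := b)) j = w i then ?X i j b else 0)"
      using wi by (subst sum.delta') simp_all
    also have "\<dots> = (\<Sum>j\<in>I. \<Sum>b<k. if (w(i := b)) j = w i then ?X i j b else 0)"
      by (rule sum.swap)
    also have "\<dots> = (\<Sum>j\<in>I. if j = i then A w else 0)"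
    proof (rule sum.cong[OF refl])
      fix j assume j: "j \<in> I"
      show "(\<Sum>b<k. if (w(i := b)) j = w i then ?X i j b else 0) = (if j = i then A w else 0)"
      proof (cases "j = i")
        case True
        then have "(\<Sum>b<k. if (w(i := b)) j = w i then ?X i j b else 0)
            = (\<Sum>b<k. if b = w i then ?X i i b else 0)" by simp
        also have "\<dots> = A w" using wi by (subst sum.delta) simp_all
        finally show ?thesis using True by simp
      next
        case False
        then have "(\<Sum>b<k. if (w(i := b)) j = w i then ?X i j b else 0)
            = (if w j = w i then (\<Sum>b<k. ?X i j b) else 0)" by simp
        also have "\<dots> = 0" using traceless i j assms(2) False by (simp add: traceless_def)
        finally show ?thesis using False by simp
      qed
    qed
    also have "\<dots> = A w" using i assms(1) by simp
    finally show "(\<Sum>a<k. \<Sum>b<k. \<Sum>j\<in>I. if w i = a \<and> (w(i := b)) j = w i then ?X i j b else 0) = A w" .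
  qed
  finally show ?thesis by simp
qed

text \<open>The squared norms of all \<open>replace_sum I a b A\<close> sum to \<open>card I\<close> times the squared norm of \<open>A\<close>, but the terms with \<open>a = b\<close> already reach this amount, since \<open>m \<le> m\<^sup>2\<close> for natural numbers. So all inequalities on the way are equalities.\<close>

lemma traceless_invariant_vanishing:
  assumes "finite I"
    and inv: "replace_invariant I k A"
    and traceless: "traceless I k A"
    and w: "w \<in> words I k"
  shows "A w \<noteq> 0 \<Longrightarrow> inj_on w I"
    and "\<And>a b. a < k \<Longrightarrow> b < k \<Longrightarrow> a \<noteq> b \<Longrightarrow> replace_sum I a b A w = 0"
proof -
  let ?W = "words I k"
  let ?R = "\<lambda>a b. replace_sum I a b A"
  let ?m = "\<lambda>w a. real (card {i \<in> I. w i = a})"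
  \<comment> \<open>The defect at one word, and its decomposition into nonnegative parts \<open>g w a b\<close>.\<close>
  define f where "f w = (\<Sum>a<k. \<Sum>b<k. (cmod (?R a b w))\<^sup>2) - real (card I) * (cmod (A w))\<^sup>2" for w
  define g where "g w a b = (if a = b then ((?m w a)\<^sup>2 - ?m w a) * (cmod (A w))\<^sup>2 else (cmod (?R a b w))\<^sup>2)" for w a b
  have "complex_of_real (\<Sum>w\<in>?W. \<Sum>a<k. \<Sum>b<k. (cmod (?R a b w))\<^sup>2)
      = (\<Sum>w\<in>?W. \<Sum>a<k. \<Sum>b<k. ?R a b w * cnj (?R a b w))"
    by (simp only: of_real_sum complex_norm_square)
  also have "\<dots> = (\<Sum>a<k. \<Sum>w\<in>?W. \<Sum>b<k. ?R a b w * cnj (?R a b w))"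
    by (rule sum.swap)
  also have "\<dots> = (\<Sum>a<k. \<Sum>b<k. \<Sum>w\<in>?W. ?R a b w * cnj (?R a b w))"
    by (rule sum.cong[OF refl], rule sum.swap)
  also have "\<dots> = (\<Sum>a<k. \<Sum>b<k. \<Sum>w\<in>?W. ?R a b w * cnj (?R b a w))"
  proof (rule sum.cong[OF refl], rule sum.cong[OF refl], rule sum.cong[OF refl])
    fix a b w assume "a \<in> {..<k}" "b \<in> {..<k}" "w \<in> ?W"
    then show "?R a b w * cnj (?R a b w) = ?R a b w * cnj (?R b a w)"
      using inv unfolding replace_invariant_def by (metis lessThan_iff)
  qed
  also have "\<dots> = (\<Sum>a<k. \<Sum>b<k. \<Sum>w\<in>?W. replace_sum I a b (?R a b) w * cnj (A w))"
    by (rule sum.cong[OF refl], rule sum.cong[OF refl], rule replace_sum_adjoint[symmetric])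
       (simp_all only: assms(1) lessThan_iff)
  also have "\<dots> = (\<Sum>a<k. \<Sum>w\<in>?W. \<Sum>b<k. replace_sum I a b (?R a b) w * cnj (A w))"
    by (rule sum.cong[OF refl], rule sum.swap)
  also have "\<dots> = (\<Sum>w\<in>?W. \<Sum>a<k. \<Sum>b<k. replace_sum I a b (?R a b) w * cnj (A w))"
    by (rule sum.swap)
  also have "\<dots> = (\<Sum>w\<in>?W. (\<Sum>a<k. \<Sum>b<k. replace_sum I a b (?R a b) w) * cnj (A w))"
    by (simp only: sum_distrib_right)
  also have "\<dots> = (\<Sum>w\<in>?W. of_nat (card I) * A w * cnj (A w))"
  proof (rule sum.cong[OF refl])
    fix w assume "w \<in> ?W"
    then show "(\<Sum>a<k. \<Sum>b<k. replace_sum I a b (?R a b) w) * cnj (A w) = of_nat (card I) * A w * cnj (A w)"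
      using sum_replace_sum_square[OF assms(1), of w k A] traceless by simp
  qed
  also have "\<dots> = complex_of_real (\<Sum>w\<in>?W. real (card I) * (cmod (A w))\<^sup>2)"
    by (simp only: of_real_sum of_real_mult complex_norm_square mult.assoc of_real_of_nat_eq)
  finally have "(\<Sum>w\<in>?W. f w) = 0"
    unfolding f_def sum_subtractf of_real_eq_iff by simp
  moreover have fg: "f w = (\<Sum>a<k. \<Sum>b<k. g w a b)" if "w \<in> ?W" for w
  proof -
    have "(\<Sum>a<k. \<Sum>b<k. (cmod (?R a b w))\<^sup>2)
        = (\<Sum>a<k. \<Sum>b<k. g w a b + (if a = b then ?m w a * (cmod (A w))\<^sup>2 else 0))"
      by (intro sum.cong refl)
         (auto simp: g_def replace_sum_diag norm_mult power_mult_distrib algebra_simps)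
    also have "\<dots> = (\<Sum>a<k. \<Sum>b<k. g w a b) + (\<Sum>a<k. ?m w a * (cmod (A w))\<^sup>2)"
      by (simp add: sum.distrib)
    also have "(\<Sum>a<k. ?m w a * (cmod (A w))\<^sup>2) = real (card I) * (cmod (A w))\<^sup>2"
    proof -
      have "(\<Sum>a<k. \<Sum>i\<in>{i \<in> I. w i = a}. 1) = (\<Sum>i\<in>I. 1::real)"
        by (rule sum.group) (use assms(1) words_less[OF that] in auto)
      then show ?thesis by (simp flip: sum_distrib_right)
    qed
    finally show ?thesis by (simp add: f_def)
  qed
  have g0: "0 \<le> g w a b" for w a b
  proof -
    have "real m \<le> (real m)\<^sup>2" for m by (cases m) (auto simp: power2_eq_square)
    then show ?thesis by (auto simp: g_def)
  qed
  have "f w \<ge> 0" if "w \<in> ?W" for w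
    unfolding fg[OF that] by (intro sum_nonneg g0)
  ultimately have "f w = 0"
    using w assms(1) by (subst (asm) sum_nonneg_eq_0_iff) auto
  then have gz: "g w a b = 0" if "a < k" "b < k" for a b
    using that unfolding fg[OF w]
    by (subst (asm) sum_nonneg_eq_0_iff, simp_all add: sum_nonneg g0 sum_nonneg_eq_0_iff)
  show "replace_sum I a b A w = 0" if "a < k" "b < k" "a \<noteq> b" for a b
    using gz[OF that(1,2)] that(3) by (simp add: g_def)
  show "inj_on w I" if "A w \<noteq> 0"
  proof (rule inj_onI)
    fix i j assume ij: "i \<in> I" "j \<in> I" "w i = w j"
    let ?c = "card {l \<in> I. w l = w i}"
    have "(real ?c)\<^sup>2 - real ?c = 0"
      using gz[of "w i" "w i"] words_less[OF w ij(1)] that by (simp add: g_def)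
    then have "real ?c * (real ?c - 1) = 0" by (simp add: power2_eq_square algebra_simps)
    then have "?c \<le> 1" by auto
    then show "i = j" using ij assms(1) by (auto simp: card_le_Suc0_iff_eq)
  qed
qed

text \<open>Let \<open>w\<close> have distinct letters and leave a letter \<open>b\<close> unused. Put \<open>b\<close> into one position of \<open>w\<close>; the sum over the ways of replacing \<open>b\<close> by the former letter is \<open>A w\<close>, so \<open>A w = 0\<close>. Hence \<open>A w \<noteq> 0\<close> forces all letters to be used. Replacing a letter by another one of the word gives a sum of two terms, which differ by a transposition.\<close>

lemma traceless_invariant_zero_or_antisymmetric:
  assumes "finite I" "I \<noteq> {}"
    and inv: "replace_invariant I k A"
    and traceless: "traceless I k A"
  shows "(\<forall>w\<in>words I k. A w = 0) \<or> (card I = k \<and>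
      (\<forall>w\<in>words I k. \<forall>x\<in>I. \<forall>y\<in>I. x \<noteq> y \<longrightarrow> A (w \<circ> Transposition.transpose x y) = - A w))"
proof (cases "\<forall>w\<in>words I k. A w = 0")
  case False
  then obtain w where w: "w \<in> words I k" "A w \<noteq> 0" by auto
  note V = traceless_invariant_vanishing[OF assms(1) inv traceless]
  have inj: "inj_on w I" using V(1)[of w] w by simp
  have sub: "w ` I \<subseteq> {..<k}" using words_less[OF w(1)] by auto
  have "w ` I = {..<k}"
  proof (rule ccontr)
    assume "w ` I \<noteq> {..<k}"
    then obtain b where b: "b < k" "b \<notin> w ` I" using sub by auto
    obtain i where i: "i \<in> I" using assms(2) by auto
    have "{j \<in> I. (w(i := b)) j = b} = {i}" using b i by auto
    then have "replace_sum I b (w i) A (w(i := b)) = A w"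
      by (simp add: replace_sum_def)
    moreover have "replace_sum I b (w i) A (w(i := b)) = 0"
      using V(2)[of "w(i := b)" b "w i"] b i w words_less[OF w(1) i] by auto
    ultimately show False using w by simp
  qed
  then have card: "card I = k" using inj by (metis card_image card_lessThan)
  have "A (v \<circ> Transposition.transpose x y) = - A v" if v: "v \<in> words I k" and xy: "x \<in> I" "y \<in> I" "x \<noteq> y" for v x y
  proof (cases "inj_on v I")
    case True
    have ne: "v x \<noteq> v y" using True xy by (auto dest: inj_onD)
    let ?u = "v(x := v y)"
    have u: "?u \<in> words I k" using v xy words_less[OF v] by blast
    have "{l \<in> I. ?u l = v y} = {x, y}" using True xy by (auto dest: inj_onD)
    then have "replace_sum I (v y) (v x) A ?u = A (?u(x := v x)) + A (?u(y := v x))"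
      using xy by (simp add: replace_sum_def)
    moreover have "?u(x := v x) = v" by simp
    moreover have "?u(y := v x) = v \<circ> Transposition.transpose x y"
      using xy by (auto simp: fun_eq_iff Transposition.transpose_def)
    moreover have "replace_sum I (v y) (v x) A ?u = 0"
      using V(2)[of ?u "v y" "v x"] u ne words_less[OF v] xy by auto
    ultimately show ?thesis by (metis add.commute add_eq_0_iff)
  next
    case False
    have "A v = 0" using V(1)[of v] v False by auto
    moreover have "\<not> inj_on (v \<circ> Transposition.transpose x y) I"
      using False permutes_swap_id[OF xy(1,2)]
      by (metis comp_inj_on_iff permutes_image permutes_inj_on)
    then have "A (v \<circ> Transposition.transpose x y) = 0"
      using V(1)[of "v \<circ> Transposition.transpose x y"] words_permute[OF v permutes_swap_id[OF xy(1,2)]] by auto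
    ultimately show ?thesis by simp
  qed
  then show ?thesis using card by blast
qed simp

section \<open>Forms of diagrams on words\<close>

text \<open>What is used of the determinant of the frame vectors selected by the letters \<open>u 0, \<dots>, u (k - 1)\<close>.\<close>

locale volume_form =
  fixes k :: nat and \<delta> :: "(nat \<Rightarrow> nat) \<Rightarrow> complex"
  assumes \<delta>_cong: "\<And>u u'. (\<And>l. l < k \<Longrightarrow> u l = u' l) \<Longrightarrow> \<delta> u = \<delta> u'"
    and \<delta>_transpose: "\<And>u x y. x < k \<Longrightarrow> y < k \<Longrightarrow> x \<noteq> y \<Longrightarrow> \<delta> (u \<circ> Transposition.transpose x y) = - \<delta> u"
    and \<delta>_nonzero: "\<And>u. inj_on u {..<k} \<Longrightarrow> u ` {..<k} \<subseteq> {..<k} \<Longrightarrow> \<delta> u \<noteq> 0"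
begin

text \<open>The empty set stands for a diagram without hyperedge, also when \<open>k = 0\<close>.\<close>

definition vol :: "nat set \<Rightarrow> (nat \<Rightarrow> nat) \<Rightarrow> complex" where
  "vol S w = (if S = {} then 1 else \<delta> (\<lambda>l. w (sorted_list_of_set S ! l)))"

definition word_form :: "nat set \<Rightarrow> nat set \<Rightarrow> (nat \<Rightarrow> nat) \<Rightarrow> (nat \<Rightarrow> nat) \<Rightarrow> complex" where
  "word_form I S \<pi> w = (if \<forall>x\<in>I - S. w (\<pi> x) = w x then vol S w else 0)"

lemma bij_enum:
  assumes "finite S" "card S = k"
  shows "bij_betw ((!) (sorted_list_of_set S)) {..<k} S"
  using assms by (intro bij_betw_nth) auto

lemma vol_cong:
  assumes "finite S" "S = {} \<or> card S = k" "\<And>x. x \<in> S \<Longrightarrow> w x = w' x"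
  shows "vol S w = vol S w'"
proof (cases "S = {}")
  case False
  then have "card S = k" using assms(2) by auto
  then have "w (sorted_list_of_set S ! l) = w' (sorted_list_of_set S ! l)" if "l < k" for l
    using assms(3) bij_betwE[OF bij_enum[OF assms(1)]] that by auto
  then show ?thesis unfolding vol_def using False by (simp cong: \<delta>_cong)
qed (simp add: vol_def)

lemma vol_transpose:
  assumes "finite S" "card S = k" "x \<in> S" "y \<in> S" "x \<noteq> y"
  shows "vol S (w \<circ> Transposition.transpose x y) = - vol S w"
proof -
  let ?a = "(!) (sorted_list_of_set S)"
  note bij = bij_enum[OF assms(1,2)]
  obtain p q where pq: "p < k" "?a p = x" "q < k" "?a q = y"
    using assms(3,4) bij by (metis bij_betw_imp_surj_on imageE lessThan_iff)
  have "\<delta> (\<lambda>l. (w \<circ> Transposition.transpose x y) (?a l)) = \<delta> ((\<lambda>l. w (?a l)) \<circ> Transposition.transpose p q)"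
  proof (rule \<delta>_cong)
    fix l assume l: "l < k"
    have "?a l = x \<longleftrightarrow> l = p" "?a l = y \<longleftrightarrow> l = q"
      using bij l pq unfolding bij_betw_def inj_on_def by (metis lessThan_iff)+
    then show "(w \<circ> Transposition.transpose x y) (?a l) = ((\<lambda>l. w (?a l)) \<circ> Transposition.transpose p q) l"
      using pq by (auto simp: Transposition.transpose_def)
  qed
  also have "\<dots> = - \<delta> (\<lambda>l. w (?a l))"
    using pq assms(5) by (intro \<delta>_transpose) auto
  finally show ?thesis using assms(3) by (auto simp: vol_def)
qed

lemma vol_permutes:
  assumes "finite S" "S = {} \<or> card S = k" "p permutes S"
  shows "vol S (w \<circ> p) = of_int (sign p) * vol S w"
proof (cases "S = {}")
  case True
  then show ?thesis using assms(3) by (simp add: vol_def)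
next
  case False
  then have c: "card S = k" using assms(2) by auto
  show ?thesis
    by (rule transposition_antisymmetric_imp_sign[where X = UNIV, OF assms(1) _ _ assms(3)])
       (rule UNIV_I vol_transpose[OF assms(1) c]; assumption)+
qed

lemma vol_not_inj:
  assumes "finite S" "S = {} \<or> card S = k" "\<not> inj_on w S"
  shows "vol S w = 0"
proof -
  obtain x y where xy: "x \<in> S" "y \<in> S" "x \<noteq> y" "w x = w y"
    using assms(3) by (auto simp: inj_on_def)
  have "w \<circ> Transposition.transpose x y = w"
    using xy(4) by (auto simp: fun_eq_iff Transposition.transpose_def)
  then have "vol S w = - vol S w"
    using vol_transpose[OF assms(1) _ xy(1-3), of w] assms(2) xy(1) by auto
  then show ?thesis by simp
qed

lemma vol_nonzero:
  assumes "finite S" "S = {} \<or> card S = k" "inj_on w S" "w ` S \<subseteq> {..<k}"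
  shows "vol S w \<noteq> 0"
proof (cases "S = {}")
  case False
  then have "card S = k" using assms(2) by auto
  then have bij: "bij_betw ((!) (sorted_list_of_set S)) {..<k} S" using bij_enum[OF assms(1)] by simp
  have "inj_on (w \<circ> (!) (sorted_list_of_set S)) {..<k}"
    using bij assms(3) by (intro comp_inj_on) (auto simp: bij_betw_def)
  moreover have "(w \<circ> (!) (sorted_list_of_set S)) ` {..<k} \<subseteq> {..<k}"
    using bij assms(4) by (auto simp: bij_betw_def)
  ultimately have "\<delta> (w \<circ> (!) (sorted_list_of_set S)) \<noteq> 0" by (rule \<delta>_nonzero)
  then show ?thesis using False by (simp add: vol_def o_def)
qed (simp add: vol_def)

text \<open>Both sides are the determinant of the same vectors, listed in different orders, so they differ by a sign that does not depend on the word.\<close>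

lemma vol_relabel:
  assumes "finite S" "S = {} \<or> card S = k" "inj_on p S"
  obtains s :: complex where "s \<noteq> 0" "\<And>w. vol S (w \<circ> p) = s * vol (p ` S) w"
proof (cases "S = {}")
  case True
  then show ?thesis using that[of 1] by (simp add: vol_def)
next
  case False
  then have c: "card S = k" using assms(2) by auto
  have c': "card (p ` S) = k" using c assms(3) by (simp add: card_image)
  let ?a = "(!) (sorted_list_of_set S)" and ?b = "(!) (sorted_list_of_set (p ` S))"
  have ba: "bij_betw ?a {..<k} S" using bij_enum[OF assms(1) c] .
  have bb: "bij_betw ?b {..<k} (p ` S)" using bij_enum[OF _ c'] assms(1) by simp
  have bp: "bij_betw p S (p ` S)" using assms(3) by (rule inj_on_imp_bij_betw)
  define t where "t l = (if l < k then inv_into {..<k} ?b (p (?a l)) else l)" for l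
  have "bij_betw (inv_into {..<k} ?b \<circ> (p \<circ> ?a)) {..<k} {..<k}"
    by (intro bij_betw_trans[OF bij_betw_trans[OF ba bp]] bij_betw_inv_into bb)
  then have "bij_betw t {..<k} {..<k}"
    by (subst bij_betw_cong[where g = "inv_into {..<k} ?b \<circ> (p \<circ> ?a)"]) (auto simp: t_def)
  then have t: "t permutes {..<k}"
    by (rule bij_imp_permutes) (simp add: t_def)
  have eq: "?b (t l) = p (?a l)" if "l < k" for l
  proof -
    have "p (?a l) \<in> ?b ` {..<k}"
      using that ba bb by (auto simp: bij_betw_def)
    then show ?thesis using that by (simp add: t_def f_inv_into_f)
  qed
  have "vol S (w \<circ> p) = of_int (sign t) * vol (p ` S) w" for w
  proof -
    have "vol S (w \<circ> p) = \<delta> (\<lambda>l. w (p (?a l)))"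
      using False by (simp add: vol_def)
    also have "\<dots> = \<delta> ((\<lambda>l. w (?b l)) \<circ> t)"
      by (rule \<delta>_cong) (simp add: eq)
    also have "\<dots> = of_int (sign t) * \<delta> (\<lambda>l. w (?b l))"
      by (rule transposition_antisymmetric_imp_sign[where X = UNIV and S = "{..<k}", OF _ _ _ t])
         (simp_all only: finite_lessThan UNIV_I lessThan_iff \<delta>_transpose not_False_eq_True)
    finally show ?thesis using False by (simp add: vol_def)
  qed
  then show ?thesis using that[of "of_int (sign t)"] by simp
qed

section \<open>Invariant tensors orthogonal to all diagrams vanish\<close>

lemma word_form_add_arc:
  assumes I: "i \<in> I" "j \<in> I" "i \<noteq> j" "finite I"
    and S: "S \<subseteq> I - {i, j}" "S = {} \<or> card S = k" and \<pi>: "pairing (I - {i, j} - S) \<pi>"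
  shows "word_form I S (\<pi>(i := j, j := i)) w = (if w i = w j then word_form (I - {i, j}) S \<pi> w else 0)"
proof -
  have "(\<forall>x\<in>I - S. w ((\<pi>(i := j, j := i)) x) = w x) \<longleftrightarrow>
      w i = w j \<and> (\<forall>x\<in>I - {i, j} - S. w (\<pi> x) = w x)"
    using I S(1) by auto
  then show ?thesis by (simp add: word_form_def)
qed

lemma word_form_cong:
  assumes "finite I" "S \<subseteq> I" "S = {} \<or> card S = k" "pairing (I - S) \<pi>" "\<And>x. x \<in> I \<Longrightarrow> w x = w' x"
  shows "word_form I S \<pi> w = word_form I S \<pi> w'"
proof -
  have "vol S w = vol S w'"
    using assms by (intro vol_cong) (auto intro: finite_subset)
  moreover have "w (\<pi> x) = w' (\<pi> x)" "w x = w' x" if "x \<in> I - S" for x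
    using assms(5) pairing_in[OF assms(4) that] that by auto
  ultimately show ?thesis by (simp add: word_form_def)
qed

lemma pairing_empty: "U = {} \<Longrightarrow> pairing U id"
  by (simp add: pairing_def)

text \<open>Adding an arc \<open>(i, j)\<close> to a diagram is adjoint to contracting a tensor at \<open>i\<close> and \<open>j\<close>. Hence the contractions of \<open>A\<close> satisfy the hypotheses for \<open>I - {i, j}\<close>, and \<open>A\<close> is traceless by induction.\<close>

lemma invariant_orthogonal_to_diagrams_vanishes:
  assumes "finite I"
    and "replace_invariant I k A"
    and "\<And>S \<pi>. S \<subseteq> I \<Longrightarrow> S = {} \<or> card S = k \<Longrightarrow> pairing (I - S) \<pi> \<Longrightarrow>
      (\<Sum>w\<in>words I k. A w * cnj (word_form I S \<pi> w)) = 0"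
    and "w \<in> words I k"
  shows "A w = 0"
  using assms
proof (induction I arbitrary: A w rule: finite_psubset_induct)
  case (psubset I)
  note fin = psubset.hyps and inv = psubset.prems(1) and orth = psubset.prems(2)
  have traceless: "traceless I k A"
    unfolding traceless_def
  proof (intro ballI impI)
    fix i j w assume ij: "i \<in> I" "j \<in> I" "i \<noteq> j" and w: "w \<in> words I k"
    let ?J = "I - {i, j}"
    define C where "C v = (\<Sum>b<k. A (v(i := b, j := b)))" for v
    have ext: "v(i := b, j := c) \<in> words I k" if "v \<in> words ?J k" "b < k" "c < k" for v b c
      using that ij by (auto simp: words_def PiE_def Pi_def extensional_def)
    have cancel: "r = r'" if "r + x + y = z" "r' + y + x = z" for r r' x y z :: complex
    proof -
      have "r + (x + y) = r' + (x + y)" using that by (simp add: ac_simps)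
      then show ?thesis by (rule add_right_imp_eq)
    qed
    have invC: "replace_invariant ?J k C"
      unfolding replace_invariant_def
    proof (intro allI impI ballI)
      \<comment> \<open>Replacing a letter in a contracted word also meets the two contracted positions; their contribution is symmetric in \<open>a\<close> and \<open>b\<close>.\<close>
      have key: "replace_sum ?J a b C v + A (v(i := b, j := a)) + A (v(i := a, j := b))
          = (\<Sum>c<k. replace_sum I a b A (v(i := c, j := c)))" if ab: "a < k" "b < k" and v: "v \<in> words ?J k" for a b v
      proof -
        have "replace_sum I a b A (v(i := c, j := c)) = (\<Sum>l\<in>{l \<in> ?J. v l = a}. A (v(l := b, i := c, j := c)))
            + (if c = a then A (v(i := b, j := a)) + A (v(i := a, j := b)) else 0)" for c
        proof -
          let ?u = "v(i := c, j := c)"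
          have "replace_sum I a b A ?u = (\<Sum>l\<in>I. if ?u l = a then A (?u(l := b)) else 0)"
            unfolding replace_sum_def using fin by (simp only: sum.inter_filter)
          also have "\<dots> = (\<Sum>l\<in>?J. if ?u l = a then A (?u(l := b)) else 0)
              + (\<Sum>l\<in>{i, j}. if ?u l = a then A (?u(l := b)) else 0)"
            using fin ij by (subst sum.subset_diff[of "{i, j}" I]) auto
          also have "(\<Sum>l\<in>?J. if ?u l = a then A (?u(l := b)) else 0)
              = (\<Sum>l\<in>?J. if v l = a then A (v(l := b, i := c, j := c)) else 0)"
            by (intro sum.cong refl) (use ij in \<open>auto simp: fun_upd_twist\<close>)
          also have "\<dots> = (\<Sum>l\<in>{l \<in> ?J. v l = a}. A (v(l := b, i := c, j := c)))"
            using fin by (simp only: sum.inter_filter finite_Diff)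
          also have "(\<Sum>l\<in>{i, j}. if ?u l = a then A (?u(l := b)) else 0)
              = (if c = a then A (v(i := b, j := a)) + A (v(i := a, j := b)) else 0)"
            using ij by (auto simp: fun_upd_twist)
          finally show ?thesis .
        qed
        then have "(\<Sum>c<k. replace_sum I a b A (v(i := c, j := c)))
          = (\<Sum>c<k. \<Sum>l\<in>{l \<in> ?J. v l = a}. A (v(l := b, i := c, j := c))) + (A (v(i := b, j := a)) + A (v(i := a, j := b)))"
          using ab by (simp add: sum.distrib)
        also have "(\<Sum>c<k. \<Sum>l\<in>{l \<in> ?J. v l = a}. A (v(l := b, i := c, j := c))) = replace_sum ?J a b C v"
          unfolding replace_sum_def C_def by (rule sum.swap)
        finally show ?thesis by (simp only: add.assoc)
      qed
      fix a b v assume ab: "a < k" "b < k" and v: "v \<in> words ?J k"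
      have "(\<Sum>c<k. replace_sum I a b A (v(i := c, j := c))) = (\<Sum>c<k. replace_sum I b a A (v(i := c, j := c)))"
        by (rule sum.cong[OF refl]) (use inv ab ext[OF v] in \<open>auto simp: replace_invariant_def\<close>)
      note * = this
      show "replace_sum ?J a b C v = replace_sum ?J b a C v"
        by (rule cancel[OF key[OF ab v] key[OF ab(2,1) v, folded *]])
    qed
    have orthC: "(\<Sum>v\<in>words ?J k. C v * cnj (word_form ?J S \<pi> v)) = 0"
      if S: "S \<subseteq> ?J" "S = {} \<or> card S = k" and \<pi>: "pairing (?J - S) \<pi>" for S \<pi>
    proof -
      let ?p = "\<pi>(i := j, j := i)"
      have IS: "I - S = insert i (insert j (?J - S))" using ij S(1) by auto
      have "pairing (I - S) ?p"
        unfolding IS by (rule pairing_add[OF \<pi>]) (use ij in auto)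
      moreover have "S \<subseteq> I" using S by blast
      ultimately have "(\<Sum>w\<in>words I k. A w * cnj (word_form I S ?p w)) = 0"
        by (rule orth[OF _ S(2), rotated])
      then have "0 = (\<Sum>w\<in>words I k. A w * cnj (word_form I S ?p w))"
        by (rule sym)
      also have "\<dots> = (\<Sum>w\<in>words I k. if w i = w j then A w * cnj (word_form ?J S \<pi> w) else 0)"
        by (rule sum.cong[OF refl]) (simp add: word_form_add_arc[OF ij fin S \<pi>])
      also have "\<dots> = (\<Sum>w\<in>{w \<in> words I k. w i = w j}. A w * cnj (word_form ?J S \<pi> w))"
        using fin by (simp only: sum.inter_filter finite_words)
      also have "\<dots> = (\<Sum>(v, b)\<in>words ?J k \<times> {..<k}. A (v(i := b, j := b)) * cnj (word_form ?J S \<pi> v))"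
      proof (rule sum.reindex_bij_witness[where j = "\<lambda>w. (restrict w ?J, w i)" and i = "\<lambda>(v, b). v(i := b, j := b)"])
        fix w assume w: "w \<in> {w \<in> words I k. w i = w j}"
        show eq: "(case (restrict w ?J, w i) of (v, b) \<Rightarrow> v(i := b, j := b)) = w"
          using w by (auto simp: words_def fun_eq_iff extensional_def PiE_def)
        show "(restrict w ?J, w i) \<in> words ?J k \<times> {..<k}"
          using w words_less[of w I k] ij by (auto simp: words_def)
        have "word_form ?J S \<pi> (restrict w ?J) = word_form ?J S \<pi> w"
          by (rule word_form_cong) (use S \<pi> fin in auto)
        then show "(case (restrict w ?J, w i) of (v, b) \<Rightarrow> A (v(i := b, j := b)) * cnj (word_form ?J S \<pi> v))
          = A w * cnj (word_form ?J S \<pi> w)" using eq by simp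
      next
        fix x assume x: "x \<in> words ?J k \<times> {..<k}"
        then obtain v b where vb: "x = (v, b)" "v \<in> words ?J k" "b < k" by auto
        show "(case x of (v, b) \<Rightarrow> v(i := b, j := b)) \<in> {w \<in> words I k. w i = w j}"
          using vb ext by auto
        show "(restrict (case x of (v, b) \<Rightarrow> v(i := b, j := b)) ?J, (case x of (v, b) \<Rightarrow> v(i := b, j := b)) i) = x"
          using vb ij by (auto simp: words_def fun_eq_iff extensional_def PiE_def)
      qed
      also have "\<dots> = (\<Sum>v\<in>words ?J k. C v * cnj (word_form ?J S \<pi> v))"
        by (simp add: C_def sum_distrib_right sum.cartesian_product)
      finally show ?thesis by simp
    qed
    have "C (restrict w ?J) = 0"
    proof (rule psubset.IH[OF _ invC orthC])
      show "?J \<subset> I" using ij by auto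
      show "restrict w ?J \<in> words ?J k" using w by (auto simp: words_def)
    qed
    moreover have "(restrict w ?J)(i := b, j := b) = w(i := b, j := b)" for b
      using w by (auto simp: words_def fun_eq_iff extensional_def PiE_def)
    ultimately show "(\<Sum>b<k. A (w(i := b, j := b))) = 0" by (simp add: C_def)
  qed
  show ?case
  proof (cases "I = {}")
    case True
    have "pairing {} id" using permutes_id[of "{}"] by (simp only: pairing_def) blast
    then have "(\<Sum>w\<in>words I k. A w * cnj (word_form I {} id w)) = 0"
        using orth[of "{}" id] True by (metis Diff_empty order_refl)
    moreover have "words I k = {w}" using psubset.prems(3) True by (auto simp: words_def)
    ultimately show ?thesis using True by (simp add: word_form_def vol_def)
  next
    case False
    consider "\<forall>w\<in>words I k. A w = 0" | "card I = k"
      "\<And>w x y. w \<in> words I k \<Longrightarrow> x \<in> I \<Longrightarrow> y \<in> I \<Longrightarrow> x \<noteq> y \<Longrightarrow> A (w \<circ> Transposition.transpose x y) = - A w"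
      using traceless_invariant_zero_or_antisymmetric[OF fin False inv traceless] by blast
    then show ?thesis
    proof cases
      case 1
      then show ?thesis using psubset.prems(3) by simp
    next
      case 2
      show ?thesis
      proof (rule ccontr)
        assume Aw: "A w \<noteq> 0"
        have w: "w \<in> words I k" by fact
        have inj: "inj_on w I"
          using traceless_invariant_vanishing(1)[OF fin inv traceless w Aw] .
        have wI: "w ` I = {..<k}"
        proof (rule card_subset_eq)
          show "w ` I \<subseteq> {..<k}" by (intro image_subsetI) (simp add: words_less[OF w])
          show "card (w ` I) = card {..<k}" by (simp add: card_image[OF inj] 2(1))
        qed simp
        \<comment> \<open>Both factors are alternating, so the product is the same for all words without repetitions.\<close>
        have const: "A v * cnj (word_form I I id v) = (if inj_on v I then A w * cnj (vol I w) else 0)"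
          if v: "v \<in> words I k" for v
        proof (cases "inj_on v I")
          case True
          have vI: "v ` I = {..<k}"
          proof (rule card_subset_eq)
            show "v ` I \<subseteq> {..<k}" by (intro image_subsetI) (simp add: words_less[OF v])
            show "card (v ` I) = card {..<k}" by (simp add: card_image[OF True] 2(1))
          qed simp
          define p where "p x = (if x \<in> I then inv_into I w (v x) else x)" for x
          have "bij_betw v I {..<k}" "bij_betw w I {..<k}"
            using True inj vI wI by (simp_all add: bij_betw_def)
          then have "bij_betw (inv_into I w \<circ> v) I I"
            by (rule bij_betw_trans[OF _ bij_betw_inv_into])
          then have "bij_betw p I I"
            by (subst bij_betw_cong[where g = "inv_into I w \<circ> v"]) (auto simp: p_def)
          then have p: "p permutes I" by (rule bij_imp_permutes) (simp add: p_def)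
          have "v = w \<circ> p"
          proof (rule words_eqI[OF v words_permute[OF w p]])
            fix x assume x: "x \<in> I"
            then have "v x \<in> w ` I" using vI wI by blast
            then show "v x = (w \<circ> p) x" using x by (simp add: p_def f_inv_into_f)
          qed
          moreover have "A (w \<circ> p) = of_int (sign p) * A w"
            by (rule transposition_antisymmetric_imp_sign[where X = "words I k", OF fin _ _ p w])
               (rule words_permute[OF _ permutes_swap_id] 2(2); assumption)+
          moreover have "vol I (w \<circ> p) = of_int (sign p) * vol I w"
            using vol_permutes[OF fin _ p] 2(1) by simp
          ultimately show ?thesis
            using True by (simp add: word_form_def flip: of_int_mult)
        next
          case False
          then show ?thesis using vol_not_inj[OF fin _ False] 2(1) by (simp add: word_form_def)
        qed
        have "pairing (I - I) id" by (rule pairing_empty) simp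
        from orth[OF order_refl disjI2[OF 2(1)] this]
        have "0 = (\<Sum>v\<in>words I k. A v * cnj (word_form I I id v))" by (rule sym)
        also have "\<dots> = (\<Sum>v\<in>words I k. if inj_on v I then A w * cnj (vol I w) else 0)"
          using const by simp
        also have "\<dots> = of_nat (card {v \<in> words I k. inj_on v I}) * (A w * cnj (vol I w))"
          using fin by (simp add: sum.inter_filter[symmetric])
        finally have "of_nat (card {v \<in> words I k. inj_on v I}) * (A w * cnj (vol I w)) = 0" by (rule sym)
        moreover have "vol I w \<noteq> 0"
          by (rule vol_nonzero[OF fin _ inj]) (use wI 2(1) in simp_all)
        moreover have "card {v \<in> words I k. inj_on v I} \<noteq> 0"
        proof -
          have "w \<in> {v \<in> words I k. inj_on v I}" "finite {v \<in> words I k. inj_on v I}"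
            using w inj fin by simp_all
          then show ?thesis by (metis card_0_eq empty_iff)
        qed
        ultimately show False using Aw by simp
      qed
    qed
  qed
qed

end

section \<open>Relabelling and straightening\<close>

text \<open>Every arc is counted at both ends. The sum is large when arcs cross or are disjoint and small when they are nested.\<close>

definition crossing_sum :: "nat set \<Rightarrow> nat set \<Rightarrow> (nat \<Rightarrow> nat) \<Rightarrow> nat" where
  "crossing_sum I S \<pi> = (\<Sum>v\<in>I - S. v * \<pi> v)"

definition diagram_less :: "nat set \<Rightarrow> nat set \<times> (nat \<Rightarrow> nat) \<Rightarrow> nat set \<times> (nat \<Rightarrow> nat) \<Rightarrow> bool" where
  "diagram_less I D D' \<longleftrightarrow> \<Sum>(fst D) < \<Sum>(fst D') \<or>
     (\<Sum>(fst D) = \<Sum>(fst D') \<and> crossing_sum I (fst D) (snd D) < crossing_sum I (fst D') (snd D'))"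

definition relabel :: "(nat \<Rightarrow> nat) \<Rightarrow> (nat \<Rightarrow> nat) \<Rightarrow> nat \<Rightarrow> nat" where
  "relabel s \<pi> = s \<circ> \<pi> \<circ> inv_into UNIV s"

lemma relabel_apply: "s permutes I \<Longrightarrow> relabel s \<pi> (s x) = s (\<pi> x)"
  by (simp add: relabel_def permutes_inverses)

lemma diff_image_permutes: "s permutes I \<Longrightarrow> S \<subseteq> I \<Longrightarrow> I - s ` S = s ` (I - S)"
  by (metis image_set_diff permutes_image permutes_inj)

lemma pairing_relabel:
  assumes s: "s permutes I" and "S \<subseteq> I" and \<pi>: "pairing (I - S) \<pi>"
  shows "pairing (I - s ` S) (relabel s \<pi>)"
proof -
  let ?r = "relabel s \<pi>"
  have eq: "I - s ` S = s ` (I - S)" using diff_image_permutes[OF s assms(2)] .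
  have out: "?r x = x" if "x \<notin> s ` (I - S)" for x
  proof -
    have "inv_into UNIV s x \<notin> I - S" using that s by (metis imageI permutes_inverses(1))
    then have "\<pi> (inv_into UNIV s x) = inv_into UNIV s x"
      using \<pi> by (metis pairing_def permutes_not_in)
    then show ?thesis using s by (simp add: relabel_def permutes_inverses)
  qed
  have inside: "?r x \<in> s ` (I - S) \<and> ?r x \<noteq> x \<and> ?r (?r x) = x" if x: "x \<in> s ` (I - S)" for x
  proof -
    obtain u where u: "u \<in> I - S" "x = s u" using x by blast
    have "\<pi> u \<in> I - S" "\<pi> u \<noteq> u" "\<pi> (\<pi> u) = u"
      using pairing_in[OF \<pi> u(1)] \<pi> u(1) unfolding pairing_def by blast+
    moreover have "s (\<pi> u) \<noteq> s u"
      using \<open>\<pi> u \<noteq> u\<close> permutes_inj[OF s] by (metis injD)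
    ultimately show ?thesis unfolding u(2) relabel_apply[OF s] by simp
  qed
  have "?r permutes s ` (I - S)"
    by (rule involution_permutes) (use inside out in blast)+
  then show ?thesis unfolding pairing_def eq using inside by blast
qed

context volume_form
begin

lemma word_form_relabel:
  assumes s: "s permutes I" and "finite I" "S \<subseteq> I" "S = {} \<or> card S = k"
  obtains c :: complex where "\<And>w. word_form I S \<pi> (w \<circ> s) = c * word_form I (s ` S) (relabel s \<pi>) w"
proof -
  have "finite S" using assms(2,3) finite_subset by blast
  moreover have "inj_on s S" using permutes_inj[OF s] by (rule inj_on_subset) simp
  ultimately obtain c where c: "\<And>w. vol S (w \<circ> s) = c * vol (s ` S) w"
    using vol_relabel[OF _ assms(4)] by metis
  have eq: "(\<forall>x\<in>I - S. (w \<circ> s) (\<pi> x) = (w \<circ> s) x) \<longleftrightarrow> (\<forall>y\<in>I - s ` S. w (relabel s \<pi> y) = w y)" for w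
    unfolding diff_image_permutes[OF s assms(3)] by (simp add: relabel_apply[OF s])
  have "word_form I S \<pi> (w \<circ> s) = c * word_form I (s ` S) (relabel s \<pi>) w" for w
    unfolding word_form_def c eq[of w] by simp
  then show ?thesis using that by blast
qed

end

text \<open>If the painted set changes, some of its elements move to the vertices of \<open>P1\<close>, which are further left. Otherwise \<open>s\<close> permutes the left ends \<open>P1\<close> of a chain of arcs against their increasing right ends, and the rearrangement inequality applies.\<close>

lemma straightening_step_decreases:
  assumes "finite I" "S \<subseteq> I" and \<pi>: "pairing (I - S) \<pi>"
    and P1: "P1 \<subseteq> I - S" "strict_mono_on P1 \<pi>" "\<And>x. x \<in> P1 \<Longrightarrow> x < \<pi> x"
    and P2: "P2 \<subseteq> S" "\<And>x y. x \<in> P1 \<Longrightarrow> y \<in> P2 \<Longrightarrow> x < y"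
    and s: "s permutes (P1 \<union> P2)" and x: "x \<in> P1" "s x \<noteq> x"
  shows "diagram_less I (s ` S, relabel s \<pi>) (S, \<pi>)"
proof (cases "s ` S = S")
  case False
  have fin: "finite S" using assms(1,2) finite_subset by blast
  have inj: "inj s" using permutes_inj[OF s] .
  have "\<Sum>(s ` S) < \<Sum>S"
  proof (rule sum_less_by_exchange)
    show "card (s ` S) = card S" using inj by (metis card_image inj_on_subset subset_UNIV)
    fix x y assume xy: "x \<in> s ` S - S" "y \<in> S - s ` S"
    obtain u where u: "u \<in> S" "x = s u" using xy(1) by blast
    have "u \<in> P1 \<union> P2" using xy(1) u s by (metis DiffE permutes_not_in)
    then have "x \<in> P1 \<union> P2" using u s by (metis permutes_in_image)
    then have "x \<in> P1" using xy(1) P2(1) by blast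
    moreover have "y \<in> P1 \<union> P2" using xy(2) s by (metis DiffE imageI permutes_not_in)
    then have "y \<in> P2" using xy(2) P1(1) by blast
    ultimately show "x < y" using P2(2) by blast
  qed (use fin False in simp_all)
  then show ?thesis by (simp add: diagram_less_def)
next
  case True
  let ?U = "I - S"
  have finU: "finite ?U" and finP1: "finite P1"
    using assms(1) P1(1) finite_subset by (blast, metis finite_Diff finite_subset)
  have inj: "inj s" using permutes_inj[OF s] .
  have sI: "s permutes I" using s by (rule permutes_subset) (use assms(2) P1(1) P2(1) in blast)
  have sU: "s ` ?U = ?U" using diff_image_permutes[OF sI assms(2)] True by simp
  have sP1: "s y \<in> P1" if "y \<in> P1" for y
  proof -
    have "s y \<in> P1 \<union> P2" using that s by (metis UnI1 permutes_in_image)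
    moreover have "s y \<in> ?U" using that P1(1) sU by blast
    ultimately show ?thesis using P2(1) by blast
  qed
  have fix_out: "s y = y" if "y \<in> ?U" "y \<notin> P1" for y
    using that P2(1) s by (metis DiffE Un_iff permutes_not_in subsetD)
  have disj: "\<pi> y \<notin> P1" if "y \<in> P1" for y
    using P1(3)[OF that] P1(3)[of "\<pi> y"] pairing_invol[OF \<pi>, of y] by auto
  have \<pi>U: "\<pi> y \<in> ?U" if "y \<in> ?U" for y using pairing_in[OF \<pi> that] .
  let ?Q = "\<pi> ` P1"
  let ?R = "?U - P1 - ?Q"
  have split: "(\<Sum>u\<in>?U. F u) = (\<Sum>u\<in>P1. F u) + (\<Sum>u\<in>P1. F (\<pi> u)) + (\<Sum>u\<in>?R. F u)" for F :: "nat \<Rightarrow> nat"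
  proof -
    have "?Q \<subseteq> ?U - P1" using disj \<pi>U P1(1) by blast
    moreover have "inj_on \<pi> P1" using pairing_invol[OF \<pi>] by (metis inj_onI)
    then have "(\<Sum>u\<in>?Q. F u) = (\<Sum>u\<in>P1. F (\<pi> u))" by (simp add: sum.reindex)
    ultimately show ?thesis
      using sum.subset_diff[OF P1(1) finU, of F] sum.subset_diff[of ?Q "?U - P1" F] finU by simp
  qed
  have "crossing_sum I S (relabel s \<pi>) = (\<Sum>y\<in>s ` ?U. y * relabel s \<pi> y)"
    by (simp only: crossing_sum_def sU)
  also have "\<dots> = (\<Sum>u\<in>?U. s u * s (\<pi> u))"
    using inj by (subst sum.reindex) (auto intro: inj_on_subset simp: relabel_apply[OF sI])
  also have "\<dots> = (\<Sum>u\<in>P1. s u * \<pi> u) + (\<Sum>u\<in>P1. \<pi> u * s u) + (\<Sum>u\<in>?R. u * \<pi> u)"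
  proof -
    have "s (\<pi> u) = \<pi> u" if "u \<in> P1" for u
      using that disj \<pi>U P1(1) fix_out by blast
    moreover have "s u * s (\<pi> u) = u * \<pi> u" if "u \<in> ?R" for u
    proof -
      have "\<pi> u \<notin> P1" using that pairing_invol[OF \<pi>, of u] by (metis DiffE imageI)
      then show ?thesis using that fix_out \<pi>U by (metis DiffD1 DiffD2)
    qed
    ultimately show ?thesis
      unfolding split by (simp add: pairing_invol[OF \<pi>])
  qed
  finally have new: "crossing_sum I S (relabel s \<pi>) = 2 * (\<Sum>u\<in>P1. s u * \<pi> u) + (\<Sum>u\<in>?R. u * \<pi> u)"
    by (simp add: mult.commute)
  have old: "crossing_sum I S \<pi> = 2 * (\<Sum>u\<in>P1. u * \<pi> u) + (\<Sum>u\<in>?R. u * \<pi> u)"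
    unfolding crossing_sum_def split by (simp add: pairing_invol[OF \<pi>] mult.commute)
  define t where "t y = (if y \<in> P1 then s y else y)" for y
  have inj1: "inj_on s P1" using inj by (rule inj_on_subset) simp
  have "s ` P1 = P1" by (rule endo_inj_surj[OF finP1 _ inj1]) (use sP1 in blast)
  then have "bij_betw s P1 P1" using inj1 by (simp add: bij_betw_def)
  then have "bij_betw t P1 P1" by (subst bij_betw_cong[where g = s]) (simp_all add: t_def)
  then have t: "t permutes P1" by (rule bij_imp_permutes) (simp add: t_def)
  have "t x \<noteq> id x" using x by (simp add: t_def)
  then have "t \<noteq> id" by metis
  moreover have "strict_mono_on P1 (\<lambda>y. int (\<pi> y))" using P1(2) by (simp add: strict_mono_on_def)
  ultimately have "(\<Sum>y\<in>P1. int (t y) * int (\<pi> y)) < (\<Sum>y\<in>P1. int y * int (\<pi> y))"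
    using rearrangement_le_and_strict[OF finP1 _ t] by blast
  then have "int (\<Sum>y\<in>P1. t y * \<pi> y) < int (\<Sum>y\<in>P1. y * \<pi> y)" by simp
  then have "(\<Sum>y\<in>P1. t y * \<pi> y) < (\<Sum>y\<in>P1. y * \<pi> y)" by (simp only: of_nat_less_iff)
  moreover have "(\<Sum>y\<in>P1. t y * \<pi> y) = (\<Sum>y\<in>P1. s y * \<pi> y)"
    by (rule sum.cong[OF refl]) (simp add: t_def)
  ultimately show ?thesis using True new old by (simp add: diagram_less_def)
qed

context volume_form
begin

text \<open>The alternating sum over \<open>P1 \<union> P2\<close> vanishes on words. The permutations fixing \<open>P1\<close> move painted vertices only, and the sign of the determinant cancels the sign of the permutation: each of them contributes the given form. All others contribute forms of smaller diagrams.\<close>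

lemma word_form_straighten:
  assumes I: "finite I" "S \<subseteq> I" "S = {} \<or> card S = k" and \<pi>: "pairing (I - S) \<pi>"
    and P1: "P1 \<subseteq> I - S" "strict_mono_on P1 \<pi>" "\<And>x. x \<in> P1 \<Longrightarrow> x < \<pi> x"
    and P2: "P2 \<subseteq> S" "\<And>x y. x \<in> P1 \<Longrightarrow> y \<in> P2 \<Longrightarrow> x < y"
    and card: "card (P1 \<union> P2) = Suc k"
  obtains G and c :: "(nat \<Rightarrow> nat) \<Rightarrow> complex" where "finite G"
    "\<And>s. s \<in> G \<Longrightarrow> s permutes I \<and> diagram_less I (s ` S, relabel s \<pi>) (S, \<pi>)"
    "\<And>w. w \<in> words I k \<Longrightarrow> word_form I S \<pi> w = (\<Sum>s\<in>G. c s * word_form I (s ` S) (relabel s \<pi>) w)"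
proof -
  let ?P = "P1 \<union> P2"
  have PI: "?P \<subseteq> I" using I(2) P1(1) P2(1) by blast
  have finP: "finite ?P" using PI I(1) finite_subset by blast
  have finS: "finite S" using I finite_subset by blast
  let ?F = "{s. s permutes ?P \<and> (\<forall>x\<in>P1. s x = x)}"
  let ?G = "{s. s permutes ?P \<and> (\<exists>x\<in>P1. s x \<noteq> x)}"
  have fin_all: "finite {s. s permutes ?P}" using finP by (rule finite_permutations)
  have finF: "finite ?F" and finG: "finite ?G" using fin_all by (auto elim: rev_finite_subset)
  have "id \<in> ?F" by (simp add: permutes_id)
  define m where "m = card ?F"
  have N: "m \<noteq> 0" unfolding m_def card_0_eq[OF finF] using \<open>id \<in> ?F\<close> by blast
  have sI: "s permutes I" if "s permutes ?P" for s using that PI by (rule permutes_subset)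
  have "\<exists>d :: complex. \<forall>w. word_form I S \<pi> (w \<circ> s) = d * word_form I (s ` S) (relabel s \<pi>) w"
    if "s permutes ?P" for s
    by (rule word_form_relabel[OF sI[OF that] I, of \<pi>]) blast
  note ex_d = this
  define d :: "(nat \<Rightarrow> nat) \<Rightarrow> complex" where
    "d s = (SOME d. \<forall>w. word_form I S \<pi> (w \<circ> s) = d * word_form I (s ` S) (relabel s \<pi>) w)" for s
  have d: "word_form I S \<pi> (w \<circ> s) = d s * word_form I (s ` S) (relabel s \<pi>) w"
    if "s permutes ?P" for s w
    unfolding d_def by (rule spec[OF someI_ex[OF ex_d[OF that]]])
  have F: "of_int (sign s) * word_form I S \<pi> (w \<circ> s) = word_form I S \<pi> w" if s: "s \<in> ?F" for s w
  proof -
    have sP: "s permutes ?P" and fix1: "\<forall>x\<in>P1. s x = x" using s by simp_all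
    have "s permutes P2" by (rule permutes_superset[OF sP]) (use fix1 in blast)
    then have sS: "s permutes S" using P2(1) by (rule permutes_subset)
    have "s x = x" "s (\<pi> x) = \<pi> x" if "x \<in> I - S" for x
      using permutes_not_in[OF sS] pairing_in[OF \<pi> that] that by simp_all
    then have iff: "(\<forall>x\<in>I - S. (w \<circ> s) (\<pi> x) = (w \<circ> s) x) \<longleftrightarrow> (\<forall>x\<in>I - S. w (\<pi> x) = w x)"
      by simp
    have "word_form I S \<pi> (w \<circ> s) = (if \<forall>x\<in>I - S. w (\<pi> x) = w x then vol S (w \<circ> s) else 0)"
      unfolding word_form_def iff ..
    also have "\<dots> = of_int (sign s) * word_form I S \<pi> w"
      unfolding vol_permutes[OF finS I(3) sS] by (simp add: word_form_def)
    finally show ?thesis by (simp add: mult.assoc[symmetric] flip: of_int_mult)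
  qed
  define c where "c s = - of_int (sign s) * d s / of_nat m" for s
  have c: "- of_nat m * (c s * X) = of_int (sign s) * (d s * X)" for s X
    using N by (simp add: c_def)
  have cancel: "p = q * r" if "0 = p + - q * r" for p q r :: complex
    using that[symmetric] by simp
  show ?thesis
  proof (rule that[OF finG])
    fix s assume "s \<in> ?G"
    show "s permutes I \<and> diagram_less I (s ` S, relabel s \<pi>) (S, \<pi>)"
    proof (intro conjI)
      have s: "s permutes ?P" using \<open>s \<in> ?G\<close> by blast
      show "s permutes I" using s by (rule sI)
      obtain x where x: "x \<in> P1" "s x \<noteq> x" using \<open>s \<in> ?G\<close> by blast
      show "diagram_less I (s ` S, relabel s \<pi>) (S, \<pi>)"
        by (rule straightening_step_decreases[where ?P1.0 = P1 and ?P2.0 = P2 and x = x]; fact)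
    qed
  next
    fix w assume w: "w \<in> words I k"
    have "\<not> inj_on w ?P"
    proof
      assume "inj_on w ?P"
      moreover have "w ` ?P \<subseteq> {..<k}" using words_less[OF w] PI by blast
      ultimately have "card ?P \<le> card {..<k}" by (rule card_inj_on_le) simp
      then show False using card by simp
    qed
    from signed_sum_eq_0_if_not_inj[OF finP this, of "word_form I S \<pi>"]
    have "0 = (\<Sum>s | s permutes ?P. of_int (sign s) * word_form I S \<pi> (w \<circ> s))"
      by (rule sym)
    also have "{s. s permutes ?P} = ?F \<union> ?G" by blast
    also have "(\<Sum>s\<in>?F \<union> ?G. of_int (sign s) * word_form I S \<pi> (w \<circ> s))
      = (\<Sum>s\<in>?F. of_int (sign s) * word_form I S \<pi> (w \<circ> s)) + (\<Sum>s\<in>?G. of_int (sign s) * word_form I S \<pi> (w \<circ> s))"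
      by (rule sum.union_disjoint[OF finF finG]) blast
    also have "(\<Sum>s\<in>?F. of_int (sign s) * word_form I S \<pi> (w \<circ> s)) = of_nat m * word_form I S \<pi> w"
    proof -
      have "(\<Sum>s\<in>?F. of_int (sign s) * word_form I S \<pi> (w \<circ> s)) = (\<Sum>s\<in>?F. word_form I S \<pi> w)"
        by (rule sum.cong[OF refl], rule F)
      then show ?thesis by (simp only: sum_constant m_def)
    qed
    also have "(\<Sum>s\<in>?G. of_int (sign s) * word_form I S \<pi> (w \<circ> s))
      = (\<Sum>s\<in>?G. - of_nat m * (c s * word_form I (s ` S) (relabel s \<pi>) w))"
    proof (rule sum.cong[OF refl])
      fix s assume "s \<in> ?G"
      then have s: "s permutes ?P" by blast
      show "of_int (sign s) * word_form I S \<pi> (w \<circ> s) = - of_nat m * (c s * word_form I (s ` S) (relabel s \<pi>) w)"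
        unfolding d[OF s] using c by (rule sym)
    qed
    also have "\<dots> = - of_nat m * (\<Sum>s\<in>?G. c s * word_form I (s ` S) (relabel s \<pi>) w)"
      by (simp only: sum_distrib_left)
    finally have "of_nat m * word_form I S \<pi> w
      = of_nat m * (\<Sum>s\<in>?G. c s * word_form I (s ` S) (relabel s \<pi>) w)"
      by (rule cancel)
    then show "word_form I S \<pi> w = (\<Sum>s\<in>?G. c s * word_form I (s ` S) (relabel s \<pi>) w)"
      by (rule mult_left_cancel[THEN iffD1, rotated]) (use N in simp)
  qed
qed

end

section \<open>Colourings and triangularity\<close>

lemma pairing_even_card:
  assumes "finite C" "\<And>x. x \<in> C \<Longrightarrow> \<pi> x \<in> C \<and> \<pi> x \<noteq> x \<and> \<pi> (\<pi> x) = x"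
  shows "even (card C)"
  using assms
proof (induction C rule: finite_psubset_induct)
  case (psubset C)
  show ?case
  proof (cases "C = {}")
    case False
    then obtain x where x: "x \<in> C" by blast
    let ?D = "C - {x, \<pi> x}"
    have px: "\<pi> x \<in> C" "\<pi> x \<noteq> x" "\<pi> (\<pi> x) = x" using psubset.prems[OF x] by blast+
    have "even (card ?D)"
    proof (rule psubset.IH)
      show "?D \<subset> C" using x by blast
      show "\<pi> y \<in> ?D \<and> \<pi> y \<noteq> y \<and> \<pi> (\<pi> y) = y" if "y \<in> ?D" for y
      proof -
        have y: "\<pi> y \<in> C" "\<pi> y \<noteq> y" "\<pi> (\<pi> y) = y" "y \<noteq> x" "y \<noteq> \<pi> x"
          using psubset.prems[of y] that by simp_all
        have "\<pi> y \<noteq> x" by (rule notI) (use y(3,5) in simp)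
        moreover have "\<pi> y \<noteq> \<pi> x" using y(3,4) px(3) by metis
        ultimately show ?thesis using y by simp
      qed
    qed
    moreover have "card C = card ?D + 2"
      using px x psubset.hyps card_Diff_subset[of "{x, \<pi> x}" C] card_mono[of C "{x, \<pi> x}"] by simp
    ultimately show ?thesis by simp
  qed simp
qed

text \<open>On each letter class, \<open>\<pi>\<close> reverses the order, and \<open>\<pi>' \<circ> \<pi>\<close> is a permutation of the class for any other pairing \<open>\<pi>'\<close> that respects it; the claim is the rearrangement inequality for the strictly increasing function \<open>- \<pi>\<close>.\<close>

lemma nested_pairing_minimises_crossing_sum:
  assumes "finite U" and \<pi>: "pairing U \<pi>" and \<pi>': "pairing U \<pi>'"
    and w: "\<And>x. x \<in> U \<Longrightarrow> w (\<pi> x) = w x" "\<And>x. x \<in> U \<Longrightarrow> w (\<pi>' x) = w x"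
    and nested: "\<And>x y. x \<in> U \<Longrightarrow> y \<in> U \<Longrightarrow> w x = w y \<Longrightarrow> x < y \<Longrightarrow> \<pi> y < \<pi> x"
    and ne: "\<pi>' \<noteq> \<pi>"
  shows "(\<Sum>v\<in>U. v * \<pi> v) < (\<Sum>v\<in>U. v * \<pi>' v)"
proof -
  define C where "C c = {v \<in> U. w v = c}" for c
  have finC: "finite (C c)" for c using assms(1) by (simp add: C_def)
  have CU: "x \<in> U" if "x \<in> C c" for x c using that by (simp add: C_def)
  have \<pi>C: "\<pi> x \<in> C c" "\<pi>' x \<in> C c" if "x \<in> C c" for x c
    using that w pairing_in[OF \<pi>] pairing_in[OF \<pi>'] by (simp_all add: C_def)
  define s where "s c x = (if x \<in> C c then \<pi>' (\<pi> x) else x)" for c x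
  have bij: "bij_betw (s c) (C c) (C c)" for c
  proof (rule bij_betw_byWitness[where f' = "\<lambda>x. \<pi> (\<pi>' x)"])
    show "\<forall>x\<in>C c. \<pi> (\<pi>' (s c x)) = x" "\<forall>x\<in>C c. s c (\<pi> (\<pi>' x)) = x"
      by (simp_all add: s_def \<pi>C pairing_invol[OF \<pi>] pairing_invol[OF \<pi>'])
    show "s c ` C c \<subseteq> C c" "(\<lambda>x. \<pi> (\<pi>' x)) ` C c \<subseteq> C c"
      by (rule image_subsetI, simp add: s_def \<pi>C)+
  qed
  have perm: "s c permutes C c" for c by (rule bij_imp_permutes[OF bij]) (simp add: s_def)
  have mono: "strict_mono_on (C c) (\<lambda>x. - int (\<pi> x))" for c
  proof (rule strict_mono_onI)
    fix x y assume "x \<in> C c" "y \<in> C c" "x < y"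
    then have "\<pi> y < \<pi> x" using nested[of x y] by (simp add: C_def)
    then show "- int (\<pi> x) < - int (\<pi> y)" by simp
  qed
  have new: "(\<Sum>v\<in>C c. v * \<pi>' v) = (\<Sum>x\<in>C c. s c x * \<pi> x)" for c
  proof -
    have "(\<Sum>v\<in>C c. v * \<pi>' v) = (\<Sum>x\<in>C c. s c x * \<pi>' (s c x))"
      using sum.reindex_bij_betw[OF bij, of "\<lambda>v. v * \<pi>' v" c] by simp
    also have "\<dots> = (\<Sum>x\<in>C c. s c x * \<pi> x)"
      by (rule sum.cong[OF refl]) (simp add: s_def pairing_invol[OF \<pi>'])
    finally show ?thesis .
  qed
  have neg: "(\<Sum>x\<in>C c. int (f x) * - int (\<pi> x)) = - int (\<Sum>x\<in>C c. f x * \<pi> x)" for c f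
    by (simp add: sum_negf)
  have int_le: "- int (\<Sum>x\<in>C c. s c x * \<pi> x) \<le> - int (\<Sum>x\<in>C c. x * \<pi> x) \<and>
      (s c \<noteq> id \<longrightarrow> - int (\<Sum>x\<in>C c. s c x * \<pi> x) < - int (\<Sum>x\<in>C c. x * \<pi> x))" for c
    using rearrangement_le_and_strict[OF finC mono perm, of c] unfolding neg .
  have le: "(\<Sum>x\<in>C c. x * \<pi> x) \<le> (\<Sum>v\<in>C c. v * \<pi>' v)"
    and less: "s c \<noteq> id \<Longrightarrow> (\<Sum>x\<in>C c. x * \<pi> x) < (\<Sum>v\<in>C c. v * \<pi>' v)" for c
    using int_le[of c] by (simp_all only: new neg_le_iff_le neg_less_iff_less of_nat_le_iff of_nat_less_iff simp_thms)
  obtain x where "\<pi>' x \<noteq> \<pi> x" using ne by blast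
  then have x: "x \<in> U" using \<pi> \<pi>' by (metis pairing_def permutes_not_in)
  define y where "y = \<pi> x"
  have y: "y \<in> C (w y)" using pairing_in[OF \<pi> x] by (simp add: C_def y_def)
  have "s (w y) y \<noteq> y"
    using y \<open>\<pi>' x \<noteq> \<pi> x\<close> by (simp add: s_def) (simp add: y_def pairing_invol[OF \<pi>])
  then have "s (w y) \<noteq> id" by (metis id_apply)
  note strict = less[OF this]
  have group: "(\<Sum>v\<in>U. F v) = (\<Sum>c\<in>w ` U. \<Sum>v\<in>C c. F v)" for F :: "nat \<Rightarrow> nat"
    unfolding C_def by (rule sum.group[symmetric]) (use assms(1) in simp_all)
  show ?thesis
    unfolding group
  proof (rule sum_strict_mono_ex1)
    show "\<exists>c\<in>w ` U. (\<Sum>v\<in>C c. v * \<pi> v) < (\<Sum>v\<in>C c. v * \<pi>' v)"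
      using strict CU[OF y] by (intro bexI[of _ "w y"] imageI)
  qed (simp_all add: assms(1) le)
qed

context volume_form
begin

text \<open>A nonzero value forces the second diagram to respect the colouring and to have one painted vertex of each colour. These lie weakly right of the elements of \<open>S\<close>, the first vertices of their classes. A hyperedge in the first diagram but not in the second is impossible, as the letter classes then have odd size and the second diagram pairs their elements.\<close>

lemma colouring_triangular:
  assumes I: "finite I" "0 \<notin> I" and S: "S \<subseteq> I" "S = {} \<or> card S = k" and \<pi>: "pairing (I - S) \<pi>"
    and w: "w \<in> words I k" "\<And>x. x \<in> I - S \<Longrightarrow> w (\<pi> x) = w x" "inj_on w S"
    and nested: "\<And>x y. x \<in> I - S \<Longrightarrow> y \<in> I - S \<Longrightarrow> w x = w y \<Longrightarrow> x < y \<Longrightarrow> \<pi> y < \<pi> x"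
    and left: "\<And>x p. x \<in> I - S \<Longrightarrow> p \<in> S \<Longrightarrow> w x = w p \<Longrightarrow> p < x"
    and S': "S' \<subseteq> I" "S' = {} \<or> card S' = k" and \<pi>': "pairing (I - S') \<pi>'"
    and nz: "word_form I S' \<pi>' w \<noteq> 0"
  shows "(S', \<pi>') = (S, \<pi>) \<or> diagram_less I (S, \<pi>) (S', \<pi>')"
proof -
  have fin: "finite S" "finite S'" using S(1) S'(1) I(1) finite_subset by blast+
  have w': "w (\<pi>' x) = w x" if "x \<in> I - S'" for x
    using nz that unfolding word_form_def by metis
  have "vol S' w \<noteq> 0" using nz unfolding word_form_def by metis
  then have inj': "inj_on w S'" using vol_not_inj[OF fin(2) S'(2)] by blast
  have surj: "w ` T = {..<k}" if "T \<subseteq> I" "card T = k" "inj_on w T" for T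
  proof (rule card_subset_eq)
    show "w ` T \<subseteq> {..<k}" using words_less[OF w(1)] that(1) by blast
    show "card (w ` T) = card {..<k}" using card_image[OF that(3)] that(2) by simp
  qed simp
  have same: ?thesis if "S' = S"
  proof (cases "\<pi>' = \<pi>")
    case False
    have "(\<Sum>v\<in>I - S. v * \<pi> v) < (\<Sum>v\<in>I - S. v * \<pi>' v)"
      by (rule nested_pairing_minimises_crossing_sum[where w = w, OF _ \<pi> \<pi>'[unfolded that] _ _ _ False])
         (use I(1) w(2) w' nested that in simp_all)
    then show ?thesis using that by (simp add: diagram_less_def crossing_sum_def)
  qed (simp add: that)
  show ?thesis
  proof (cases "S' = S")
    case True
    then show ?thesis by (rule same)
  next
    case False
    have "\<Sum>S < \<Sum>S'"
    proof (cases "S = {}")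
      case True
      then obtain p where p: "p \<in> S'" using False by blast
      then have "0 < p" using I(2) S'(1) by (metis gr0I subsetD)
      also have "p \<le> \<Sum>S'" using member_le_sum[of p S' "\<lambda>x. x"] fin(2) p by simp
      finally show ?thesis using True by simp
    next
      case ne: False
      then have cS: "card S = k" using S(2) by blast
      have wS: "w ` S = {..<k}" using surj[OF S(1) cS w(3)] .
      have "S' \<noteq> {}"
      proof
        assume "S' = {}"
        obtain p where p: "p \<in> S" using ne by blast
        let ?C = "{x \<in> I. w x = w p}"
        have finC: "finite ?C" by (rule finite_subset[OF _ I(1)]) blast
        have e1: "even (card ?C)"
        proof (rule pairing_even_card)
          show "\<pi>' x \<in> ?C \<and> \<pi>' x \<noteq> x \<and> \<pi>' (\<pi>' x) = x" if "x \<in> ?C" for x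
          proof -
            have "x \<in> I - S'" "w x = w p" using that \<open>S' = {}\<close> by simp_all
            moreover from this(1) have "\<pi>' x \<in> I - S'" "w (\<pi>' x) = w x" "\<pi>' x \<noteq> x" "\<pi>' (\<pi>' x) = x"
              by (rule pairingD[OF \<pi>'] w')+
            ultimately show ?thesis by simp
          qed
        qed (rule finC)
        have e2: "even (card (?C - {p}))"
        proof (rule pairing_even_card)
          show "\<pi> x \<in> ?C - {p} \<and> \<pi> x \<noteq> x \<and> \<pi> (\<pi> x) = x" if x: "x \<in> ?C - {p}" for x
          proof -
            have xw: "x \<in> I" "w x = w p" "x \<noteq> p" using x by simp_all
            have "x \<notin> S" using inj_onD[OF w(3) xw(2) _ p] xw(3) by blast
            then have "x \<in> I - S" using xw(1) by simp
            then have *: "\<pi> x \<in> I - S" "w (\<pi> x) = w x" "\<pi> x \<noteq> x" "\<pi> (\<pi> x) = x"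
              by (rule pairingD[OF \<pi>] w(2))+
            moreover have "\<pi> x \<noteq> p" using *(1) p by blast
            ultimately show ?thesis using xw(2) by simp
          qed
        qed (rule finite_Diff[OF finC])
        have ceq: "card ?C = Suc (card (?C - {p}))"
        proof (rule card.remove)
          show "finite ?C" by (rule finC)
          show "p \<in> ?C" using p S(1) by blast
        qed
        from e1 have "\<not> even (card (?C - {p}))" unfolding ceq even_Suc .
        then show False using e2 by (rule notE)
      qed
      then have cS': "card S' = k" using S'(2) by blast
      have wS': "w ` S' = {..<k}" using surj[OF S'(1) cS' inj'] .
      define f where "f q = inv_into S w (w q)" for q
      have f: "f q \<in> S" "w (f q) = w q" if "q \<in> S'" for q
      proof -
        have "w q \<in> w ` S'" using that by (rule imageI)
        then have *: "w q \<in> w ` S" by (simp only: wS wS')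
        show "f q \<in> S" unfolding f_def using * by (rule inv_into_into)
        show "w (f q) = w q" unfolding f_def using * by (rule f_inv_into_f)
      qed
      have le: "f q \<le> q" "f q = q \<or> f q < q" if "q \<in> S'" for q
      proof -
        have "f q = q \<or> f q < q"
        proof (cases "q \<in> S")
          case True
          then have "f q = q" unfolding f_def using w(3) by simp
          then show ?thesis by simp
        next
          case False
          have "f q < q"
            by (rule left) (use False that S'(1) f[OF that] in auto)
          then show ?thesis by simp
        qed
        then show "f q \<le> q" "f q = q \<or> f q < q" by auto
      qed
      have "inj_on f S'" using inj' f(2) by (metis inj_on_def)
      moreover have "f ` S' \<subseteq> S" using f(1) by blast
      ultimately have bij: "bij_betw f S' S"
        using fin cS cS' by (metis bij_betw_def card_image card_subset_eq)
      have "\<Sum>S = (\<Sum>q\<in>S'. f q)" using sum.reindex_bij_betw[OF bij, of "\<lambda>x. x"] by simp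
      moreover have "\<exists>q\<in>S'. f q \<noteq> q"
      proof (rule ccontr)
        assume "\<not> (\<exists>q\<in>S'. f q \<noteq> q)"
        then have "f ` S' = S'" by simp
        then show False using bij False by (simp add: bij_betw_def)
      qed
      then have "(\<Sum>q\<in>S'. f q) < (\<Sum>q\<in>S'. q)"
        by (intro sum_strict_mono_ex1 fin) (use le in blast)+
      ultimately show ?thesis by simp
    qed
    then show ?thesis by (simp add: diagram_less_def)
  qed
qed

end

section \<open>Layers and chains of arcs\<close>

text \<open>Two arcs are comparable in this order exactly if they are not weakly nested, so weak nestings are antichains and layers are formed by successively removing the minimal elements.\<close>

definition below :: "arc \<Rightarrow> arc \<Rightarrow> bool" where
  "below a b \<longleftrightarrow> fst a < fst b \<and> snd a < snd b"

lemma below_trans: "below a b \<Longrightarrow> below b c \<Longrightarrow> below a c"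
  by (auto simp: below_def)

lemma mem_first_layer: "a \<in># first_layer M \<longleftrightarrow> a \<in># M \<and> \<not> (\<exists>a'\<in>#M. below a' a)"
  by (cases a) (auto simp: first_layer_def below_def split: prod.splits)

lemma mem_layer: "a \<in># layer M l \<longleftrightarrow> a \<in># remaining_arcs M l \<and> \<not> (\<exists>a'\<in>#remaining_arcs M l. below a' a)"
  unfolding layer_def by (rule mem_first_layer)

lemma first_layer_eq: "first_layer M = filter_mset (\<lambda>a. \<not> (\<exists>a'\<in>#M. below a' a)) M"
  unfolding first_layer_def by (rule filter_mset_cong) (auto simp: below_def split: prod.splits)

lemma remaining_arcs_Suc_eq:
  "remaining_arcs M (Suc l) = filter_mset (\<lambda>a. \<exists>a'\<in>#remaining_arcs M l. below a' a) (remaining_arcs M l)"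
proof -
  let ?R = "remaining_arcs M l" and ?P = "\<lambda>a. \<exists>a'\<in>#remaining_arcs M l. below a' a"
  have "?R - filter_mset (\<lambda>a. \<not> ?P a) ?R = filter_mset ?P ?R" by (rule multiset_eqI) simp
  then show ?thesis by (simp only: remaining_arcs.simps first_layer_eq)
qed

lemma mem_remaining_Suc:
  "a \<in># remaining_arcs M (Suc l) \<longleftrightarrow> a \<in># remaining_arcs M l \<and> (\<exists>a'\<in>#remaining_arcs M l. below a' a)"
  unfolding remaining_arcs_Suc_eq by simp

lemma remaining_arcs_antimono: "l \<le> l' \<Longrightarrow> a \<in># remaining_arcs M l' \<Longrightarrow> a \<in># remaining_arcs M l"
  by (induction l' rule: dec_induct) (auto simp: mem_remaining_Suc simp del: remaining_arcs.simps)

lemma remaining_subset: "a \<in># remaining_arcs M l \<Longrightarrow> a \<in># M"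
  using remaining_arcs_antimono[of 0 l a M] by simp

lemma layer_subset: "a \<in># layer M l \<Longrightarrow> a \<in># M"
  using remaining_subset mem_layer by blast

lemma layer_pred:
  assumes "a \<in># layer M (Suc l)"
  shows "\<exists>a'\<in>#layer M l. below a' a"
proof -
  have a: "a \<in># remaining_arcs M (Suc l)" "\<not> (\<exists>a'\<in>#remaining_arcs M (Suc l). below a' a)"
    using assms unfolding mem_layer by blast+
  then obtain a' where a': "a' \<in># remaining_arcs M l" "below a' a"
    unfolding mem_remaining_Suc by blast
  then have "a' \<notin># remaining_arcs M (Suc l)" using a(2) by blast
  then have "a' \<in># layer M l" using a'(1) unfolding mem_layer mem_remaining_Suc by blast
  then show ?thesis using a'(2) by blast
qed

text \<open>An arc survives to the next layer because some arc of the current layer lies below it.\<close>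

lemma layer_chain:
  assumes "a \<in># layer M l"
  obtains f where "f l = a" "\<And>m. m \<le> l \<Longrightarrow> f m \<in># M" "\<And>m m'. m < m' \<Longrightarrow> m' \<le> l \<Longrightarrow> below (f m) (f m')"
proof -
  have "\<exists>f. f l = a \<and> (\<forall>m\<le>l. f m \<in># M) \<and> (\<forall>m'\<le>l. \<forall>m<m'. below (f m) (f m'))"
    using assms
  proof (induction l arbitrary: a)
    case 0
    then show ?case using layer_subset by (intro exI[of _ "\<lambda>_. a"]) auto
  next
    case (Suc l)
    obtain a' where a': "a' \<in># layer M l" "below a' a" using layer_pred[OF Suc.prems] by blast
    obtain f where f: "f l = a'" "\<forall>m\<le>l. f m \<in># M" "\<forall>m'\<le>l. \<forall>m<m'. below (f m) (f m')"
      using Suc.IH[OF a'(1)] by blast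
    let ?g = "\<lambda>m. if m = Suc l then a else f m"
    have "below (f m) a" if "m \<le> l" for m
      using f(1,3) a'(2) that below_trans by (metis le_eq_less_or_eq order_refl)
    then have "below (?g m) (?g m')" if "m < m'" "m' \<le> Suc l" for m m'
      using that f(3) by auto
    moreover have "?g m \<in># M" if "m \<le> Suc l" for m
      using that f(2) layer_subset[OF Suc.prems] by auto
    ultimately show ?case by (intro exI[of _ ?g]) simp
  qed
  then show ?thesis using that by blast
qed

lemma layer_empty_imp_exhausted:
  assumes "layer M l = {#}"
  shows "remaining_arcs M l = {#}"
proof (rule ccontr)
  let ?R = "remaining_arcs M l"
  assume "?R \<noteq> {#}"
  then have "finite (set_mset ?R)" "set_mset ?R \<noteq> {}" by simp_all
  then have "Min (fst ` set_mset ?R) \<in> fst ` set_mset ?R" by (intro Min_in) simp_all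
  then obtain a where a: "a \<in># ?R" "fst a = Min (fst ` set_mset ?R)" by (metis imageE)
  have "\<forall>b\<in>#?R. fst a \<le> fst b" unfolding a(2) by (intro ballI Min_le) simp_all
  then have "a \<in># layer M l" using a(1) unfolding mem_layer below_def by (metis not_le)
  then show False using assms by simp
qed

lemma layer_empty_mono:
  assumes "layer M l = {#}" "l \<le> l'"
  shows "layer M l' = {#}"
proof -
  have "a \<notin># layer M l'" for a
    using remaining_arcs_antimono[OF assms(2), of a M] layer_empty_imp_exhausted[OF assms(1)]
    by (auto simp: mem_layer)
  then show ?thesis by (metis multiset_nonemptyE)
qed

lemma arc_in_some_layer:
  assumes "layer M K = {#}" "a \<in># M"
  obtains l where "l < K" "a \<in># layer M l"
proof -
  have ex: "\<exists>l<K. a \<in># layer M l" if "a \<notin># remaining_arcs M K" for K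
    using that
  proof (induction K)
    case 0
    then show ?case using assms(2) by simp
  next
    case (Suc K)
    show ?case
    proof (cases "a \<in># remaining_arcs M K")
      case True
      then have "a \<in># layer M K" using Suc.prems unfolding mem_layer mem_remaining_Suc by blast
      then show ?thesis by blast
    next
      case False
      then show ?thesis using Suc.IH less_SucI by blast
    qed
  qed
  have "a \<notin># remaining_arcs M K" by (simp only: layer_empty_imp_exhausted[OF assms(1)]) simp
  from ex[OF this] show ?thesis using that by blast
qed

lemma weak_nesting_iff_no_below:
  assumes "\<And>a. a \<in># N \<Longrightarrow> fst a \<le> snd a"
  shows "weak_nesting N \<longleftrightarrow> (\<forall>a\<in>#N. \<forall>b\<in>#N. \<not> below a b)"
proof
  assume wn: "weak_nesting N"
  show "\<forall>a\<in>#N. \<forall>b\<in>#N. \<not> below a b"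
  proof (intro ballI)
    fix a b assume "a \<in># N" "b \<in># N"
    then have "weakly_nested a b" using wn by (simp add: weak_nesting_def)
    then show "\<not> below a b" by (cases a; cases b) (auto simp: below_def)
  qed
next
  assume nb: "\<forall>a\<in>#N. \<forall>b\<in>#N. \<not> below a b"
  show "weak_nesting N"
    unfolding weak_nesting_def
  proof (intro ballI)
    fix a b assume ab: "a \<in># N" "b \<in># N"
    have "\<not> below a b" "\<not> below b a" "fst a \<le> snd a" "fst b \<le> snd b" using nb ab assms by blast+
    then show "weakly_nested a b" by (cases a; cases b) (auto simp: below_def)
  qed
qed

lemma sum_layers: "sum_list (map (layer M) [0..<l]) + remaining_arcs M l = M"
proof (induction l)
  case (Suc l)
  have "layer M l \<subseteq># remaining_arcs M l" by (simp add: layer_def first_layer_eq)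
  then have "layer M l + remaining_arcs M (Suc l) = remaining_arcs M l" by (simp add: layer_def)
  then show ?case using Suc by (simp add: add.assoc del: remaining_arcs.simps)
qed simp

text \<open>Layers are weak nestings, and conversely a chain through \<open>k + 1\<close> layers needs a separate weak nesting for each of its arcs.\<close>

lemma decomposes_iff_layer_empty:
  assumes le: "\<And>a. a \<in># M \<Longrightarrow> fst a \<le> snd a"
  shows "decomposes_into_weak_nestings k M \<longleftrightarrow> layer M k = {#}"
proof
  assume "layer M k = {#}"
  then have "sum_list (map (layer M) [0..<k]) = M"
    using sum_layers[of M k] layer_empty_imp_exhausted[of M k] by simp
  moreover have "weak_nesting (layer M l)" for l
  proof (subst weak_nesting_iff_no_below)
    show "fst a \<le> snd a" if "a \<in># layer M l" for a by (rule le[OF layer_subset[OF that]])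
    show "\<forall>a\<in>#layer M l. \<forall>b\<in>#layer M l. \<not> below a b" 
    proof (intro ballI)
      fix a b assume "a \<in># layer M l" "b \<in># layer M l"
      then have "a \<in># remaining_arcs M l" "\<not> (\<exists>a'\<in>#remaining_arcs M l. below a' b)"
        unfolding mem_layer by blast+
      then show "\<not> below a b" by blast
    qed
  qed
  ultimately show "decomposes_into_weak_nestings k M"
    unfolding decomposes_into_weak_nestings_def by (intro exI[of _ "map (layer M) [0..<k]"]) auto
next
  assume "decomposes_into_weak_nestings k M"
  then obtain Ns where Ns: "length Ns \<le> k" "\<And>N. N \<in> set Ns \<Longrightarrow> weak_nesting N" "sum_list Ns = M"
    unfolding decomposes_into_weak_nestings_def by blast
  have memM: "a \<in># M \<longleftrightarrow> (\<exists>N\<in>set Ns. a \<in># N)" for a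
    unfolding Ns(3)[symmetric] by (induction Ns) auto
  show "layer M k = {#}"
  proof (rule ccontr)
    assume "layer M k \<noteq> {#}"
    then obtain a where "a \<in># layer M k" by (metis multiset_nonemptyE)
    then obtain f where f: "\<And>m. m \<le> k \<Longrightarrow> f m \<in># M" "\<And>m m'. m < m' \<Longrightarrow> m' \<le> k \<Longrightarrow> below (f m) (f m')"
      by (rule layer_chain) blast
    have "\<exists>N. N < length Ns \<and> f m \<in># Ns ! N" if "m \<le> k" for m
      using f(1)[OF that] unfolding memM by (metis in_set_conv_nth)
    then obtain h where h: "\<And>m. m \<le> k \<Longrightarrow> h m < length Ns \<and> f m \<in># Ns ! h m" by metis
    have "\<not> inj_on h {..k}"
    proof
      assume "inj_on h {..k}"
      then have "card {..k} \<le> card {..<length Ns}" by (rule card_inj_on_le) (use h in auto)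
      then show False using Ns(1) by simp
    qed
    then obtain m m' where m: "m < m'" "m' \<le> k" "h m = h m'"
      unfolding inj_on_def by (metis atMost_iff linorder_neqE_nat)
    let ?N = "Ns ! h m"
    have N: "?N \<in> set Ns" "f m \<in># ?N" "f m' \<in># ?N" using h[of m] h[of m'] m by auto
    have "fst b \<le> snd b" if "b \<in># ?N" for b using le memM N(1) that by blast
    then show False using weak_nesting_iff_no_below[of ?N] Ns(2)[OF N(1)] N(2,3) f(2)[OF m(1,2)] by blast
  qed
qed

lemma mem_arcs_diagram_of:
  "finite U \<Longrightarrow> a \<in># arcs (diagram_of U S \<pi>) \<longleftrightarrow> (\<exists>v\<in>U. v < \<pi> v \<and> a = (v, \<pi> v))"
  by auto

lemma basis_diagrams_iff:
  "D \<in> basis_diagrams n k \<longleftrightarrow> D \<in> one_regular_diagrams n k \<and> (has_hyperedge D \<longrightarrow> painting_rule D) \<and>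
     layer (arcs D) k = {#}"
proof -
  have "decomposes_into_weak_nestings k (arcs D) \<longleftrightarrow> layer (arcs D) k = {#}" if "arc_diagram n k D"
    by (rule decomposes_iff_layer_empty) (use that in \<open>auto simp: arc_diagram_def\<close>)
  then show ?thesis by (auto simp: basis_diagrams_def one_regular_diagrams_def)
qed

lemma painted_vertex_mono:
  assumes "finite S" "l < l'" "l' < card S"
  shows "painted_vertex (diagram_of U S \<pi>) l < painted_vertex (diagram_of U S \<pi>) l'"
proof -
  have "sorted_wrt (<) (sorted_list_of_set S)" by simp
  then show ?thesis unfolding painted_vertex_def using assms by (simp add: sorted_wrt_nth_less)
qed

text \<open>An arc in the layer with index \<open>l\<close> ends a chain of \<open>l + 1\<close> arcs. If this layer exists for \<open>l = k\<close>, the left ends of the chain suffice. If the arc violates the painting rule for some \<open>l < k\<close>, the \<open>k - l\<close> painted vertices from index \<open>l\<close> on lie right of the chain and complete it to \<open>k + 1\<close> vertices.\<close>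

lemma non_basis_diagram_chain:
  assumes U: "U = {1..n} - S" and S: "S \<subseteq> {1..n}" "S = {} \<or> card S = k" and \<pi>: "pairing U \<pi>"
    and nb: "diagram_of U S \<pi> \<notin> basis_diagrams n k"
  obtains P1 P2 where "P1 \<subseteq> U" "strict_mono_on P1 \<pi>" "\<And>x. x \<in> P1 \<Longrightarrow> x < \<pi> x"
    "P2 \<subseteq> S" "\<And>x y. x \<in> P1 \<Longrightarrow> y \<in> P2 \<Longrightarrow> x < y" "card (P1 \<union> P2) = Suc k"
proof -
  let ?D = "diagram_of U S \<pi>"
  let ?M = "arcs ?D"
  have finU: "finite U" and finS: "finite S" using U S(1) finite_subset by auto
  have chain: "\<exists>P1. P1 \<subseteq> U \<and> strict_mono_on P1 \<pi> \<and> (\<forall>x\<in>P1. x < \<pi> x \<and> x \<le> fst a) \<and> finite P1 \<and> card P1 = Suc l"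
    if a: "a \<in># layer ?M l" for a l
  proof -
    obtain f where f: "f l = a" "\<And>m. m \<le> l \<Longrightarrow> f m \<in># ?M" "\<And>m m'. m < m' \<Longrightarrow> m' \<le> l \<Longrightarrow> below (f m) (f m')"
      using layer_chain[OF a] by blast
    have fm: "fst (f m) \<in> U" "fst (f m) < \<pi> (fst (f m))" "snd (f m) = \<pi> (fst (f m))" if "m \<le> l" for m
      using f(2)[OF that] unfolding mem_arcs_diagram_of[OF finU] by auto
    have mono: "strict_mono_on {..l} (\<lambda>m. fst (f m))"
      using f(3) by (simp add: strict_mono_on_def below_def)
    let ?P = "(\<lambda>m. fst (f m)) ` {..l}"
    have "card ?P = Suc l" using card_image[OF strict_mono_on_imp_inj_on[OF mono]] by simp
    moreover have "strict_mono_on ?P \<pi>"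
    proof (rule strict_mono_onI)
      fix x y assume "x \<in> ?P" "y \<in> ?P" and xy: "x < y"
      then obtain p q where pq: "p \<le> l" "q \<le> l" "x = fst (f p)" "y = fst (f q)" by auto
      have "p < q"
      proof (rule ccontr)
        assume "\<not> p < q"
        then have "y \<le> x" using pq f(3)[of q p] by (cases "p = q") (auto simp: below_def)
        then show False using xy by simp
      qed
      then have "snd (f p) < snd (f q)" using f(3) pq(2) by (simp add: below_def)
      then show "\<pi> x < \<pi> y" using fm(3) pq by simp
    qed
    moreover have "fst (f m) \<le> fst a" if "m \<le> l" for m
      using f(1) f(3)[of m l] that by (cases "m = l") (auto simp: below_def)
    ultimately show ?thesis using fm by (intro exI[of _ ?P]) auto
  qed
  show ?thesis
  proof (cases "layer ?M k = {#}")
    case False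
    then obtain a where "a \<in># layer ?M k" by (metis multiset_nonemptyE)
    then obtain P1 where P1: "P1 \<subseteq> U" "strict_mono_on P1 \<pi>" "\<forall>x\<in>P1. x < \<pi> x \<and> x \<le> fst a" "card P1 = Suc k"
      using chain by blast
    show ?thesis by (rule that[of P1 "{}"]) (use P1 in auto)
  next
    case True
    have "?D \<in> one_regular_diagrams n k"
      unfolding U by (rule diagram_of_in_one_regular) (use U \<pi> S in auto)
    then have hp: "has_hyperedge ?D" "\<not> painting_rule ?D" using nb True unfolding basis_diagrams_iff by blast+
    then have card: "card S = k" using S(2) unfolding has_hyperedge_def painted_diagram_of by blast
    obtain l where l: "layer ?M l \<noteq> {#}" "l < card S \<longrightarrow> \<not> (\<forall>(i, j)\<in>#layer ?M l. painted_vertex ?D l \<le> i)"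
      using hp(2) unfolding painting_rule_def painted_diagram_of by blast
    have lk: "l < k" using layer_empty_mono[OF True, of l] l(1) by (meson not_le)
    then obtain a where a: "a \<in># layer ?M l" "fst a < painted_vertex ?D l"
      using l(2) card by (auto simp: not_le)
    obtain P1 where P1: "P1 \<subseteq> U" "strict_mono_on P1 \<pi>" "\<forall>x\<in>P1. x < \<pi> x \<and> x \<le> fst a" "finite P1" "card P1 = Suc l"
      using chain[OF a(1)] by blast
    let ?p = "painted_vertex ?D"
    let ?P2 = "?p ` {l..<k}"
    have p_mono: "strict_mono_on {l..<k} ?p"
      using painted_vertex_mono[OF finS] card by (auto simp: strict_mono_on_def)
    have c2: "card ?P2 = k - l" using card_image[OF strict_mono_on_imp_inj_on[OF p_mono]] by simp
    have "?p m \<in> S" if "m < k" for m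
      using that card finS nth_mem[of m "sorted_list_of_set S"] by (simp add: painted_vertex_def)
    then have P2S: "?P2 \<subseteq> S" by auto
    have lt: "x < y" if x: "x \<in> P1" and y: "y \<in> ?P2" for x y
    proof -
      obtain m where m: "l \<le> m" "m < k" "y = ?p m" using y by auto
      have "?p l \<le> ?p m" using m painted_vertex_mono[OF finS, of l m U \<pi>] card by (cases "l = m") auto
      moreover have "x \<le> fst a" using x P1(3) by blast
      ultimately show ?thesis using m(3) a(2) by linarith
    qed
    have "P1 \<inter> ?P2 = {}" using lt by blast
    then have "card (P1 \<union> ?P2) = Suc k" using P1(4,5) c2 lk by (simp add: card_Un_disjoint)
    then show ?thesis by (intro that[of P1 ?P2]) (use P1 P2S lt in blast)+
  qed
qed

text \<open>The letter of a vertex is the index of the layer of its arc, or its rank among the painted vertices. Arcs of one layer are pairwise nested, and the painting rule puts the painted vertex in front of them.\<close>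

lemma basis_diagram_colouring:
  assumes U: "U = {1..n} - S" and S: "S \<subseteq> {1..n}" "S = {} \<or> card S = k" and \<pi>: "pairing U \<pi>"
    and basis: "diagram_of U S \<pi> \<in> basis_diagrams n k"
  obtains w where "w \<in> words {1..n} k" "\<And>x. x \<in> U \<Longrightarrow> w (\<pi> x) = w x" "inj_on w S"
    "\<And>x y. x \<in> U \<Longrightarrow> y \<in> U \<Longrightarrow> w x = w y \<Longrightarrow> x < y \<Longrightarrow> \<pi> y < \<pi> x"
    "\<And>x p. x \<in> U \<Longrightarrow> p \<in> S \<Longrightarrow> w x = w p \<Longrightarrow> p < x"
proof -
  let ?D = "diagram_of U S \<pi>"
  let ?M = "arcs ?D" and ?p = "painted_vertex (diagram_of U S \<pi>)"
  have finU: "finite U" and finS: "finite S" using U S(1) finite_subset by auto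
  define arc_of where "arc_of v = (min v (\<pi> v), max v (\<pi> v))" for v
  note \<pi>U = pairingD[OF \<pi>]
  have arcM: "arc_of v \<in># ?M" if "v \<in> U" for v
  proof (cases "v < \<pi> v")
    case True
    then show ?thesis unfolding mem_arcs_diagram_of[OF finU] arc_of_def using that by (intro bexI[of _ v]) auto
  next
    case False
    then show ?thesis unfolding mem_arcs_diagram_of[OF finU] arc_of_def using \<pi>U[OF that] by (intro bexI[of _ "\<pi> v"]) auto
  qed
  have empty: "layer ?M k = {#}" and rule: "has_hyperedge ?D \<longrightarrow> painting_rule ?D"
    using basis unfolding basis_diagrams_iff by blast+
  define lev where "lev v = (SOME l. l < k \<and> arc_of v \<in># layer ?M l)" for v
  have lev: "lev v < k" "arc_of v \<in># layer ?M (lev v)" if v: "v \<in> U" for v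
  proof -
    obtain l where "l < k" "arc_of v \<in># layer ?M l" using arc_in_some_layer[OF empty arcM[OF v]] by blast
    then have "\<exists>l. l < k \<and> arc_of v \<in># layer ?M l" by blast
    from someI_ex[OF this] show "lev v < k" "arc_of v \<in># layer ?M (lev v)" unfolding lev_def by blast+
  qed
  have bij: "S = {} \<or> bij_betw ?p {..<k} S"
    unfolding painted_vertex_def painted_diagram_of
    using S(2) finS by (metis bij_betw_nth distinct_sorted_list_of_set length_sorted_list_of_set set_sorted_list_of_set)
  define w where "w v = (if v \<in> U then lev v else if v \<in> S then inv_into {..<k} ?p v else undefined)" for v
  have wS: "w q < k" "?p (w q) = q" if "q \<in> S" for q
  proof -
    have "q \<notin> U" using that U by blast
    then have w: "w q = inv_into {..<k} ?p q" using that by (simp add: w_def)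
    have q: "q \<in> ?p ` {..<k}" using bij that by (auto simp: bij_betw_def)
    show "w q < k" unfolding w using inv_into_into[OF q] by simp
    show "?p (w q) = q" unfolding w using q by (rule f_inv_into_f)
  qed
  have wU: "w v = lev v" if "v \<in> U" for v using that by (simp add: w_def)
  show ?thesis
  proof (rule that[of w])
    have "w v < k" if "v \<in> {1..n}" for v using that U lev(1) wU wS(1) by (metis DiffI)
    moreover have "w v = undefined" if "v \<notin> {1..n}" for v
    proof -
      have "v \<notin> U" "v \<notin> S" using that U S(1) by blast+
      then show ?thesis by (simp add: w_def)
    qed
    ultimately show "w \<in> words {1..n} k" unfolding words_def by (intro PiE_I) simp_all
    show "w (\<pi> x) = w x" if "x \<in> U" for x
    proof -
      have "arc_of (\<pi> x) = arc_of x" using \<pi>U(3)[OF that] by (simp add: arc_of_def min.commute max.commute)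
      then show ?thesis using \<pi>U(1)[OF that] that by (simp add: w_def lev_def)
    qed
    show "inj_on w S" using wS(2) by (metis inj_onI)
    show "\<pi> y < \<pi> x" if xy: "x \<in> U" "y \<in> U" "w x = w y" "x < y" for x y
    proof (cases "y = \<pi> x")
      case True
      then show ?thesis using \<pi>U(3)[OF xy(1)] xy(4) by simp
    next
      case False
      have "\<not> below (arc_of x) (arc_of y)" "\<not> below (arc_of y) (arc_of x)"
        using lev(2)[OF xy(1)] lev(2)[OF xy(2)] xy(3) wU[OF xy(1)] wU[OF xy(2)] unfolding mem_layer by metis+
      moreover have "\<pi> x \<noteq> \<pi> y" using \<pi>U(3)[OF xy(1)] \<pi>U(3)[OF xy(2)] xy(4) by (metis less_irrefl_nat)
      moreover have "x \<noteq> \<pi> y" using \<pi>U(3)[OF xy(2)] False by metis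
      ultimately show ?thesis
        using xy(4) False \<pi>U(2)[OF xy(1)] \<pi>U(2)[OF xy(2)]
        unfolding below_def arc_of_def fst_conv snd_conv min_def max_def by (auto split: if_splits)
    qed
    show "p < x" if "x \<in> U" "p \<in> S" "w x = w p" for x p
    proof -
      have "has_hyperedge ?D" using that(2) by (auto simp: has_hyperedge_def)
      then have "painting_rule ?D" using rule by blast
      moreover have a: "arc_of x \<in># layer ?M (w p)" using lev(2)[OF that(1)] wU[OF that(1)] that(3) by simp
      then have "layer ?M (w p) \<noteq> {#}" by auto
      ultimately have "\<forall>(i, j)\<in>#layer ?M (w p). ?p (w p) \<le> i"
        unfolding painting_rule_def by blast
      then have "?p (w p) \<le> fst (arc_of x)" using a by (auto simp: arc_of_def)
      then have "p \<le> x" using wS(2)[OF that(2)] by (simp add: arc_of_def)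
      moreover have "p \<noteq> x" using that U by blast
      ultimately show ?thesis by simp
    qed
  qed
qed

section \<open>Diagrams whose arcs are all nested\<close>

text \<open>Reflecting the vertices after the first \<open>m\<close> gives arcs which are all nested, hence a single layer.\<close>

lemma rainbow_basis_diagram:
  assumes "S = {1..m}" "m \<le> n" "even (n - m)" "S = {} \<or> m = k" "0 < k"
  shows "\<exists>D\<in>basis_diagrams n k. painted D = S"
proof -
  let ?U = "{1..n} - S"
  have U: "?U = {Suc m..n}" using assms(1) by auto
  define \<pi> where "\<pi> v = (if v \<in> {Suc m..n} then Suc (m + n) - v else v)" for v
  have range: "\<pi> x \<in> {Suc m..n}" "\<pi> (\<pi> x) = x" "x + \<pi> x = Suc (m + n)" if "x \<in> {Suc m..n}" for x
    using that by (auto simp: \<pi>_def)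
  have odd: "odd (Suc (m + n))" using assms(2,3) by simp
  have "\<pi> permutes {Suc m..n}"
    by (rule involution_permutes) (use range in \<open>auto simp: \<pi>_def\<close>)
  moreover have "\<pi> x \<noteq> x" if "x \<in> {Suc m..n}" for x
  proof
    assume "\<pi> x = x"
    then have "Suc (m + n) = 2 * x" using range(3)[OF that] by simp
    then show False using odd by (metis dvd_triv_left)
  qed
  ultimately have \<pi>: "pairing ?U \<pi>" unfolding U pairing_def using range by blast
  let ?D = "diagram_of ?U S \<pi>"
  let ?M = "arcs ?D"
  have S: "S \<subseteq> {1..n}" "S = {} \<or> card S = k" using assms by auto
  have nb: "\<not> below a b" if a: "a \<in># ?M" and b: "b \<in># ?M" for a b
  proof -
    obtain v u where vu: "v \<in> {Suc m..n}" "a = (v, \<pi> v)" "u \<in> {Suc m..n}" "b = (u, \<pi> u)"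
      using a b unfolding U mem_arcs_diagram_of[OF finite_atLeastAtMost] by blast
    then show ?thesis using range(3)[OF vu(1)] range(3)[OF vu(3)] by (auto simp: below_def)
  qed
  have "remaining_arcs ?M 1 = {#}"
  proof -
    have "a \<notin># remaining_arcs ?M (Suc 0)" for a
      unfolding mem_remaining_Suc using nb by (simp only: remaining_arcs.simps) blast
    then show ?thesis by (metis One_nat_def multiset_nonemptyE)
  qed
  then have "layer ?M 1 = {#}" unfolding layer_def by (simp add: first_layer_def)
  then have empty: "layer ?M l = {#}" if "0 < l" for l using layer_empty_mono that by (metis One_nat_def Suc_leI)
  have "painting_rule ?D" if "S \<noteq> {}"
    unfolding painting_rule_def
  proof (intro allI impI conjI)
    fix l assume "layer ?M l \<noteq> {#}"
    then have l: "l = 0" using empty by blast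
    show "l < card (painted ?D)" using that assms(1) l by simp
    have "sorted_list_of_set S = [1..<Suc m]" unfolding assms(1) by (metis atLeastLessThanSuc_atLeastAtMost sorted_list_of_set_range)
    then have "painted_vertex ?D 0 = 1" using that assms(1) by (simp add: painted_vertex_def nth_append)
    moreover have "1 \<le> fst a" if "a \<in># layer ?M 0" for a
    proof -
      have "a \<in># ?M" by (rule layer_subset[OF that])
      then show ?thesis
        unfolding mem_arcs_diagram_of[OF finite_Diff[OF finite_atLeastAtMost]] by auto
    qed
    ultimately show "\<forall>(i, j)\<in>#layer ?M l. painted_vertex ?D l \<le> i"
      unfolding l by (intro ballI) (metis (no_types, lifting) case_prod_conv fst_conv surj_pair)
  qed
  then have "?D \<in> basis_diagrams n k"
    unfolding basis_diagrams_iff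
    using diagram_of_in_one_regular[OF \<pi> S] empty[OF assms(5)] by (auto simp: has_hyperedge_def)
  then show ?thesis by (intro bexI[of _ ?D]) simp_all
qed

section \<open>Determinants and orthonormal frames\<close>

lemma vector_space_mult: "vector_space ((*) :: complex \<Rightarrow> complex \<Rightarrow> complex)"
  by unfold_locales (simp_all add: algebra_simps)

locale quadratic_space = vector_space scale
  for scale :: "complex \<Rightarrow> 'v::ab_group_add \<Rightarrow> 'v" +
  fixes b :: "'v \<Rightarrow> 'v \<Rightarrow> complex" and e :: "nat \<Rightarrow> 'v" and k :: nat
  assumes basis: "family_basis scale {..<k} e UNIV"
    and form: "symmetric_bilinear_form scale b"
    and nondegenerate: "nondegenerate_form b"
begin

lemma linear_functional_iff:
  "Vector_Spaces.linear scale (*) f \<longleftrightarrow> (\<forall>x y. f (x + y) = f x + f y) \<and> (\<forall>c x. f (scale c x) = c * f x)"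
  using vector_space_axioms vector_space_mult by (simp add: Vector_Spaces.linear_iff)

lemma linear_map_iff:
  "Vector_Spaces.linear scale scale f \<longleftrightarrow> (\<forall>x y. f (x + y) = f x + f y) \<and> (\<forall>c x. f (scale c x) = scale c (f x))"
  using vector_space_axioms by (simp add: Vector_Spaces.linear_iff)

lemma b_add_left: "b (x + y) z = b x z + b y z"
  and b_add_right: "b z (x + y) = b z x + b z y"
  and b_scale_left: "b (scale c x) z = c * b x z"
  and b_scale_right: "b z (scale c x) = c * b z x"
  and b_sym: "b x y = b y x"
  using form unfolding symmetric_bilinear_form_def linear_functional_iff by blast+

lemma b_zero_left: "b 0 z = 0" using b_scale_left[of 0 0 z] by simp

lemma b_sum_left: "b (\<Sum>i\<in>I. f i) z = (\<Sum>i\<in>I. b (f i) z)"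
  by (induction I rule: infinite_finite_induct) (simp_all add: b_zero_left b_add_left)

lemma b_diff_left: "b (x - y) z = b x z - b y z"
  by (metis add_diff_cancel_right' b_add_left diff_add_cancel)

lemma b_diff_right: "b z (x - y) = b z x - b z y"
  using b_diff_left b_sym by metis

lemma e_inj: "inj_on e {..<k}" and e_independent: "independent (e ` {..<k})" and e_span: "span (e ` {..<k}) = UNIV"
  using basis unfolding family_basis_def by blast+

definition coord :: "nat \<Rightarrow> 'v \<Rightarrow> complex" where
  "coord r x = representation (e ` {..<k}) x (e r)"

lemma coord_add: "coord r (x + y) = coord r x + coord r y"
  unfolding coord_def by (subst representation_add[OF e_independent]) (simp_all add: e_span)

lemma coord_scale: "coord r (scale c x) = c * coord r x"
  unfolding coord_def by (subst representation_scale[OF e_independent]) (simp_all add: e_span)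

lemma coord_zero: "coord r 0 = 0"
  unfolding coord_def by (simp add: representation_zero)

lemma coord_sum: "coord r (\<Sum>i\<in>I. f i) = (\<Sum>i\<in>I. coord r (f i))"
  by (induction I rule: infinite_finite_induct) (simp_all add: coord_zero coord_add)

lemma coord_basis: "r < k \<Longrightarrow> s < k \<Longrightarrow> coord r (e s) = (if r = s then 1 else 0)"
  unfolding coord_def using e_inj by (subst representation_basis[OF e_independent]) (auto dest: inj_onD)

lemma expand: "x = (\<Sum>r<k. scale (coord r x) (e r))"
proof -
  have "(\<Sum>y\<in>e ` {..<k}. scale (representation (e ` {..<k}) x y) y) = x"
    by (rule sum_representation_eq[OF e_independent]) (simp_all add: e_span)
  then show ?thesis by (simp add: sum.reindex[OF e_inj] coord_def)
qed

definition vdet :: "(nat \<Rightarrow> 'v) \<Rightarrow> complex" where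
  "vdet u = det_vectors scale k e u"

lemma vdet_det: "vdet u = Determinant.det (mat k k (\<lambda>(r, c). coord r (u c)))"
  by (simp add: vdet_def det_vectors_def coord_def)

lemma vdet_leibniz:
  "vdet u = (\<Sum>p | p permutes {..<k}. of_int (sign p) * (\<Prod>c<k. coord (p c) (u c)))"
proof -
  have "vdet u = (\<Sum>p | p permutes {0..<k}. of_int (sign p) *
      (\<Prod>c<k. mat k k (\<lambda>(r, c). coord r (u c)) $$ (p c, c)))"
    unfolding vdet_det by (rule det_col) simp
  also have "\<dots> = (\<Sum>p | p permutes {..<k}. of_int (sign p) * (\<Prod>c<k. coord (p c) (u c)))"
    unfolding atLeast0LessThan
  proof (rule sum.cong[OF refl])
    fix p assume "p \<in> {p. p permutes {..<k}}"
    then have "p c < k" if "c < k" for c using that permutes_in_image[of p "{..<k}" c] by simp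
    then show "of_int (sign p) * (\<Prod>c<k. mat k k (\<lambda>(r, c). coord r (u c)) $$ (p c, c))
        = of_int (sign p) * (\<Prod>c<k. coord (p c) (u c))" by simp
  qed
  finally show ?thesis .
qed

lemma vdet_cong: "(\<And>c. c < k \<Longrightarrow> u c = u' c) \<Longrightarrow> vdet u = vdet u'"
  unfolding vdet_leibniz by simp

lemma vdet_upd:
  assumes "c < k"
  shows "vdet (u(c := x)) = (\<Sum>p | p permutes {..<k}. coord (p c) x *
      (of_int (sign p) * (\<Prod>d\<in>{..<k} - {c}. coord (p d) (u d))))"
  unfolding vdet_leibniz
proof (rule sum.cong[OF refl])
  fix p
  have "(\<Prod>d<k. coord (p d) ((u(c := x)) d)) = coord (p c) x * (\<Prod>d\<in>{..<k} - {c}. coord (p d) ((u(c := x)) d))"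
    using assms by (subst prod.remove[of _ c]) simp_all
  also have "(\<Prod>d\<in>{..<k} - {c}. coord (p d) ((u(c := x)) d)) = (\<Prod>d\<in>{..<k} - {c}. coord (p d) (u d))"
    by (rule prod.cong) simp_all
  finally show "of_int (sign p) * (\<Prod>d<k. coord (p d) ((u(c := x)) d))
      = coord (p c) x * (of_int (sign p) * (\<Prod>d\<in>{..<k} - {c}. coord (p d) (u d)))" by simp
qed

lemma vdet_add: "c < k \<Longrightarrow> vdet (u(c := x + y)) = vdet (u(c := x)) + vdet (u(c := y))"
  by (simp only: vdet_upd coord_add distrib_right sum.distrib)

lemma vdet_scale: "c < k \<Longrightarrow> vdet (u(c := scale a x)) = a * vdet (u(c := x))"
  by (simp only: vdet_upd coord_scale sum_distrib_left mult.assoc)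

lemma vdet_transpose:
  assumes "x < k" "y < k" "x \<noteq> y"
  shows "vdet (u \<circ> Transposition.transpose x y) = - vdet u"
proof -
  let ?t = "Transposition.transpose x y"
  have t: "?t permutes {..<k}" using assms by (intro permutes_swap_id) simp_all
  have "vdet u = (\<Sum>p | p permutes {..<k}. of_int (sign (p \<circ> ?t)) * (\<Prod>c<k. coord ((p \<circ> ?t) c) (u c)))"
    unfolding vdet_leibniz by (rule sum_permutations_compose_right[OF t])
  also have "\<dots> = (\<Sum>p | p permutes {..<k}. - (of_int (sign p) * (\<Prod>c<k. coord (p c) ((u \<circ> ?t) c))))"
  proof (rule sum.cong[OF refl])
    fix p assume "p \<in> {p. p permutes {..<k}}"
    then have "permutation p" by (auto simp: permutation_permutes)
    then have "sign (p \<circ> ?t) = - sign p"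
      using sign_compose[OF _ permutation_swap_id, of p x y] assms(3) by (simp add: sign_swap_id)
    moreover have "(\<Prod>c<k. coord (p (?t c)) (u (?t (?t c)))) = (\<Prod>c<k. coord (p c) (u (?t c)))"
      using prod.reindex_bij_betw[OF permutes_imp_bij[OF t], of "\<lambda>c. coord (p c) (u (?t c))"] .
    ultimately show "of_int (sign (p \<circ> ?t)) * (\<Prod>c<k. coord ((p \<circ> ?t) c) (u c))
      = - (of_int (sign p) * (\<Prod>c<k. coord (p c) ((u \<circ> ?t) c)))" by simp
  qed
  also have "\<dots> = - vdet (u \<circ> ?t)" unfolding vdet_leibniz by (rule sum_negf)
  finally show ?thesis by simp
qed

lemma vdet_eq_columns:
  assumes "x < k" "y < k" "x \<noteq> y" "u x = u y"
  shows "vdet u = 0"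
proof -
  have "u \<circ> Transposition.transpose x y = u"
    using assms(4) by (auto simp: fun_eq_iff Transposition.transpose_def)
  then show ?thesis using vdet_transpose[OF assms(1-3), of u] by simp
qed

lemma vdet_linear_map:
  assumes g: "Vector_Spaces.linear scale scale g"
  shows "vdet (\<lambda>c. g (u c)) = vdet (\<lambda>c. g (e c)) * vdet u"
proof -
  have g_add: "g (x + y) = g x + g y" and g_scale: "g (scale c x) = scale c (g x)" for x y c
    using g unfolding linear_map_iff by blast+
  have g_sum: "g (\<Sum>i\<in>I. f i) = (\<Sum>i\<in>I. g (f i))" for f :: "nat \<Rightarrow> 'v" and I
    using g_scale[of 0 0] by (induction I rule: infinite_finite_induct) (simp_all add: g_add)
  have c: "coord r (g x) = (\<Sum>s<k. coord r (g (e s)) * coord s x)" for r x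
    by (subst expand[of x]) (simp add: g_sum g_scale coord_sum coord_scale mult.commute)
  let ?G = "mat k k (\<lambda>(r, c). coord r (g (e c)))" and ?U = "mat k k (\<lambda>(r, c). coord r (u c))"
  have "mat k k (\<lambda>(r, c). coord r (g (u c))) = ?G * ?U"
  proof (rule eq_matI)
    fix i j assume "i < dim_row (?G * ?U)" "j < dim_col (?G * ?U)"
    then have ij: "i < k" "j < k" by simp_all
    have "(?G * ?U) $$ (i, j) = (\<Sum>s<k. coord i (g (e s)) * coord s (u j))"
      using ij by (simp add: scalar_prod_def atLeast0LessThan)
    then show "mat k k (\<lambda>(r, c). coord r (g (u c))) $$ (i, j) = (?G * ?U) $$ (i, j)"
      using ij c[of i "u j"] by simp
  qed simp_all
  then show ?thesis unfolding vdet_det by (simp add: det_mult[of ?G k ?U])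
qed

definition orthonormal :: "(nat \<Rightarrow> 'v) \<Rightarrow> nat \<Rightarrow> bool" where
  "orthonormal f m \<longleftrightarrow> (\<forall>i<m. \<forall>j<m. b (f i) (f j) = (if i = j then 1 else 0))"

lemma orthonormal_independent:
  assumes "orthonormal f m"
  shows "inj_on f {..<m}" "independent (f ` {..<m})"
proof -
  have on: "b (f i) (f j) = (if i = j then 1 else 0)" if "i < m" "j < m" for i j
    using assms that by (simp add: orthonormal_def)
  show inj: "inj_on f {..<m}"
  proof (rule inj_onI)
    fix x y assume "x \<in> {..<m}" "y \<in> {..<m}" "f x = f y"
    then show "x = y" using on[of x x] on[of x y] by (auto split: if_splits)
  qed
  show "independent (f ` {..<m})"
  proof
    assume "dependent (f ` {..<m})"
    then obtain u where u: "\<exists>v\<in>f ` {..<m}. u v \<noteq> 0" "(\<Sum>v\<in>f ` {..<m}. scale (u v) v) = 0"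
      using dependent_finite[of "f ` {..<m}"] by auto
    then obtain j where j: "j < m" "u (f j) \<noteq> 0" by auto
    have "0 = b (\<Sum>v\<in>f ` {..<m}. scale (u v) v) (f j)" unfolding u(2) by (simp add: b_zero_left)
    also have "\<dots> = (\<Sum>i<m. u (f i) * b (f i) (f j))"
      by (simp add: sum.reindex[OF inj] b_sum_left b_scale_left)
    also have "\<dots> = (\<Sum>i<m. if i = j then u (f i) else 0)"
      by (rule sum.cong[OF refl]) (simp add: on j(1))
    also have "\<dots> = u (f j)" using j(1) by simp
    finally show False using j(2) by simp
  qed
qed

text \<open>Take an orthonormal family of maximal size. On its orthogonal complement every vector is isotropic, since otherwise it could be rescaled (complex numbers have square roots) and added to the family. By polarisation the form vanishes on the complement, which is therefore zero by nondegeneracy.\<close>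

lemma orthonormal_frame_exists:
  obtains f where "orthonormal f k" "\<And>x. x = (\<Sum>i<k. scale (b x (f i)) (f i))"
proof -
  have card_e: "card (e ` {..<k}) = k" using card_image[OF e_inj] by simp
  have bound: "m \<le> k" if "orthonormal f m" for f m
    using independent_span_bound[of "e ` {..<k}" "f ` {..<m}"] orthonormal_independent[OF that]
      card_image[of f "{..<m}"] card_e e_span by simp
  define N where "N = Max {m. \<exists>f. orthonormal f m}"
  have fin: "finite {m. \<exists>f. orthonormal f m}"
    by (rule finite_subset[of _ "{..k}"]) (use bound in auto)
  have "0 \<in> {m. \<exists>f. orthonormal f m}" by (simp add: orthonormal_def)
  then have "N \<in> {m. \<exists>f. orthonormal f m}" unfolding N_def using Max_in[OF fin] by blast
  then obtain f where f: "orthonormal f N" by blast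
  have on: "b (f i) (f j) = (if i = j then 1 else 0)" if "i < N" "j < N" for i j
    using f that by (simp add: orthonormal_def)
  have no_ext: "b v v = 0" if v: "\<And>j. j < N \<Longrightarrow> b v (f j) = 0" for v
  proof (rule ccontr)
    assume q: "b v v \<noteq> 0"
    let ?v = "scale (1 / csqrt (b v v)) v"
    have "csqrt (b v v) * csqrt (b v v) = b v v" by (metis power2_csqrt power2_eq_square)
    then have "b ?v ?v = 1" using q by (simp add: b_scale_left b_scale_right field_simps)
    moreover have "b ?v (f j) = 0" "b (f j) ?v = 0" if "j < N" for j
      using v[OF that] b_sym[of "f j" v] by (simp_all add: b_scale_left b_scale_right)
    ultimately have "orthonormal (f(N := ?v)) (Suc N)"
      unfolding orthonormal_def by (auto simp: less_Suc_eq on)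
    then have "Suc N \<le> N" unfolding N_def using Max_ge[OF fin] by blast
    then show False by simp
  qed
  define res where "res x = x - (\<Sum>i<N. scale (b x (f i)) (f i))" for x
  have res_orth: "b (res x) (f j) = 0" if "j < N" for x j
  proof -
    have "b (\<Sum>i<N. scale (b x (f i)) (f i)) (f j) = (\<Sum>i<N. if i = j then b x (f i) else 0)"
      unfolding b_sum_left by (rule sum.cong[OF refl]) (simp add: b_scale_left on that)
    then show ?thesis using that by (simp add: res_def b_diff_left)
  qed
  have res0: "res x = 0" for x
  proof (rule ccontr)
    assume "res x \<noteq> 0"
    then obtain z where z: "b (res x) z \<noteq> 0" using nondegenerate unfolding nondegenerate_form_def by blast
    have "b (res x) (\<Sum>i<N. scale (b z (f i)) (f i)) = 0"
      by (subst b_sym) (simp add: b_sum_left b_scale_left b_sym[of "f _" "res x"] res_orth)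
    then have "b (res x) (res z) = b (res x) z" by (simp add: res_def[of z] b_diff_right)
    moreover have "b (res x + res z) (res x + res z) = 0"
      by (rule no_ext) (simp add: b_add_left res_orth)
    moreover have "b (res x) (res x) = 0" "b (res z) (res z) = 0" using no_ext res_orth by blast+
    ultimately show False using z b_sym[of "res z" "res x"] by (simp add: b_add_left b_add_right)
  qed
  have exp: "x = (\<Sum>i<N. scale (b x (f i)) (f i))" for x using res0[of x] by (simp add: res_def)
  have "x \<in> span (f ` {..<N})" for x
    by (subst exp[of x]) (intro span_sum span_scale span_base, simp)
  then have "e ` {..<k} \<subseteq> span (f ` {..<N})" by blast
  then have "card (e ` {..<k}) \<le> card (f ` {..<N})"
    using independent_span_bound[of "f ` {..<N}" "e ` {..<k}"] e_independent by simp
  also have "\<dots> \<le> N" using card_image_le[of "{..<N}" f] by simp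
  finally have "N = k" using bound[OF f] card_e by simp
  then show ?thesis using that f exp by blast
qed

end

locale orthonormal_frame = quadratic_space scale b e k
  for scale :: "complex \<Rightarrow> 'v::ab_group_add \<Rightarrow> 'v" and b e k +
  fixes f :: "nat \<Rightarrow> 'v"
  assumes orthonormal_f: "orthonormal f k"
    and expand_f: "\<And>x. x = (\<Sum>i<k. scale (b x (f i)) (f i))"
begin

lemma b_f: "i < k \<Longrightarrow> j < k \<Longrightarrow> b (f i) (f j) = (if i = j then 1 else 0)"
  using orthonormal_f by (simp add: orthonormal_def)

text \<open>The coordinates of the frame in the basis \<open>e\<close> and those of \<open>e\<close> in the frame form inverse matrices.\<close>

lemma vdet_f_nonzero: "vdet f \<noteq> 0"
proof -
  let ?F = "mat k k (\<lambda>(r, c). coord r (f c))" and ?B = "mat k k (\<lambda>(c, s). b (e s) (f c))"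
  have "?F * ?B = 1\<^sub>m k"
  proof (rule eq_matI)
    fix i j assume "i < dim_row (1\<^sub>m k :: complex mat)" "j < dim_col (1\<^sub>m k :: complex mat)"
    then have ij: "i < k" "j < k" by simp_all
    have "(?F * ?B) $$ (i, j) = (\<Sum>c<k. coord i (f c) * b (e j) (f c))"
      using ij by (simp add: scalar_prod_def atLeast0LessThan)
    also have "\<dots> = coord i (e j)"
      by (subst (2) expand_f[of "e j"]) (simp add: coord_sum coord_scale mult.commute)
    finally show "(?F * ?B) $$ (i, j) = (1\<^sub>m k) $$ (i, j)" using ij by (simp add: coord_basis)
  qed simp_all
  then have "Determinant.det ?F * Determinant.det ?B = 1"
    using det_mult[of ?F k ?B] by simp
  then show ?thesis unfolding vdet_det by auto
qed

definition frame_det :: "(nat \<Rightarrow> nat) \<Rightarrow> complex" where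
  "frame_det u = vdet (\<lambda>l. f (u l))"

sublocale volume_form k frame_det
proof
  show "frame_det u = frame_det u'" if "\<And>l. l < k \<Longrightarrow> u l = u' l" for u u'
    unfolding frame_det_def by (rule vdet_cong) (simp add: that)
  show tr: "frame_det (u \<circ> Transposition.transpose x y) = - frame_det u" if "x < k" "y < k" "x \<noteq> y" for u x y
    using vdet_transpose[OF that, of "\<lambda>l. f (u l)"] by (simp add: frame_det_def o_def)
  show "frame_det u \<noteq> 0" if u: "inj_on u {..<k}" "u ` {..<k} \<subseteq> {..<k}" for u
  proof -
    define p where "p l = (if l < k then u l else l)" for l
    have "u ` {..<k} = {..<k}" using endo_inj_surj[OF _ u(2,1)] by simp
    then have "bij_betw u {..<k} {..<k}" using u(1) by (simp add: bij_betw_def)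
    then have "bij_betw p {..<k} {..<k}" by (subst bij_betw_cong[where g = u]) (simp_all add: p_def)
    then have p: "p permutes {..<k}" by (rule bij_imp_permutes) (simp add: p_def)
    have "frame_det (id \<circ> p) = of_int (sign p) * frame_det id"
      by (rule transposition_antisymmetric_imp_sign[where X = UNIV and S = "{..<k}", OF _ _ _ p])
         (simp_all only: finite_lessThan UNIV_I lessThan_iff tr not_False_eq_True)
    moreover have "frame_det (id \<circ> p) = frame_det u"
      unfolding frame_det_def by (rule vdet_cong) (simp add: p_def)
    moreover have "frame_det id = vdet f" by (simp add: frame_det_def)
    ultimately have "frame_det u = of_int (sign p) * vdet f" by simp
    then show ?thesis using vdet_f_nonzero by simp
  qed
qed

end

section \<open>Multilinear forms and invariants\<close>

context quadratic_space
begin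

lemma multilinear_forms_iff:
  "T \<in> multilinear_forms scale n \<longleftrightarrow>
     (\<forall>v w. (\<forall>i\<in>{1..n}. v i = w i) \<longrightarrow> T v = T w) \<and>
     (\<forall>v. \<forall>i\<in>{1..n}. \<forall>x y. T (v(i := x + y)) = T (v(i := x)) + T (v(i := y))) \<and>
     (\<forall>v. \<forall>i\<in>{1..n}. \<forall>c x. T (v(i := scale c x)) = c * T (v(i := x)))"
  unfolding multilinear_forms_def linear_functional_iff by blast

lemma multilinear_cong:
  "T \<in> multilinear_forms scale n \<Longrightarrow> (\<And>i. i \<in> {1..n} \<Longrightarrow> v i = w i) \<Longrightarrow> T v = T w"
  unfolding multilinear_forms_def by blast

lemma multilinear_add:
  "T \<in> multilinear_forms scale n \<Longrightarrow> i \<in> {1..n} \<Longrightarrow> T (v(i := x + y)) = T (v(i := x)) + T (v(i := y))"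
  unfolding multilinear_forms_iff by blast

lemma multilinear_scale:
  "T \<in> multilinear_forms scale n \<Longrightarrow> i \<in> {1..n} \<Longrightarrow> T (v(i := scale c x)) = c * T (v(i := x))"
  unfolding multilinear_forms_iff by blast

lemma multilinear_sum:
  assumes "T \<in> multilinear_forms scale n" "i \<in> {1..n}"
  shows "T (v(i := \<Sum>j\<in>J. g j)) = (\<Sum>j\<in>J. T (v(i := g j)))"
  using multilinear_scale[OF assms, of v 0 0]
  by (induction J rule: infinite_finite_induct) (simp_all add: multilinear_add[OF assms])

lemma multilinear_zero: "0 \<in> multilinear_forms scale n"
  unfolding multilinear_forms_iff by simp

lemma multilinear_lincomb:
  assumes "finite J" "\<And>j. j \<in> J \<Longrightarrow> F j \<in> multilinear_forms scale n"
  shows "(\<lambda>v. \<Sum>j\<in>J. c j * F j v) \<in> multilinear_forms scale n"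
  unfolding multilinear_forms_iff
proof (intro conjI allI impI ballI)
  fix v w :: "nat \<Rightarrow> 'v" assume "\<forall>i\<in>{1..n}. v i = w i"
  then have "F j v = F j w" if "j \<in> J" for j using multilinear_cong[OF assms(2)[OF that]] by blast
  then show "(\<Sum>j\<in>J. c j * F j v) = (\<Sum>j\<in>J. c j * F j w)" by simp
next
  fix v :: "nat \<Rightarrow> 'v" and i x y assume i: "i \<in> {1..n}"
  have "(\<Sum>j\<in>J. c j * F j (v(i := x + y))) = (\<Sum>j\<in>J. c j * F j (v(i := x)) + c j * F j (v(i := y)))"
    by (rule sum.cong[OF refl]) (simp only: multilinear_add[OF assms(2) i] distrib_left)
  then show "(\<Sum>j\<in>J. c j * F j (v(i := x + y))) = (\<Sum>j\<in>J. c j * F j (v(i := x))) + (\<Sum>j\<in>J. c j * F j (v(i := y)))"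
    by (simp only: sum.distrib)
next
  fix v :: "nat \<Rightarrow> 'v" and i a x assume i: "i \<in> {1..n}"
  have "(\<Sum>j\<in>J. c j * F j (v(i := scale a x))) = (\<Sum>j\<in>J. a * (c j * F j (v(i := x))))"
    by (rule sum.cong[OF refl]) (simp only: multilinear_scale[OF assms(2) i] mult.left_commute)
  then show "(\<Sum>j\<in>J. c j * F j (v(i := scale a x))) = a * (\<Sum>j\<in>J. c j * F j (v(i := x)))"
    by (simp only: sum_distrib_left)
qed

lemma multilinear_diff:
  assumes "S \<in> multilinear_forms scale n" "T \<in> multilinear_forms scale n"
  shows "(\<lambda>v. S v - T v) \<in> multilinear_forms scale n"
  unfolding multilinear_forms_iff
proof (intro conjI allI impI ballI)
  fix v w :: "nat \<Rightarrow> 'v" assume "\<forall>i\<in>{1..n}. v i = w i"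
  then show "S v - T v = S w - T w"
    using multilinear_cong[OF assms(1)] multilinear_cong[OF assms(2)] by metis
qed (simp_all add: multilinear_add[OF assms(1)] multilinear_add[OF assms(2)]
       multilinear_scale[OF assms(1)] multilinear_scale[OF assms(2)] right_diff_distrib)

lemma diagram_form_diagram_of:
  assumes "finite U"
  shows "diagram_form scale b k e (diagram_of U S \<pi>) v =
    (\<Prod>x\<in>{x \<in> U. x < \<pi> x}. b (v x) (v (\<pi> x))) *
    (if S = {} then 1 else vdet (\<lambda>l. v (sorted_list_of_set S ! l)))"
proof -
  have "(\<Prod>(i, j)\<in>#arcs (diagram_of U S \<pi>). b (v i) (v j)) = (\<Prod>x\<in>{x \<in> U. x < \<pi> x}. b (v x) (v (\<pi> x)))"
    by (simp add: image_mset.compositionality o_def prod_unfold_prod_mset)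
  then show ?thesis
    by (simp add: diagram_form_def has_hyperedge_def vdet_def painted_vertex_def del: arcs_diagram_of)
qed

end

context orthonormal_frame
begin

definition letters :: "(nat \<Rightarrow> nat) \<Rightarrow> nat \<Rightarrow> 'v" where
  "letters w i = f (w i)"

text \<open>Expand the slots one after the other: \<open>m\<close> is the number of slots that may still hold arbitrary vectors.\<close>

lemma multilinear_eq_0_if_words:
  assumes T: "T \<in> multilinear_forms scale n"
    and z: "\<And>w. w \<in> words {1..n} k \<Longrightarrow> T (letters w) = 0"
  shows "T v = 0"
proof -
  have "T v = 0" if "\<And>i. m < i \<Longrightarrow> i \<le> n \<Longrightarrow> v i \<in> f ` {..<k}" for m v
    using that
  proof (induction m arbitrary: v)
    case 0
    have "\<exists>j. j < k \<and> v i = f j" if "i \<in> {1..n}" for i using 0[of i] that by auto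
    then obtain j where j: "\<And>i. i \<in> {1..n} \<Longrightarrow> j i < k \<and> v i = f (j i)" by metis
    let ?w = "restrict j {1..n}"
    have "?w \<in> words {1..n} k" using j by (simp add: words_def)
    moreover have "T v = T (letters ?w)"
      by (rule multilinear_cong[OF T]) (use j in \<open>simp add: letters_def\<close>)
    ultimately show ?case using z by simp
  next
    case (Suc m)
    show ?case
    proof (cases "Suc m \<le> n")
      case True
      then have i: "Suc m \<in> {1..n}" by simp
      have "T (v(Suc m := f j)) = 0" if "j < k" for j
        by (rule Suc.IH) (use Suc.prems that in \<open>auto simp: Suc_lessI\<close>)
      then have "T (v(Suc m := (\<Sum>j<k. scale (b (v (Suc m)) (f j)) (f j)))) = 0"
        by (simp only: multilinear_sum[OF T i] multilinear_scale[OF T i]) simp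
      then show ?thesis by (simp only: expand_f[symmetric] fun_upd_triv)
    next
      case False
      show ?thesis by (rule Suc.IH) (use False Suc.prems in auto)
    qed
  qed
  from this[of n v] show ?thesis by simp
qed

lemma multilinear_ext:
  assumes "S \<in> multilinear_forms scale n" "T \<in> multilinear_forms scale n"
    and "\<And>w. w \<in> words {1..n} k \<Longrightarrow> S (letters w) = T (letters w)"
  shows "S = T"
proof
  fix v show "S v = T v"
    using multilinear_eq_0_if_words[OF multilinear_diff[OF assms(1,2)], of v] assms(3) by simp
qed

lemma monomial_multilinear:
  "(\<lambda>v. \<Prod>i\<in>{1..n}. b (v i) (f (w i))) \<in> multilinear_forms scale n"
  unfolding multilinear_forms_iff
proof (intro conjI allI impI ballI)
  fix v w' :: "nat \<Rightarrow> 'v" assume "\<forall>i\<in>{1..n}. v i = w' i"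
  then show "(\<Prod>i\<in>{1..n}. b (v i) (f (w i))) = (\<Prod>i\<in>{1..n}. b (w' i) (f (w i)))" by simp
next
  fix v :: "nat \<Rightarrow> 'v" and i assume i: "i \<in> {1..n}"
  have upd: "(\<Prod>j\<in>{1..n}. b ((v(i := x)) j) (f (w j))) = b x (f (w i)) * (\<Prod>j\<in>{1..n} - {i}. b (v j) (f (w j)))" for x
    using i by (subst prod.remove[of _ i]) simp_all
  show "(\<Prod>j\<in>{1..n}. b ((v(i := x + y)) j) (f (w j)))
      = (\<Prod>j\<in>{1..n}. b ((v(i := x)) j) (f (w j))) + (\<Prod>j\<in>{1..n}. b ((v(i := y)) j) (f (w j)))" for x y
    unfolding upd by (simp only: b_add_left distrib_right)
  show "(\<Prod>j\<in>{1..n}. b ((v(i := scale c x)) j) (f (w j))) = c * (\<Prod>j\<in>{1..n}. b ((v(i := x)) j) (f (w j)))" for c x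
    unfolding upd by (simp only: b_scale_left mult.assoc)
qed

lemma multilinear_expand:
  assumes T: "T \<in> multilinear_forms scale n"
  shows "T v = (\<Sum>w\<in>words {1..n} k. T (letters w) * (\<Prod>i\<in>{1..n}. b (v i) (f (w i))))"
proof -
  let ?E = "\<lambda>v. \<Sum>w\<in>words {1..n} k. T (letters w) * (\<Prod>i\<in>{1..n}. b (v i) (f (w i)))"
  have "T = ?E"
  proof (rule multilinear_ext[OF T])
    show "?E \<in> multilinear_forms scale n"
      by (rule multilinear_lincomb[OF finite_words[OF finite_atLeastAtMost] monomial_multilinear])
    fix u assume u: "u \<in> words {1..n} k"
    have "(\<Prod>i\<in>{1..n}. b (letters u i) (f (w i))) = (if w = u then 1 else 0)" if w: "w \<in> words {1..n} k" for w
    proof (cases "w = u")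
      case True
      have "b (letters u i) (f (u i)) = 1" if "i \<in> {1..n}" for i
        using words_less[OF u that] by (simp add: letters_def b_f)
      then show ?thesis using True by simp
    next
      case False
      then obtain i where i: "i \<in> {1..n}" "w i \<noteq> u i" using words_eqI[OF w u] by blast
      then have "b (letters u i) (f (w i)) = 0"
        using words_less[OF u i(1)] words_less[OF w i(1)] by (simp add: letters_def b_f)
      then have "(\<Prod>i\<in>{1..n}. b (letters u i) (f (w i))) = 0"
        by (intro prod_zero[OF finite_atLeastAtMost] bexI[OF _ i(1)])
      then show ?thesis by (simp only: False if_False)
    qed
    then have "?E (letters u) = (\<Sum>w\<in>words {1..n} k. if w = u then T (letters w) else 0)"
      by (intro sum.cong[OF refl]) simp
    also have "\<dots> = T (letters u)" using u by simp
    finally show "T (letters u) = ?E (letters u)" by simp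
  qed
  then show ?thesis by (rule fun_cong)
qed

text \<open>For \<open>c\<^sup>2 + s\<^sup>2 = 1\<close>, the rotation in the plane of \<open>f p\<close> and \<open>f q\<close> with cosine \<open>c\<close> and sine \<open>s\<close>.\<close>

definition rotation :: "nat \<Rightarrow> nat \<Rightarrow> complex \<Rightarrow> complex \<Rightarrow> 'v \<Rightarrow> 'v" where
  "rotation p q c s x = x + scale ((c - 1) * b x (f p) - s * b x (f q)) (f p)
     + scale (s * b x (f p) + (c - 1) * b x (f q)) (f q)"

lemma rotation_linear: "Vector_Spaces.linear scale scale (rotation p q c s)"
  unfolding linear_map_iff rotation_def
  by (simp add: b_add_left b_scale_left algebra_simps scale_left_distrib scale_right_distrib scale_left_diff_distrib)

lemma rotation_isometry:
  assumes pq: "p < k" "q < k" "p \<noteq> q" and cs: "c * c + s * s = 1"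
  shows "b (rotation p q c s x) (rotation p q c s y) = b x y"
proof -
  have fp: "b (f p) (f p) = 1" "b (f q) (f q) = 1" "b (f p) (f q) = 0" "b (f q) (f p) = 0"
    using pq by (simp_all add: b_f)
  have id: "z + (A' * xp + B' * xq) + (A * yp + B * yq) + (A * A' + B * B') = z"
    if "A = (c - 1) * xp - s * xq" "B = s * xp + (c - 1) * xq"
       "A' = (c - 1) * yp - s * yq" "B' = s * yp + (c - 1) * yq" for z xp xq yp yq A B A' B' :: complex
  proof -
    have "z + (A' * xp + B' * xq) + (A * yp + B * yq) + (A * A' + B * B')
        = z + (c * c + s * s - 1) * (xp * yp + xq * yq)"
      unfolding that by (simp add: algebra_simps)
    then show ?thesis by (simp add: cs)
  qed
  have "b (rotation p q c s x) (rotation p q c s y) = b x y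
      + (((c - 1) * b y (f p) - s * b y (f q)) * b x (f p) + (s * b y (f p) + (c - 1) * b y (f q)) * b x (f q))
      + (((c - 1) * b x (f p) - s * b x (f q)) * b y (f p) + (s * b x (f p) + (c - 1) * b x (f q)) * b y (f q))
      + (((c - 1) * b x (f p) - s * b x (f q)) * ((c - 1) * b y (f p) - s * b y (f q))
         + (s * b x (f p) + (c - 1) * b x (f q)) * (s * b y (f p) + (c - 1) * b y (f q)))"
    unfolding rotation_def
    by (simp only: b_add_left b_add_right b_scale_left b_scale_right fp b_sym[of "f _" y]) (simp add: algebra_simps)
  also have "\<dots> = b x y" by (rule id) (rule refl)+
  finally show ?thesis .
qed

lemma rotation_frame:
  assumes "p < k" "q < k" "p \<noteq> q" "a < k"
  shows "rotation p q c s (f a) = (if a = p then scale c (f p) + scale s (f q)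
     else if a = q then scale (- s) (f p) + scale c (f q) else f a)"
  using assms by (auto simp: rotation_def b_f algebra_simps scale_left_diff_distrib)

text \<open>Only the columns \<open>p\<close> and \<open>q\<close> of the determinant change. Expanding them gives \<open>c\<^sup>2 + s\<^sup>2\<close> times the determinant of the frame, as the terms with two equal columns vanish.\<close>

lemma rotation_special_orthogonal:
  assumes pq: "p < k" "q < k" "p \<noteq> q" and cs: "c * c + s * s = 1"
  shows "rotation p q c s \<in> special_orthogonal scale b k e"
proof -
  let ?R = "rotation p q c s"
  have zero: "vdet (f(p := f q, q := f q)) = 0" "vdet (f(p := f p, q := f p)) = 0"
    using pq by (intro vdet_eq_columns[of p q]; simp)+
  have swap: "vdet (f(p := f q, q := f p)) = - vdet f"
  proof -
    have "f(p := f q, q := f p) = f \<circ> Transposition.transpose p q"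
      using pq(3) by (auto simp: fun_eq_iff Transposition.transpose_def)
    then show ?thesis using vdet_transpose[OF pq, of f] by simp
  qed
  have "vdet (\<lambda>a. ?R (f a)) = vdet (f(p := scale c (f p) + scale s (f q), q := scale (- s) (f p) + scale c (f q)))"
    by (rule vdet_cong) (use pq in \<open>simp add: rotation_frame\<close>)
  also have "\<dots> = - s * vdet (f(p := scale c (f p) + scale s (f q), q := f p)) + c * vdet (f(p := scale c (f p) + scale s (f q), q := f q))"
    by (simp only: vdet_add[OF pq(2)] vdet_scale[OF pq(2)])
  also have "\<dots> = - s * (s * - vdet f) + c * (c * vdet f)"
    using zero swap unfolding fun_upd_twist[OF pq(3)]
    by (simp only: vdet_add[OF pq(1)] vdet_scale[OF pq(1)])
       (simp add: fun_upd_twist[OF pq(3)[symmetric]])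
  also have "\<dots> = (c * c + s * s) * vdet f" by (simp add: algebra_simps)
  also have "\<dots> = vdet f" by (simp add: cs)
  finally have "vdet (\<lambda>c. ?R (e c)) * vdet f = vdet f"
    using vdet_linear_map[OF rotation_linear, of p q c s f] by simp
  then have "vdet (\<lambda>c. ?R (e c)) = 1" using vdet_f_nonzero by simp
  then show ?thesis
    unfolding special_orthogonal_def vdet_def
    using rotation_linear rotation_isometry[OF pq cs] by blast
qed

text \<open>Differentiate the invariance under rotations at the identity. The derivative of the rotation matrix sends \<open>f p\<close> to \<open>f q\<close> and \<open>f q\<close> to \<open>- f p\<close>, so the derivative of the form on a word is the difference of the two replacement sums.\<close>

lemma SO_invariant_replace_invariant:
  assumes "T \<in> SO_invariants scale b k e n"
  shows "replace_invariant {1..n} k (\<lambda>w. T (letters w))"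
  unfolding replace_invariant_def
proof (intro allI impI ballI)
  let ?I = "{1..n}"
  let ?A = "\<lambda>w. T (letters w)"
  have T: "T \<in> multilinear_forms scale n"
    and inv: "\<And>g v. g \<in> special_orthogonal scale b k e \<Longrightarrow> T (\<lambda>i. g (v i)) = T v"
    using assms unfolding SO_invariants_def by blast+
  fix p q w assume pq: "p < k" "q < k" and w: "w \<in> words ?I k"
  show "replace_sum ?I p q ?A w = replace_sum ?I q p ?A w"
  proof (cases "p = q")
    case False
    define r where "r t j a = (if a = p then (if j = p then cos t else if j = q then sin t else 0)
      else if a = q then (if j = p then - sin t else if j = q then cos t else 0)
      else if j = a then 1 else 0)" for t :: complex and j a :: nat
    define r' where "r' j a = (if a = p \<and> j = q then 1 else if a = q \<and> j = p then - 1 else (0::complex))" for j a :: nat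
    have r: "b (rotation p q (cos t) (sin t) (f a)) (f j) = r t j a" if "a < k" "j < k" for t a j
      using pq False that unfolding rotation_frame[OF pq False that(1)]
      by (auto simp: r_def b_add_left b_diff_left b_scale_left b_f)
    have const: "(\<Sum>u\<in>words ?I k. ?A u * (\<Prod>i\<in>?I. r t (u i) (w i))) = ?A w" for t
    proof -
      have "cos t * cos t + sin t * sin t = 1"
        using sin_cos_squared_add2[of t] by (simp add: power2_eq_square)
      then have "?A w = T (\<lambda>i. rotation p q (cos t) (sin t) (letters w i))"
        using inv[OF rotation_special_orthogonal[OF pq False]] by simp
      also have "\<dots> = (\<Sum>u\<in>words ?I k. ?A u * (\<Prod>i\<in>?I. r t (u i) (w i)))"
        unfolding multilinear_expand[OF T, of "\<lambda>i. rotation p q (cos t) (sin t) (letters w i)"]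
      proof (rule sum.cong[OF refl])
        fix u assume u: "u \<in> words ?I k"
        have "(\<Prod>i\<in>?I. b (rotation p q (cos t) (sin t) (letters w i)) (f (u i))) = (\<Prod>i\<in>?I. r t (u i) (w i))"
          by (rule prod.cong[OF refl]) (simp add: letters_def r words_less[OF u] words_less[OF w])
        then show "?A u * (\<Prod>i\<in>?I. b (rotation p q (cos t) (sin t) (letters w i)) (f (u i)))
          = ?A u * (\<Prod>i\<in>?I. r t (u i) (w i))" by simp
      qed
      finally show ?thesis by simp
    qed
    have r_deriv: "((\<lambda>t. r t j a) has_field_derivative r' j a) (at 0)" for j a
    proof -
      have trig: "((\<lambda>t. cos t) has_field_derivative 0) (at (0 :: complex))"
        "((\<lambda>t. sin t) has_field_derivative 1) (at (0 :: complex))"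
        "((\<lambda>t. - sin t) has_field_derivative - 1) (at (0 :: complex))"
        using DERIV_cos[of "0 :: complex"] DERIV_sin[of "0 :: complex"] DERIV_minus[OF DERIV_sin[of "0 :: complex"]]
        by simp_all
      consider "a = p" "j = p" | "a = p" "j = q" | "a = p" "j \<noteq> p" "j \<noteq> q"
        | "a = q" "j = p" | "a = q" "j = q" | "a = q" "j \<noteq> p" "j \<noteq> q" | "a \<noteq> p" "a \<noteq> q" by blast
      then show ?thesis
        by cases (use False in \<open>simp_all add: r_def r'_def trig del: minus_zero\<close>)
    qed
    have r0: "r 0 j a = (if j = a then 1 else 0)" for j a
      using False by (simp add: r_def)
    let ?D = "\<Sum>u\<in>words ?I k. ?A u * (\<Sum>i\<in>?I. r' (u i) (w i) * (\<Prod>j\<in>?I - {i}. r 0 (u j) (w j)))"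
    have "((\<lambda>t. \<Sum>u\<in>words ?I k. ?A u * (\<Prod>i\<in>?I. r t (u i) (w i))) has_field_derivative ?D) (at 0)"
      by (intro DERIV_sum DERIV_cmult has_field_derivative_prod r_deriv)
    moreover have "((\<lambda>t. \<Sum>u\<in>words ?I k. ?A u * (\<Prod>i\<in>?I. r t (u i) (w i))) has_field_derivative 0) (at 0)"
      unfolding const by (rule DERIV_const)
    ultimately have "?D = 0" by (rule DERIV_unique)
    moreover have "?D = (\<Sum>i\<in>?I. \<Sum>u\<in>words ?I k. ?A u * (r' (u i) (w i) * (\<Prod>j\<in>?I - {i}. r 0 (u j) (w j))))"
      unfolding sum_distrib_left by (rule sum.swap)
    moreover have "(\<Sum>u\<in>words ?I k. ?A u * (r' (u i) (w i) * (\<Prod>j\<in>?I - {i}. r 0 (u j) (w j))))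
        = (if w i = p then ?A (w(i := q)) else 0) - (if w i = q then ?A (w(i := p)) else 0)" if i: "i \<in> ?I" for i
    proof -
      have inj: "inj_on (\<lambda>a. w(i := a)) {..<k}" by (rule inj_onI) (metis fun_upd_same)
      have sub: "(\<lambda>a. w(i := a)) ` {..<k} \<subseteq> words ?I k" using w i by auto
      have vanish: "(\<Prod>j\<in>?I - {i}. r 0 (u j) (w j)) = 0" if u: "u \<in> words ?I k - (\<lambda>a. w(i := a)) ` {..<k}" for u
      proof -
        have "\<exists>j\<in>?I - {i}. u j \<noteq> w j"
        proof (rule ccontr)
          assume "\<not> ?thesis"
          then have eq: "u j = w j" if "j \<in> ?I" "j \<noteq> i" for j using that by blast
          have uW: "u \<in> words ?I k" using u by blast
          moreover have ui: "u i < k" using uW i by (rule words_less)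
          moreover have "u = w(i := u i)"
            by (rule words_eqI[OF uW words_upd[OF w i ui]]) (simp add: eq)
          ultimately show False using u by blast
        qed
        then show ?thesis unfolding r0 by (auto simp: prod_zero_iff)
      qed
      have "(\<Sum>u\<in>words ?I k. ?A u * (r' (u i) (w i) * (\<Prod>j\<in>?I - {i}. r 0 (u j) (w j))))
          = (\<Sum>u\<in>(\<lambda>a. w(i := a)) ` {..<k}. ?A u * (r' (u i) (w i) * (\<Prod>j\<in>?I - {i}. r 0 (u j) (w j))))"
        by (rule sum.mono_neutral_right[OF _ sub]) (use vanish in auto)
      also have "\<dots> = (\<Sum>a<k. ?A (w(i := a)) * r' a (w i))"
      proof -
        have "(\<Prod>j\<in>?I - {i}. r 0 ((w(i := a)) j) (w j)) = 1" for a
          by (rule prod.neutral) (simp add: r0)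
        then show ?thesis by (simp add: sum.reindex[OF inj])
      qed
      also have "\<dots> = (if w i = p then ?A (w(i := q)) else 0) - (if w i = q then ?A (w(i := p)) else 0)"
      proof -
        have "?A (w(i := a)) * r' a (w i) = (if a = q then (if w i = p then ?A (w(i := q)) else 0) else 0)
            - (if a = p then (if w i = q then ?A (w(i := p)) else 0) else 0)" for a
          using False by (simp add: r'_def)
        then show ?thesis using pq by (simp add: sum_subtractf)
      qed
      finally show ?thesis .
    qed
    ultimately have "(\<Sum>i\<in>?I. (if w i = p then ?A (w(i := q)) else 0) - (if w i = q then ?A (w(i := p)) else 0)) = 0"
      by simp
    then have "(\<Sum>i\<in>?I. if w i = p then ?A (w(i := q)) else 0) = (\<Sum>i\<in>?I. if w i = q then ?A (w(i := p)) else 0)"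
      by (simp add: sum_subtractf)
    then show ?thesis unfolding replace_sum_def by (simp only: sum.inter_filter finite_atLeastAtMost)
  qed simp
qed

section \<open>The forms of diagrams\<close>

lemma diagram_form_letters:
  assumes I: "finite I" "S \<subseteq> I" and \<pi>: "pairing (I - S) \<pi>" and w: "w \<in> words I k"
  shows "diagram_form scale b k e (diagram_of (I - S) S \<pi>) (letters w) = word_form I S \<pi> w"
proof -
  let ?U = "I - S"
  let ?L = "{x \<in> ?U. x < \<pi> x}"
  note \<pi>U = pairingD[OF \<pi>]
  have fin: "finite ?L" by (rule finite_subset[OF _ I(1)]) blast
  have "b (letters w x) (letters w (\<pi> x)) = (if w (\<pi> x) = w x then 1 else 0)" if "x \<in> ?L" for x
    using that \<pi>U(1)[of x] words_less[OF w] by (simp add: letters_def b_f)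
  then have "(\<Prod>x\<in>?L. b (letters w x) (letters w (\<pi> x))) = (\<Prod>x\<in>?L. if w (\<pi> x) = w x then 1 else 0)"
    by (rule prod.cong[OF refl])
  also have "\<dots> = (if \<forall>x\<in>?L. w (\<pi> x) = w x then 1 else 0)"
  proof (cases "\<forall>x\<in>?L. w (\<pi> x) = w x")
    case True
    show ?thesis unfolding if_P[OF True] by (rule prod.neutral) (use True in simp)
  next
    case False
    then obtain x where x: "x \<in> ?L" "w (\<pi> x) \<noteq> w x" by blast
    show ?thesis
      unfolding if_not_P[OF False] by (rule prod_zero[OF fin], rule bexI[OF _ x(1)]) (use x(2) in simp)
  qed
  also have "(\<forall>x\<in>?L. w (\<pi> x) = w x) \<longleftrightarrow> (\<forall>x\<in>?U. w (\<pi> x) = w x)"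
  proof
    assume L: "\<forall>x\<in>?L. w (\<pi> x) = w x"
    show "\<forall>x\<in>?U. w (\<pi> x) = w x"
    proof
      fix x assume x: "x \<in> ?U"
      consider "x < \<pi> x" | "\<pi> x < x" using \<pi>U(2)[OF x] by linarith
      then show "w (\<pi> x) = w x"
      proof cases
        case 1
        then show ?thesis using L x by blast
      next
        case 2
        then have "\<pi> x \<in> ?L" using \<pi>U[OF x] by simp
        then have "w (\<pi> (\<pi> x)) = w (\<pi> x)" using L by blast
        then show ?thesis using \<pi>U(3)[OF x] by simp
      qed
    qed
  qed blast
  finally have arcs: "(\<Prod>x\<in>?L. b (letters w x) (letters w (\<pi> x))) = (if \<forall>x\<in>?U. w (\<pi> x) = w x then 1 else 0)" .
  show ?thesis
    unfolding diagram_form_diagram_of[OF finite_Diff[OF I(1)]] arcs word_form_def vol_def frame_det_def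
    by (simp add: letters_def)
qed

end

context quadratic_space
begin

text \<open>By 1-regularity each vertex occurs in exactly one factor: in one arc or in one column of the determinant.\<close>

lemma diagram_form_multilinear:
  assumes D: "D \<in> one_regular_diagrams n k"
  shows "diagram_form scale b k e D \<in> multilinear_forms scale n"
proof -
  obtain S \<pi> where D: "D = diagram_of ({1..n} - S) S \<pi>" and \<pi>: "pairing ({1..n} - S) \<pi>"
      and S: "S \<subseteq> {1..n}" "S = {} \<or> card S = k"
    using one_regular_diagrams_cases[OF D] by blast
  let ?U = "{1..n} - S"
  let ?L = "{x \<in> ?U. x < \<pi> x}"
  let ?F = "diagram_form scale b k e D"
  let ?en = "\<lambda>l. sorted_list_of_set S ! l"
  let ?V = "\<lambda>v. if S = {} then 1 else vdet (\<lambda>l. v (?en l))"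
  have form: "?F v = (\<Prod>x\<in>?L. b (v x) (v (\<pi> x))) * ?V v" for v
    unfolding D by (rule diagram_form_diagram_of) simp
  note \<pi>U = pairingD[OF \<pi>]
  have finS: "finite S" using S(1) finite_subset by blast
  have bij: "bij_betw ?en {..<k} S" if "S \<noteq> {}"
    using S(2) that finS by (intro bij_betw_nth) auto
  have V_cong: "?V v = ?V v'" if eq: "\<And>x. x \<in> S \<Longrightarrow> v x = v' x" for v v' :: "nat \<Rightarrow> 'v"
  proof (cases "S = {}")
    case False
    have "vdet (\<lambda>l. v (?en l)) = vdet (\<lambda>l. v' (?en l))"
      by (rule vdet_cong, rule eq) (use bij_betwE[OF bij[OF False]] in simp)
    then show ?thesis by simp
  qed simp
  have slot: "\<exists>G. (\<forall>x. ?F (v(i := x)) = G x) \<and> (\<forall>x y. G (x + y) = G x + G y) \<and> (\<forall>c x. G (scale c x) = c * G x)"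
    if i: "i \<in> {1..n}" for v i
  proof (cases "i \<in> S")
    case True
    then have "S \<noteq> {}" by blast
    note bij = bij[OF this]
    obtain c where c: "c < k" "?en c = i" using bij True by (metis bij_betw_imp_surj_on imageE lessThan_iff)
    have en: "?en l = i \<longleftrightarrow> l = c" if "l < k" for l
      using bij c that unfolding bij_betw_def inj_on_def by (metis lessThan_iff)
    have "?F (v(i := x)) = (\<Prod>z\<in>?L. b (v z) (v (\<pi> z))) * vdet ((\<lambda>l. v (?en l))(c := x))" for x
    proof -
      have "(\<Prod>z\<in>?L. b ((v(i := x)) z) ((v(i := x)) (\<pi> z))) = (\<Prod>z\<in>?L. b (v z) (v (\<pi> z)))"
      proof (rule prod.cong[OF refl])
        fix z assume z: "z \<in> ?L"
        then have "z \<noteq> i" "\<pi> z \<noteq> i" using \<pi>U(1)[of z] True by blast+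
        then show "b ((v(i := x)) z) ((v(i := x)) (\<pi> z)) = b (v z) (v (\<pi> z))" by simp
      qed
      moreover have "vdet (\<lambda>l. (v(i := x)) (?en l)) = vdet ((\<lambda>l. v (?en l))(c := x))"
        by (rule vdet_cong) (simp add: en)
      ultimately show ?thesis unfolding form using \<open>S \<noteq> {}\<close> by (simp only: if_False)
    qed
    then show ?thesis
      by (intro exI[of _ "\<lambda>x. (\<Prod>z\<in>?L. b (v z) (v (\<pi> z))) * vdet ((\<lambda>l. v (?en l))(c := x))"])
         (simp only: vdet_add[OF c(1)] vdet_scale[OF c(1)] distrib_left mult.left_commute simp_thms)
  next
    case False
    then have iU: "i \<in> ?U" using i by simp
    define z where "z = min i (\<pi> i)"
    have z: "z \<in> ?L" "z = i \<or> \<pi> z = i"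
      using \<pi>U[OF iU] iU by (auto simp: z_def min_def)
    have "?F (v(i := x)) = b x (v (\<pi> i)) * ((\<Prod>z\<in>?L - {z}. b (v z) (v (\<pi> z))) * ?V v)" for x
    proof -
      have "(\<Prod>y\<in>?L. b ((v(i := x)) y) ((v(i := x)) (\<pi> y)))
          = b ((v(i := x)) z) ((v(i := x)) (\<pi> z)) * (\<Prod>y\<in>?L - {z}. b ((v(i := x)) y) ((v(i := x)) (\<pi> y)))"
        by (rule prod.remove) (use z in auto)
      also have "(\<Prod>y\<in>?L - {z}. b ((v(i := x)) y) ((v(i := x)) (\<pi> y))) = (\<Prod>y\<in>?L - {z}. b (v y) (v (\<pi> y)))"
      proof (rule prod.cong[OF refl])
        fix y assume y: "y \<in> ?L - {z}"
        have "y \<noteq> i"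
        proof
          assume "y = i"
          then have "y = z" using y by (simp add: z_def min_def)
          then show False using y by blast
        qed
        moreover have "\<pi> y \<noteq> i"
        proof
          assume "\<pi> y = i"
          then have "\<pi> i = y" using \<pi>U(3)[of y] y by blast
          then have "y = z" using y \<open>\<pi> y = i\<close> by (simp add: z_def min_def)
          then show False using y by blast
        qed
        ultimately show "b ((v(i := x)) y) ((v(i := x)) (\<pi> y)) = b (v y) (v (\<pi> y))" by simp
      qed
      also have "b ((v(i := x)) z) ((v(i := x)) (\<pi> z)) = b x (v (\<pi> i))"
      proof (cases "z = i")
        case True
        then show ?thesis using \<pi>U(2)[OF iU] by simp
      next
        case False
        then have "\<pi> z = i" "z = \<pi> i" using z(2) \<pi>U(3)[of z] z(1) by auto
        then show ?thesis using False b_sym by simp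
      qed
      finally have "(\<Prod>y\<in>?L. b ((v(i := x)) y) ((v(i := x)) (\<pi> y)))
          = b x (v (\<pi> i)) * (\<Prod>y\<in>?L - {z}. b (v y) (v (\<pi> y)))" .
      moreover have "?V (v(i := x)) = ?V v" by (rule V_cong) (use False in auto)
      ultimately show ?thesis unfolding form by (simp only: mult.assoc)
    qed
    then show ?thesis
      by (intro exI[of _ "\<lambda>x. b x (v (\<pi> i)) * ((\<Prod>z\<in>?L - {z}. b (v z) (v (\<pi> z))) * ?V v)"])
         (simp only: b_add_left b_scale_left distrib_right mult.assoc simp_thms)
  qed
  show ?thesis
    unfolding multilinear_forms_iff
  proof (intro conjI allI impI ballI)
    fix v v' :: "nat \<Rightarrow> 'v" assume eq: "\<forall>i\<in>{1..n}. v i = v' i"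
    have "?V v = ?V v'" by (rule V_cong) (use eq S(1) in blast)
    moreover have "(\<Prod>x\<in>?L. b (v x) (v (\<pi> x))) = (\<Prod>x\<in>?L. b (v' x) (v' (\<pi> x)))"
    proof (rule prod.cong[OF refl])
      fix x assume "x \<in> ?L"
      then have "x \<in> {1..n}" "\<pi> x \<in> {1..n}" using \<pi>U(1)[of x] by blast+
      then show "b (v x) (v (\<pi> x)) = b (v' x) (v' (\<pi> x))" using eq by simp
    qed
    ultimately show "?F v = ?F v'" unfolding form by simp
  next
    fix v :: "nat \<Rightarrow> 'v" and i x y assume "i \<in> {1..n}"
    from slot[OF this, of v] show "?F (v(i := x + y)) = ?F (v(i := x)) + ?F (v(i := y))" by metis
  next
    fix v :: "nat \<Rightarrow> 'v" and i c x assume "i \<in> {1..n}"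
    from slot[OF this, of v] show "?F (v(i := scale c x)) = c * ?F (v(i := x))" by metis
  qed
qed

lemma diagram_form_SO_invariant:
  assumes D: "D \<in> one_regular_diagrams n k"
  shows "diagram_form scale b k e D \<in> SO_invariants scale b k e n"
  unfolding SO_invariants_def mem_Collect_eq
proof (intro conjI ballI allI)
  show "diagram_form scale b k e D \<in> multilinear_forms scale n" by (rule diagram_form_multilinear[OF D])
  fix g v assume g: "g \<in> special_orthogonal scale b k e"
  have "vdet (\<lambda>l. g (u l)) = vdet u" for u
    using g vdet_linear_map[of g u] unfolding special_orthogonal_def vdet_def by simp
  moreover have "b (g x) (g y) = b x y" for x y using g unfolding special_orthogonal_def by blast
  ultimately show "diagram_form scale b k e D (\<lambda>i. g (v i)) = diagram_form scale b k e D v"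
    unfolding diagram_form_def vdet_def by simp
qed

end

section \<open>Linear algebra of function spaces\<close>

interpretation forms: vector_space "form_scale :: complex \<Rightarrow> ('x \<Rightarrow> complex) \<Rightarrow> 'x \<Rightarrow> complex"
  by (rule vector_space_form_scale)

lemma sum_fun_apply: "(\<Sum>j\<in>J. F j) x = (\<Sum>j\<in>J. F j x)" for F :: "'j \<Rightarrow> 'x \<Rightarrow> complex"
  by (induction J rule: infinite_finite_induct) simp_all

lemma orthogonal_to_span:
  fixes R :: "'x \<Rightarrow> complex" and pt :: "'j \<Rightarrow> 'x"
  assumes "\<And>g. g \<in> B \<Longrightarrow> (\<Sum>j\<in>J. R (pt j) * cnj (g (pt j))) = 0" and g: "g \<in> forms.span B"
  shows "(\<Sum>j\<in>J. R (pt j) * cnj (g (pt j))) = 0"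
proof -
  have "forms.subspace {g. (\<Sum>j\<in>J. R (pt j) * cnj (g (pt j))) = 0}"
  proof (rule forms.subspaceI)
    show "0 \<in> {g. (\<Sum>j\<in>J. R (pt j) * cnj (g (pt j))) = 0}" by simp
  next
    fix g h assume "g \<in> {g. (\<Sum>j\<in>J. R (pt j) * cnj (g (pt j))) = 0}" "h \<in> {g. (\<Sum>j\<in>J. R (pt j) * cnj (g (pt j))) = 0}"
    then show "g + h \<in> {g. (\<Sum>j\<in>J. R (pt j) * cnj (g (pt j))) = 0}"
      by (simp add: distrib_left sum.distrib)
  next
    fix c g assume "g \<in> {g. (\<Sum>j\<in>J. R (pt j) * cnj (g (pt j))) = 0}"
    moreover have "(\<Sum>j\<in>J. R (pt j) * cnj (form_scale c g (pt j))) = cnj c * (\<Sum>j\<in>J. R (pt j) * cnj (g (pt j)))"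
      by (simp add: form_scale_def sum_distrib_left mult.left_commute)
    ultimately show "form_scale c g \<in> {g. (\<Sum>j\<in>J. R (pt j) * cnj (g (pt j))) = 0}" by simp
  qed
  from forms.span_minimal[OF _ this, of B] show ?thesis using assms by blast
qed

text \<open>Gram-Schmidt for the Hermitian form given by evaluation at the points \<open>pt\<close>. This form may be degenerate on functions, but a function of norm zero vanishes at all the points.\<close>

lemma projection_onto_span:
  fixes pt :: "'j \<Rightarrow> 'x"
  assumes "finite B" "finite J"
  shows "\<exists>S\<in>forms.span B. \<forall>g\<in>B. (\<Sum>j\<in>J. (T (pt j) - S (pt j)) * cnj (g (pt j))) = 0"
  using assms(1)
proof (induction B arbitrary: T rule: finite_induct)
  case empty
  show ?case using forms.span_zero by blast
next
  case (insert f B)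
  obtain S0 where S0: "S0 \<in> forms.span B" "\<And>g. g \<in> B \<Longrightarrow> (\<Sum>j\<in>J. (f (pt j) - S0 (pt j)) * cnj (g (pt j))) = 0"
    using insert.IH[of f] by blast
  obtain S1 where S1: "S1 \<in> forms.span B" "\<And>g. g \<in> B \<Longrightarrow> (\<Sum>j\<in>J. (T (pt j) - S1 (pt j)) * cnj (g (pt j))) = 0"
    using insert.IH[of T] by blast
  define f' where "f' j = f (pt j) - S0 (pt j)" for j
  define R where "R j = T (pt j) - S1 (pt j)" for j
  define n2 where "n2 = (\<Sum>j\<in>J. f' j * cnj (f' j))"
  define a where "a = (\<Sum>j\<in>J. R j * cnj (f' j)) / n2"
  let ?S = "S1 + form_scale a (f - S0)"
  have a: "(\<Sum>j\<in>J. R j * cnj (f' j)) = a * n2"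
  proof (cases "n2 = 0")
    case True
    have n2: "n2 = of_real (\<Sum>j\<in>J. (cmod (f' j))\<^sup>2)" unfolding n2_def by (simp only: of_real_sum complex_norm_square)
    have "(\<Sum>j\<in>J. (cmod (f' j))\<^sup>2) = 0" using True unfolding n2 of_real_eq_0_iff .
    then have "f' j = 0" if "j \<in> J" for j
      using that assms(2) by (simp add: sum_nonneg_eq_0_iff)
    then show ?thesis using True by simp
  qed (simp add: a_def)
  have res: "T (pt j) - ?S (pt j) = R j - a * f' j" for j
    by (simp add: R_def f'_def form_scale_def)
  have orth: "(\<Sum>j\<in>J. (R j - a * f' j) * cnj (g (pt j))) = 0" if "g \<in> B" for g
    using S0(2)[OF that] S1(2)[OF that]
    by (simp add: left_diff_distrib sum_subtractf mult.assoc R_def f'_def flip: sum_distrib_left)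
  have orth': "(\<Sum>j\<in>J. (R j - a * f' j) * cnj (S0 (pt j))) = 0"
  proof -
    have eq: "(T - ?S) (pt j) = R j - a * f' j" for j using res[of j] by simp
    have "(\<Sum>j\<in>J. (T - ?S) (pt j) * cnj (S0 (pt j))) = 0"
      by (rule orthogonal_to_span[OF _ S0(1)]) (simp only: eq orth)
    then show ?thesis unfolding eq .
  qed
  have "(\<Sum>j\<in>J. (R j - a * f' j) * cnj (f (pt j)))
      = (\<Sum>j\<in>J. (R j - a * f' j) * cnj (f' j)) + (\<Sum>j\<in>J. (R j - a * f' j) * cnj (S0 (pt j)))"
    unfolding sum.distrib[symmetric] by (rule sum.cong[OF refl]) (simp add: f'_def algebra_simps)
  also have "\<dots> = (\<Sum>j\<in>J. R j * cnj (f' j)) - a * n2"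
    unfolding orth' n2_def by (simp add: left_diff_distrib sum_subtractf sum_distrib_left mult.assoc)
  finally have "(\<Sum>j\<in>J. (R j - a * f' j) * cnj (f (pt j))) = 0" using a by simp
  then have "\<forall>g\<in>insert f B. (\<Sum>j\<in>J. (T (pt j) - ?S (pt j)) * cnj (g (pt j))) = 0"
    unfolding res using orth by blast
  moreover have "?S \<in> forms.span (insert f B)"
  proof (intro forms.span_add forms.span_scale forms.span_diff)
    show "S1 \<in> forms.span (insert f B)" "S0 \<in> forms.span (insert f B)"
      using S0(1) S1(1) forms.span_mono[of B "insert f B"] by blast+
    show "f \<in> forms.span (insert f B)" by (rule forms.span_base) simp
  qed
  ultimately show ?case by blast
qed

text \<open>In a vanishing linear combination consider a maximal index with nonzero coefficient: at its point all other terms vanish.\<close>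

lemma triangular_family_independent:
  fixes F :: "'i \<Rightarrow> 'x \<Rightarrow> complex" and prec :: "'i \<Rightarrow> 'i \<Rightarrow> bool"
  assumes diag: "\<And>i. i \<in> B \<Longrightarrow> F i (pt i) \<noteq> 0"
    and tri: "\<And>i j. i \<in> B \<Longrightarrow> j \<in> B \<Longrightarrow> F j (pt i) \<noteq> 0 \<Longrightarrow> j = i \<or> prec i j"
    and asym: "asymp prec" and trans: "transp prec"
  shows "inj_on F B" "\<not> forms.dependent (F ` B)"
proof -
  show inj: "inj_on F B"
  proof (rule inj_onI, rule ccontr)
    fix i j assume ij: "i \<in> B" "j \<in> B" "F i = F j" "i \<noteq> j"
    have "prec i j" using tri[OF ij(1,2)] diag[OF ij(1)] ij(3,4) by auto
    moreover have "prec j i" using tri[OF ij(2,1)] diag[OF ij(2)] ij(3,4) by auto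
    ultimately show False using asym by (meson asympD)
  qed
  show "\<not> forms.dependent (F ` B)"
  proof
    assume "forms.dependent (F ` B)"
    then obtain t u g0 where t: "finite t" "t \<subseteq> F ` B" "(\<Sum>g\<in>t. form_scale (u g) g) = 0" "g0 \<in> t" "u g0 \<noteq> 0"
      unfolding forms.dependent_explicit by blast
    let ?J = "{i \<in> B. F i \<in> t \<and> u (F i) \<noteq> 0}"
    have inj_J: "inj_on F ?J" using inj by (rule inj_on_subset) blast
    have "F ` ?J \<subseteq> t" by blast
    then have "finite ?J" by (rule finite_imageD[OF finite_subset[OF _ t(1)] inj_J])
    moreover have "?J \<noteq> {}" using t by blast
    moreover have "asymp_on ?J prec" using asym by (rule asymp_on_subset) simp
    moreover have "transp_on ?J prec" using trans by (rule transp_on_subset) simp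
    ultimately obtain i where i: "i \<in> ?J" "\<And>j. j \<in> ?J \<Longrightarrow> j \<noteq> i \<Longrightarrow> \<not> prec i j"
      using Finite_Set.bex_max_element[of ?J prec] by blast
    have "0 = (\<Sum>g\<in>t. form_scale (u g) g) (pt i)" unfolding t(3) by simp
    also have "\<dots> = (\<Sum>g\<in>t. u g * g (pt i))" by (simp add: sum_fun_apply form_scale_def)
    also have "\<dots> = (\<Sum>g\<in>{F i}. u g * g (pt i))"
    proof (rule sum.mono_neutral_right[OF t(1)])
      show "{F i} \<subseteq> t" using i(1) by blast
      show "\<forall>g\<in>t - {F i}. u g * g (pt i) = 0"
      proof
        fix g assume g: "g \<in> t - {F i}"
        then obtain j where j: "j \<in> B" "g = F j" using t(2) by blast
        show "u g * g (pt i) = 0"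
        proof (rule ccontr)
          assume nz: "u g * g (pt i) \<noteq> 0"
          then have "j \<in> ?J" "F j (pt i) \<noteq> 0" using j g by simp_all
          moreover have "j \<noteq> i" using g j by blast
          ultimately show False using tri[of i j] i j(1) by blast
        qed
      qed
    qed
    also have "\<dots> = u (F i) * F i (pt i)" by simp
    finally show False using i(1) diag[of i] by simp
  qed
qed

lemma diagram_less_asymp: "asymp (diagram_less I)"
  by (rule asympI) (auto simp: diagram_less_def)

lemma diagram_less_transp: "transp (diagram_less I)"
  by (rule transpI) (auto simp: diagram_less_def)

lemma diagram_less_wf: "wf {(D', D). diagram_less I D' D}"
proof -
  have "{(D', D). diagram_less I D' D}
      = inv_image (less_than <*lex*> less_than) (\<lambda>D. (\<Sum>(fst D), crossing_sum I (fst D) (snd D)))"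
    by (auto simp: diagram_less_def inv_image_def)
  then show ?thesis by (simp add: wf_lex_prod)
qed

lemma finite_one_regular_diagrams: "finite (one_regular_diagrams n k)"
proof -
  let ?X = "Sigma (Pow {1..n}) (\<lambda>S. {\<pi>. \<pi> permutes ({1..n} - S)})"
  have "finite ?X" by (intro finite_SigmaI finite_permutations) simp_all
  moreover have "one_regular_diagrams n k \<subseteq> (\<lambda>(S, \<pi>). diagram_of ({1..n} - S) S \<pi>) ` ?X"
  proof
    fix D assume "D \<in> one_regular_diagrams n k"
    then obtain S \<pi> where D: "D = diagram_of ({1..n} - S) S \<pi>" "pairing ({1..n} - S) \<pi>" "S \<subseteq> {1..n}"
      using one_regular_diagrams_cases by blast
    then have "(S, \<pi>) \<in> ?X" by (simp add: pairing_def)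
    then show "D \<in> (\<lambda>(S, \<pi>). diagram_of ({1..n} - S) S \<pi>) ` ?X" using D(1) by (intro image_eqI) auto
  qed
  ultimately show ?thesis using finite_surj by blast
qed

section \<open>The basis theorem\<close>

context quadratic_space
begin

lemma SO_invariants_subspace: "forms.subspace (SO_invariants scale b k e n)"
proof (rule forms.subspaceI)
  show "0 \<in> SO_invariants scale b k e n"
    unfolding SO_invariants_def using multilinear_zero by simp
next
  fix S T assume "S \<in> SO_invariants scale b k e n" "T \<in> SO_invariants scale b k e n"
  then have m: "S \<in> multilinear_forms scale n" "T \<in> multilinear_forms scale n"
    and inv: "\<And>g v. g \<in> special_orthogonal scale b k e \<Longrightarrow> S (\<lambda>i. g (v i)) = S v \<and> T (\<lambda>i. g (v i)) = T v"
    unfolding SO_invariants_def by blast+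
  have "(\<lambda>v. \<Sum>j\<in>{False, True}. 1 * (if j then S else T) v) \<in> multilinear_forms scale n"
    by (rule multilinear_lincomb) (use m in auto)
  moreover have "(\<lambda>v. \<Sum>j\<in>{False, True}. 1 * (if j then S else T) v) = S + T" by (simp add: fun_eq_iff add.commute)
  ultimately have "S + T \<in> multilinear_forms scale n" by (simp only:)
  then show "S + T \<in> SO_invariants scale b k e n" unfolding SO_invariants_def using inv by simp
next
  fix c T assume "T \<in> SO_invariants scale b k e n"
  then have m: "T \<in> multilinear_forms scale n"
    and inv: "\<And>g v. g \<in> special_orthogonal scale b k e \<Longrightarrow> T (\<lambda>i. g (v i)) = T v"
    unfolding SO_invariants_def by blast+
  have "(\<lambda>v. \<Sum>j\<in>{()}. c * T v) \<in> multilinear_forms scale n"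
    by (rule multilinear_lincomb) (use m in auto)
  then have "form_scale c T \<in> multilinear_forms scale n" by (simp add: form_scale_def)
  then show "form_scale c T \<in> SO_invariants scale b k e n"
    unfolding SO_invariants_def using inv by (simp add: form_scale_def)
qed

end

context orthonormal_frame
begin

abbreviation dform :: "diagram \<Rightarrow> (nat \<Rightarrow> 'v) \<Rightarrow> complex" where
  "dform \<equiv> diagram_form scale b k e"

text \<open>The difference between the invariant and its projection to the span of the diagrams is an invariant orthogonal to all diagrams.\<close>

lemma SO_invariant_in_span_of_diagrams:
  assumes T: "T \<in> SO_invariants scale b k e n"
  shows "T \<in> forms.span (dform ` one_regular_diagrams n k)"
proof -
  let ?B = "dform ` one_regular_diagrams n k"
  have "finite ?B" using finite_one_regular_diagrams by simp
  then obtain S where S: "S \<in> forms.span ?B"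
    "\<And>g. g \<in> ?B \<Longrightarrow> (\<Sum>w\<in>words {1..n} k. (T (letters w) - S (letters w)) * cnj (g (letters w))) = 0"
    using projection_onto_span[of ?B "words {1..n} k" T letters] by auto
  have "?B \<subseteq> SO_invariants scale b k e n" using diagram_form_SO_invariant by blast
  then have "S \<in> SO_invariants scale b k e n"
    using S(1) forms.span_minimal[OF _ SO_invariants_subspace] by blast
  then have R: "T - S \<in> SO_invariants scale b k e n"
    using T forms.subspace_diff[OF SO_invariants_subspace] by blast
  have "(T - S) (letters w) = 0" if w: "w \<in> words {1..n} k" for w
  proof (rule invariant_orthogonal_to_diagrams_vanishes[OF finite_atLeastAtMost _ _ w])
    show "replace_invariant {1..n} k (\<lambda>w. (T - S) (letters w))"
      by (rule SO_invariant_replace_invariant[OF R])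
    fix S' \<pi> assume S': "S' \<subseteq> {1..n}" "S' = {} \<or> card S' = k" "pairing ({1..n} - S') \<pi>"
    let ?D = "diagram_of ({1..n} - S') S' \<pi>"
    have "?D \<in> one_regular_diagrams n k" using diagram_of_in_one_regular[OF S'(3,1,2)] .
    then have "(\<Sum>w\<in>words {1..n} k. (T (letters w) - S (letters w)) * cnj (dform ?D (letters w))) = 0"
      by (intro S(2)) blast
    moreover have "dform ?D (letters w) = word_form {1..n} S' \<pi> w" if "w \<in> words {1..n} k" for w
      by (rule diagram_form_letters[OF finite_atLeastAtMost S'(1,3) that])
    ultimately show "(\<Sum>w\<in>words {1..n} k. (T - S) (letters w) * cnj (word_form {1..n} S' \<pi> w)) = 0" by simp
  qed
  note vanish = this
  have "T - S \<in> multilinear_forms scale n" using R unfolding SO_invariants_def by blast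
  then have "(T - S) v = 0" for v by (rule multilinear_eq_0_if_words) (rule vanish)
  then have "T = S" by (simp add: fun_eq_iff)
  then show ?thesis using S(1) by simp
qed

text \<open>Straightening terminates because the order on diagrams is well-founded.\<close>

lemma diagram_in_span_of_basis:
  assumes "S \<subseteq> {1..n}" "S = {} \<or> card S = k" "pairing ({1..n} - S) \<pi>"
  shows "dform (diagram_of ({1..n} - S) S \<pi>) \<in> forms.span (dform ` basis_diagrams n k)"
  using assms
proof (induction "(S, \<pi>)" arbitrary: S \<pi> rule: wf_induct_rule[OF diagram_less_wf[of "{1..n}"]])
  case (1 S \<pi>)
  let ?I = "{1..n}"
  let ?D = "\<lambda>S \<pi>. diagram_of (?I - S) S \<pi>"
  note S = "1.prems"(1,2) and \<pi> = "1.prems"(3)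
  show ?case
  proof (cases "?D S \<pi> \<in> basis_diagrams n k")
    case True
    then show ?thesis by (intro forms.span_base imageI)
  next
    case False
    obtain P1 P2 where P: "P1 \<subseteq> ?I - S" "strict_mono_on P1 \<pi>" "\<And>x. x \<in> P1 \<Longrightarrow> x < \<pi> x"
      "P2 \<subseteq> S" "\<And>x y. x \<in> P1 \<Longrightarrow> y \<in> P2 \<Longrightarrow> x < y" "card (P1 \<union> P2) = Suc k"
      by (rule non_basis_diagram_chain[OF refl S \<pi> False]) blast
    obtain G c where G: "finite G"
      "\<And>s. s \<in> G \<Longrightarrow> s permutes ?I \<and> diagram_less ?I (s ` S, relabel s \<pi>) (S, \<pi>)"
      "\<And>w. w \<in> words ?I k \<Longrightarrow> word_form ?I S \<pi> w = (\<Sum>s\<in>G. c s * word_form ?I (s ` S) (relabel s \<pi>) w)"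
      by (rule word_form_straighten[OF finite_atLeastAtMost S \<pi> P(1,2)])
         (rule P(3), assumption, rule P(4), rule P(5), assumption, assumption, rule P(6), blast)
    have valid: "s ` S \<subseteq> ?I" "s ` S = {} \<or> card (s ` S) = k" "pairing (?I - s ` S) (relabel s \<pi>)" if "s \<in> G" for s
    proof -
      have s: "s permutes ?I" using G(2)[OF that] by blast
      show "s ` S \<subseteq> ?I" using S(1) permutes_image[OF s] by blast
      have "card (s ` S) = card S" by (rule card_image, rule inj_on_subset[OF permutes_inj[OF s]]) simp
      then show "s ` S = {} \<or> card (s ` S) = k" using S(2) by blast
      show "pairing (?I - s ` S) (relabel s \<pi>)" by (rule pairing_relabel[OF s S(1) \<pi>])
    qed
    let ?F = "\<lambda>s. dform (?D (s ` S) (relabel s \<pi>))"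
    have ml: "?F s \<in> multilinear_forms scale n" if "s \<in> G" for s
      by (rule diagram_form_multilinear, rule diagram_of_in_one_regular) (use valid[OF that] in blast)+
    have "dform (?D S \<pi>) = (\<lambda>v. \<Sum>s\<in>G. c s * ?F s v)"
    proof (rule multilinear_ext)
      show "dform (?D S \<pi>) \<in> multilinear_forms scale n"
        by (rule diagram_form_multilinear, rule diagram_of_in_one_regular[OF \<pi> S])
      show "(\<lambda>v. \<Sum>s\<in>G. c s * ?F s v) \<in> multilinear_forms scale n"
        by (rule multilinear_lincomb[OF G(1) ml])
      fix w assume w: "w \<in> words ?I k"
      have "?F s (letters w) = word_form ?I (s ` S) (relabel s \<pi>) w" if "s \<in> G" for s
        by (rule diagram_form_letters[OF finite_atLeastAtMost valid(1,3)[OF that] w])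
      then show "dform (?D S \<pi>) (letters w) = (\<Sum>s\<in>G. c s * ?F s (letters w))"
        using G(3)[OF w] diagram_form_letters[OF finite_atLeastAtMost S(1) \<pi> w] by simp
    qed
    also have "\<dots> = (\<Sum>s\<in>G. form_scale (c s) (?F s))"
      by (rule ext) (simp add: sum_fun_apply form_scale_def)
    also have "\<dots> \<in> forms.span (dform ` basis_diagrams n k)"
    proof (intro forms.span_sum forms.span_scale)
      fix s assume s: "s \<in> G"
      show "?F s \<in> forms.span (dform ` basis_diagrams n k)"
        by (rule "1.hyps"[OF _ valid[OF s]]) (use G(2)[OF s] in simp)
    qed
    finally show ?thesis .
  qed
qed

lemma basis_diagrams_family_basis:
  "family_basis form_scale (basis_diagrams n k) dform (SO_invariants scale b k e n)"
proof -
  let ?I = "{1..n}" and ?B = "basis_diagrams n k"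
  have B_sub: "?B \<subseteq> one_regular_diagrams n k" using basis_diagrams_iff by blast
  define good where "good D \<pi> \<longleftrightarrow> D = diagram_of (?I - painted D) (painted D) \<pi> \<and> pairing (?I - painted D) \<pi>" for D \<pi>
  define pi_of where "pi_of D = (SOME \<pi>. good D \<pi>)" for D
  have valid: "painted D \<subseteq> ?I" "painted D = {} \<or> card (painted D) = k"
    "D = diagram_of (?I - painted D) (painted D) (pi_of D)" "pairing (?I - painted D) (pi_of D)"
    if D: "D \<in> one_regular_diagrams n k" for D
  proof -
    obtain S \<pi> where S: "D = diagram_of (?I - S) S \<pi>" "pairing (?I - S) \<pi>" "S \<subseteq> ?I" "S = {} \<or> card S = k"
      using one_regular_diagrams_cases[OF D] by blast
    have "painted D = S" using S(1) by simp
    then show "painted D \<subseteq> ?I" "painted D = {} \<or> card (painted D) = k" using S(3,4) by simp_all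
    have "good D \<pi>" unfolding good_def \<open>painted D = S\<close> using S(1,2) by blast
    then have "good D (pi_of D)" unfolding pi_of_def by (rule someI[of "good D"])
    then show "D = diagram_of (?I - painted D) (painted D) (pi_of D)" "pairing (?I - painted D) (pi_of D)"
      unfolding good_def by blast+
  qed
  define less where "less D D' \<longleftrightarrow> diagram_less ?I (painted D, pi_of D) (painted D', pi_of D')" for D D'
  have colouring: "\<exists>w. w \<in> words ?I k \<and> dform D (letters w) \<noteq> 0 \<and>
      (\<forall>D'\<in>?B. dform D' (letters w) \<noteq> 0 \<longrightarrow> D' = D \<or> less D D')" if D: "D \<in> ?B" for D
  proof -
    let ?S = "painted D" and ?\<pi> = "pi_of D"
    note V = valid[OF subsetD[OF B_sub D]]
    obtain w where w: "w \<in> words ?I k" "\<And>x. x \<in> ?I - ?S \<Longrightarrow> w (?\<pi> x) = w x" "inj_on w ?S"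
      "\<And>x y. x \<in> ?I - ?S \<Longrightarrow> y \<in> ?I - ?S \<Longrightarrow> w x = w y \<Longrightarrow> x < y \<Longrightarrow> ?\<pi> y < ?\<pi> x"
      "\<And>x p. x \<in> ?I - ?S \<Longrightarrow> p \<in> ?S \<Longrightarrow> w x = w p \<Longrightarrow> p < x"
      by (rule basis_diagram_colouring[OF refl V(1,2,4)]) (use D V(3) in simp, blast)
    have eval: "dform D' (letters w) = word_form ?I (painted D') (pi_of D') w" if "D' \<in> ?B" for D'
    proof -
      note V' = valid[OF subsetD[OF B_sub that]]
      show ?thesis using diagram_form_letters[OF finite_atLeastAtMost V'(1,4) w(1)] V'(3) by simp
    qed
    have finS: "finite ?S" using V(1) finite_subset by blast
    have "vol ?S w \<noteq> 0"
      by (rule vol_nonzero[OF finS V(2) w(3)]) (use words_less[OF w(1)] V(1) in blast)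
    then have "word_form ?I ?S ?\<pi> w \<noteq> 0" unfolding word_form_def using w(2) by simp
    then have nzD: "dform D (letters w) \<noteq> 0" unfolding eval[OF D] .
    have tri: "D' = D \<or> less D D'" if D': "D' \<in> ?B" and nz: "dform D' (letters w) \<noteq> 0" for D'
    proof -
      note V' = valid[OF subsetD[OF B_sub D']]
      have nz': "word_form ?I (painted D') (pi_of D') w \<noteq> 0" using nz eval[OF D'] by simp
      have "(painted D', pi_of D') = (?S, ?\<pi>) \<or> diagram_less ?I (?S, ?\<pi>) (painted D', pi_of D')"
        by (rule colouring_triangular[where w = w]) (fact | simp)+
      then show ?thesis using V(3) V'(3) unfolding less_def by (metis prod.inject)
    qed
    show ?thesis using w(1) nzD tri by blast
  qed
  define col where "col D = (SOME w. w \<in> words ?I k \<and> dform D (letters w) \<noteq> 0 \<and>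
      (\<forall>D'\<in>?B. dform D' (letters w) \<noteq> 0 \<longrightarrow> D' = D \<or> less D D'))" for D
  have col: "dform D (letters (col D)) \<noteq> 0"
    "\<And>D'. D' \<in> ?B \<Longrightarrow> dform D' (letters (col D)) \<noteq> 0 \<Longrightarrow> D' = D \<or> less D D'" if D: "D \<in> ?B" for D
    using someI_ex[OF colouring[OF D]] unfolding col_def[symmetric] by blast+
  have asym: "asymp less"
    by (rule asympI) (use diagram_less_asymp[of ?I] in \<open>auto simp: less_def dest: asympD\<close>)
  have trans: "transp less"
    by (rule transpI) (use diagram_less_transp[of ?I] in \<open>auto simp: less_def dest: transpD\<close>)
  have indep: "inj_on dform ?B" "\<not> forms.dependent (dform ` ?B)"
    by (rule triangular_family_independent[where B = ?B and F = dform and pt = "\<lambda>D. letters (col D)" and prec = less];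
        (rule asym trans | (rule col; assumption)))+
  have "dform ` one_regular_diagrams n k \<subseteq> forms.span (dform ` ?B)"
  proof (rule image_subsetI)
    fix D assume "D \<in> one_regular_diagrams n k"
    note V = valid[OF this]
    show "dform D \<in> forms.span (dform ` ?B)"
      using diagram_in_span_of_basis[OF V(1,2,4)] V(3) by simp
  qed
  then have "forms.span (dform ` one_regular_diagrams n k) \<subseteq> forms.span (dform ` ?B)"
    by (rule forms.span_minimal[OF _ forms.subspace_span])
  then have "SO_invariants scale b k e n \<subseteq> forms.span (dform ` ?B)"
    using SO_invariant_in_span_of_diagrams by blast
  moreover have "forms.span (dform ` ?B) \<subseteq> SO_invariants scale b k e n"
    by (rule forms.span_minimal[OF _ SO_invariants_subspace]) (use diagram_form_SO_invariant B_sub in blast)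
  ultimately show ?thesis unfolding family_basis_def using indep by blast
qed

end

section \<open>Incidence and parity\<close>

lemma size_filter_mset_eq_sum: "size (filter_mset P M) = (\<Sum>a\<in>#M. of_bool (P a))"
  by (induction M) auto

lemma one_regular_incidence:
  assumes D: "D \<in> one_regular_diagrams n k" and v: "v \<in> {1..n}"
  shows "if v \<in> painted D then \<not> (\<exists>(i, j)\<in>#arcs D. v = i \<or> v = j)
         else size {#(i, j) \<in># arcs D. v = i \<or> v = j#} = 1"
proof -
  obtain S \<pi> where S: "D = diagram_of ({1..n} - S) S \<pi>" and \<pi>: "pairing ({1..n} - S) \<pi>"
    using one_regular_diagrams_cases[OF D] by blast
  let ?U = "{1..n} - S"
  have arc: "i \<in> ?U" "j \<in> ?U" "i \<noteq> j" if "(i, j) \<in># arcs D" for i j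
    using that pairing_in[OF \<pi>, of i] unfolding S mem_arcs_diagram_of[OF finite_Diff[OF finite_atLeastAtMost]] by auto
  show ?thesis
  proof (cases "v \<in> S")
    case True
    then have "\<not> (\<exists>(i, j)\<in>#arcs D. v = i \<or> v = j)" using arc by blast
    then show ?thesis using True S by simp
  next
    case False
    have "size {#(i, j) \<in># arcs D. v = i \<or> v = j#} = (\<Sum>(i, j)\<in>#arcs D. of_bool (i = v) + of_bool (j = v))"
      unfolding size_filter_mset_eq_sum
    proof (rule arg_cong[of _ _ sum_mset], rule image_mset_cong)
      fix a assume "a \<in># arcs D"
      then show "of_bool (case a of (i, j) \<Rightarrow> v = i \<or> v = j) = ((case a of (i, j) \<Rightarrow> of_bool (i = v) + of_bool (j = v)) :: nat)"
        using arc(3)[of "fst a" "snd a"] by (cases a) auto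
    qed
    also have "\<dots> = of_bool (v \<in> ?U)" unfolding S by (rule degree_diagram_of[OF _ \<pi>]) simp
    finally show ?thesis using False v S by (simp del: arcs_diagram_of)
  qed
qed

lemma one_regular_parity:
  assumes D: "D \<in> one_regular_diagrams n k"
  shows "even (n - card (painted D))" "card (painted D) \<le> n" "has_hyperedge D \<Longrightarrow> card (painted D) = k"
    "\<not> has_hyperedge D \<Longrightarrow> card (painted D) = 0"
proof -
  obtain S \<pi> where S: "D = diagram_of ({1..n} - S) S \<pi>" "S \<subseteq> {1..n}" "S = {} \<or> card S = k" and \<pi>: "pairing ({1..n} - S) \<pi>"
    using one_regular_diagrams_cases[OF D] by blast
  have "even (card ({1..n} - S))"
    by (rule pairing_even_card[where \<pi> = \<pi>]) (use pairingD[OF \<pi>] in blast)+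
  moreover have "card ({1..n} - S) = n - card S" using S(2) finite_subset by (subst card_Diff_subset) auto
  ultimately show "even (n - card (painted D))" using S(1) by simp
  show "card (painted D) \<le> n" using card_mono[OF _ S(2)] S(1) by simp
  show "has_hyperedge D \<Longrightarrow> card (painted D) = k" "\<not> has_hyperedge D \<Longrightarrow> card (painted D) = 0"
    using S(1,3) by (auto simp: has_hyperedge_def)
qed

theorem proposition4p4p2:
  fixes scale :: "complex \<Rightarrow> 'v::ab_group_add \<Rightarrow> 'v"
    and b :: "'v \<Rightarrow> 'v \<Rightarrow> complex"
    and e :: "nat \<Rightarrow> 'v"
    and k n :: nat
  assumes "vector_space scale"
    and "family_basis scale {..<k} e UNIV"
    and "symmetric_bilinear_form scale b"
    and "nondegenerate_form b"
  shows "family_basis form_scale (basis_diagrams n k) (diagram_form scale b k e)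
           (SO_invariants scale b k e n)
       \<and> (\<forall>D\<in>basis_diagrams n k.
            (card (painted D) = 0 \<or> card (painted D) = k) \<and>
            (\<forall>v\<in>{1..n}.
               if v \<in> painted D then \<not> (\<exists>(i, j)\<in>#arcs D. v = i \<or> v = j)
               else size {#(i, j) \<in># arcs D. v = i \<or> v = j#} = 1))
       \<and> (k \<le> n \<longrightarrow>
            (even n \<and> even k \<and> 0 < k \<longrightarrow>
               (\<exists>D\<in>basis_diagrams n k. \<not> has_hyperedge D) \<and>
               (\<exists>D\<in>basis_diagrams n k. has_hyperedge D)) \<and>
            (odd n \<and> odd k \<longrightarrow> (\<forall>D\<in>basis_diagrams n k. has_hyperedge D)) \<and>
            (even n \<and> odd k \<longrightarrow> (\<forall>D\<in>basis_diagrams n k. \<not> has_hyperedge D)) \<and>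
            (odd n \<and> even k \<longrightarrow>
               basis_diagrams n k = {} \<and> SO_invariants scale b k e n = {0}))"
proof -
  let ?B = "basis_diagrams n k"
  interpret quadratic_space scale b e k
    by (rule quadratic_space.intro[OF assms(1)]) (unfold_locales; fact)
  obtain f where f: "orthonormal f k" "\<And>x. x = (\<Sum>i<k. scale (b x (f i)) (f i))"
    by (rule orthonormal_frame_exists) blast
  interpret orthonormal_frame scale b e k f
    by unfold_locales (fact f)+
  have family: "family_basis form_scale ?B (diagram_form scale b k e) (SO_invariants scale b k e n)"
    by (rule basis_diagrams_family_basis)
  have B: "D \<in> one_regular_diagrams n k" if "D \<in> ?B" for D using that basis_diagrams_iff by blast
  note parity = one_regular_parity[OF B]
  have counts: "card (painted D) = 0 \<or> card (painted D) = k" if "D \<in> ?B" for D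
    using parity(3,4)[OF that] by blast
  have "\<exists>D\<in>?B. \<not> has_hyperedge D" "\<exists>D\<in>?B. has_hyperedge D" if c: "k \<le> n" "even n" "even k" "0 < k"
  proof -
    obtain D where "D \<in> ?B" "painted D = {}"
      using rainbow_basis_diagram[of "{}" 0 n k] c by auto
    then show "\<exists>D\<in>?B. \<not> has_hyperedge D" by (auto simp: has_hyperedge_def)
    obtain D where "D \<in> ?B" "painted D = {1..k}"
      using rainbow_basis_diagram[of "{1..k}" k n k] c by auto
    then show "\<exists>D\<in>?B. has_hyperedge D" using c(4) by (intro bexI[of _ D]) (simp_all add: has_hyperedge_def)
  qed
  moreover have "has_hyperedge D" if "odd n" "D \<in> ?B" for D
    using parity(1,4)[OF that(2)] that(1) by (cases "has_hyperedge D") simp_all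
  moreover have "\<not> has_hyperedge D" if "odd (n + k)" "D \<in> ?B" for D
    using parity(1-3)[OF that(2)] that(1) by (cases "has_hyperedge D") simp_all
  moreover have "?B = {} \<and> SO_invariants scale b k e n = {0}" if "odd n" "even k"
  proof -
    have "?B = {}" using calculation(3,4) that by auto
    moreover from this have "SO_invariants scale b k e n = forms.span {}"
      using family unfolding family_basis_def by simp
    ultimately show ?thesis by (simp add: forms.span_empty)
  qed
  moreover have "\<forall>v\<in>{1..n}. if v \<in> painted D then \<not> (\<exists>(i, j)\<in>#arcs D. v = i \<or> v = j)
      else size {#(i, j) \<in># arcs D. v = i \<or> v = j#} = 1" if "D \<in> ?B" for D
    using one_regular_incidence[OF B[OF that]] by blast
  ultimately show ?thesis using family counts by (simp del: One_nat_def)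
qed

end
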